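(* Let $K$ be a field, $q,Q\in K^{\times}$ with $q^2\neq1$, $n,d\ge1$, and assume $f^{\mathrm B}_d(Q,q)=\prod_{i=1-d}^{d-1}(Q^{-2}+q^{2i})\neq0$. The algebra $S^{\mathrm B}_{Q,q}(n,d)$ is semisimple if and only if one of the following holds: (i) $n=1$; (ii) $q$ is not a root of unity; (iii) $q^2$ is a primitive $l$th root of unity and $d<l$; (iv) $n=2$ and $d$ is arbitrary.
   Context: Put $I(n)=[-r,r]\cap\mathbb Z$ if $n=2r+1$ and $I(n)=([-r,r]\cap\mathbb Z)\setminus\{0\}$ if $n=2r$. $\mathcal H^{\mathrm B}_{Q,q}(d)$ is the $K$-algebra generated by $T_0,\dots,T_{d-1}$ with relations $T_iT_{i+1}T_i=T_{i+1}T_iT_{i+1}$ $(1\le i\le d-2)$, $(T_0T_1)^2=(T_1T_0)^2$, $T_iT_j=T_jT_i$ $(|i-j|>1)$, $T_0^2=(Q^{-1}-Q)T_0+1$, $T_i^2=(q^{-1}-q)T_i+1$ $(1\le i\le d-1)$. $V$ has basis $\{v_i\mid i\in I(n)\}$; for $\mu\in I(n)^d$, $v_\mu=v_{\mu_1}\otimes\cdots\otimes v_{\mu_d}$. For $1\le t\le d-1$, $\mu\cdot s_t$ is $\mu$ with entries $\mu_t,\mu_{t+1}$ exchanged, and $\mu\cdot s_0=(-\mu_1,\mu_2,\dots,\mu_d)$. $V^{\otimes d}$ is a right $\mathcal H^{\mathrm B}_{Q,q}(d)$-module via: $v_\mu T_t=v_{\mu\cdot s_t}$ if $\mu_t<\mu_{t+1}$,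 $q^{-1}v_{\mu\cdot s_t}$ if $\mu_t=\mu_{t+1}$, $v_{\mu\cdot s_t}+(q^{-1}-q)v_\mu$ if $\mu_t>\mu_{t+1}$; $v_\mu T_0=v_{\mu\cdot s_0}$ if $\mu_1>0$, $Q^{-1}v_{\mu\cdot s_0}$ if $\mu_1=0$, $v_{\mu\cdot s_0}+(Q^{-1}-Q)v_\mu$ if $\mu_1<0$. $S^{\mathrm B}_{Q,q}(n,d)=\operatorname{End}_{\mathcal H^{\mathrm B}_{Q,q}(d)}(V^{\otimes d})$. *)

theory Defs
  imports Complex_Main "HOL-Library.Poly_Mapping" "HOL-Algebra.QuotRing"
begin

section \<open>Semisimple rings\<close>

definition left_ideal :: "('a, 'm) ring_scheme \<Rightarrow> 'a set \<Rightarrow> bool" where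
  "left_ideal R I \<longleftrightarrow> additive_subgroup I R \<and>
     (\<forall>r \<in> carrier R. \<forall>a \<in> I. r \<otimes>\<^bsub>R\<^esub> a \<in> I)"

definition simple_left_ideal :: "('a, 'm) ring_scheme \<Rightarrow> 'a set \<Rightarrow> bool" where
  "simple_left_ideal R I \<longleftrightarrow> left_ideal R I \<and> I \<noteq> {\<zero>\<^bsub>R\<^esub>} \<and>
     (\<forall>J. left_ideal R J \<and> J \<subseteq> I \<longrightarrow> J = {\<zero>\<^bsub>R\<^esub>} \<or> J = I)"

text \<open>
  A ring is semisimple if its left regular module is a direct sum of simple submodules.  As the ring
  has a unit, such a decomposition has only finitely many summands.
\<close>

definition semisimple_ring :: "('a, 'm) ring_scheme \<Rightarrow> bool" where
  "semisimple_ring R \<longleftrightarrow> ring R \<and>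
     (\<exists>F. finite F \<and> (\<forall>I \<in> F. simple_left_ideal R I) \<and>
        (\<forall>x \<in> carrier R. \<exists>!f. f \<in> (\<Pi>\<^sub>E I\<in>F. I) \<and> x = finsum R f F))"

section \<open>Linear extension\<close>

definition scale :: "'k::field \<Rightarrow> ('a \<Rightarrow>\<^sub>0 'k) \<Rightarrow> ('a \<Rightarrow>\<^sub>0 'k)" where
  "scale c = Poly_Mapping.map ((*) c)"

definition lin_ext :: "('a \<Rightarrow> ('b \<Rightarrow>\<^sub>0 'k::field)) \<Rightarrow> ('a \<Rightarrow>\<^sub>0 'k) \<Rightarrow> ('b \<Rightarrow>\<^sub>0 'k)" where
  "lin_ext g x = (\<Sum>k \<in> Poly_Mapping.keys x. scale (Poly_Mapping.lookup x k) (g k))"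

section \<open>The Hecke algebra of type B\<close>

text \<open>
  Words in the generators form the free monoid; it is written additively, so that the convolution
  product of \<open>word \<Rightarrow>\<^sub>0 'k\<close> is the product of the free algebra.
\<close>

datatype word = Word (letters: "nat list")

instantiation word :: monoid_add
begin

definition zero_word :: word where "0 = Word []"

definition plus_word :: "word \<Rightarrow> word \<Rightarrow> word" where "u + v = Word (letters u @ letters v)"

instance by standard (simp_all add: zero_word_def plus_word_def)

end

definition free_algebra :: "nat \<Rightarrow> (word \<Rightarrow>\<^sub>0 'k::field) ring" where
  "free_algebra d =
     \<lparr>carrier = {a. \<forall>w \<in> Poly_Mapping.keys a. set (letters w) \<subseteq> {..<d}},
      mult = (*), one = 1, zero = 0, add = (+)\<rparr>"

definition gen :: "nat \<Rightarrow> (word \<Rightarrow>\<^sub>0 'k::field)" where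
  "gen i = Poly_Mapping.single (Word [i]) 1"

definition scalar :: "'k::field \<Rightarrow> (word \<Rightarrow>\<^sub>0 'k)" where
  "scalar c = Poly_Mapping.single 0 c"

definition hecke_relators :: "'k::field \<Rightarrow> 'k \<Rightarrow> nat \<Rightarrow> (word \<Rightarrow>\<^sub>0 'k) set" where
  "hecke_relators Q q d =
     {gen i * gen (i+1) * gen i - gen (i+1) * gen i * gen (i+1) | i. 1 \<le> i \<and> i + 2 \<le> d} \<union>
     (if 2 \<le> d then {(gen 0 * gen 1)^2 - (gen 1 * gen 0)^2} else {}) \<union>
     {gen i * gen j - gen j * gen i | i j. i < d \<and> j < d \<and> \<bar>int i - int j\<bar> > 1} \<union>
     (if 1 \<le> d then {(gen 0)^2 - (scalar (inverse Q - Q) * gen 0 + 1)} else {}) \<union>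
     {(gen i)^2 - (scalar (inverse q - q) * gen i + 1) | i. 1 \<le> i \<and> i < d}"

definition hecke_ideal :: "'k::field \<Rightarrow> 'k \<Rightarrow> nat \<Rightarrow> (word \<Rightarrow>\<^sub>0 'k) set" where
  "hecke_ideal Q q d = genideal (free_algebra d) (hecke_relators Q q d)"

definition hecke_B :: "'k::field \<Rightarrow> 'k \<Rightarrow> nat \<Rightarrow> (word \<Rightarrow>\<^sub>0 'k) set ring" where
  "hecke_B Q q d = free_algebra d Quot hecke_ideal Q q d"

section \<open>The tensor space and its endomorphism algebra\<close>

definition index_set :: "nat \<Rightarrow> int set" where
  "index_set n = (let r = int (n div 2) in if odd n then {-r..r} else {-r..r} - {0})"

definition multi_indices :: "nat \<Rightarrow> nat \<Rightarrow> int list set" where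
  "multi_indices n d = {\<mu>. length \<mu> = d \<and> set \<mu> \<subseteq> index_set n}"

text \<open>
  The \<open>d\<close>-fold tensor power of \<open>V\<close> is represented by coordinates with respect to its basis
  \<open>basis_vec \<mu>\<close>, where \<open>\<mu>\<close> ranges over the multi-indices.
\<close>

definition tensor_space :: "nat \<Rightarrow> nat \<Rightarrow> (int list \<Rightarrow>\<^sub>0 'k::field) set" where
  "tensor_space n d = {x. Poly_Mapping.keys x \<subseteq> multi_indices n d}"

definition basis_vec :: "int list \<Rightarrow> (int list \<Rightarrow>\<^sub>0 'k::field)" where
  "basis_vec \<mu> = Poly_Mapping.single \<mu> 1"

text \<open>
  List positions count from \<open>0\<close>: the entry \<open>\<mu>\<^sub>t\<close> of a multi-index is \<open>\<mu> ! (t - 1)\<close>.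
\<close>

definition reflect :: "int list \<Rightarrow> nat \<Rightarrow> int list" where
  "reflect \<mu> t = (if t = 0 then \<mu>[0 := - (\<mu> ! 0)] else \<mu>[t - 1 := \<mu> ! t, t := \<mu> ! (t - 1)])"

definition basis_act :: "'k::field \<Rightarrow> 'k \<Rightarrow> nat \<Rightarrow> int list \<Rightarrow> (int list \<Rightarrow>\<^sub>0 'k)" where
  "basis_act Q q t \<mu> =
     (if t = 0 then
        (if \<mu> ! 0 > 0 then basis_vec (reflect \<mu> 0)
         else if \<mu> ! 0 = 0 then scale (inverse Q) (basis_vec (reflect \<mu> 0))
         else basis_vec (reflect \<mu> 0) + scale (inverse Q - Q) (basis_vec \<mu>))
      else
        (if \<mu> ! (t - 1) < \<mu> ! t then basis_vec (reflect \<mu> t)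
         else if \<mu> ! (t - 1) = \<mu> ! t then scale (inverse q) (basis_vec (reflect \<mu> t))
         else basis_vec (reflect \<mu> t) + scale (inverse q - q) (basis_vec \<mu>)))"

definition gen_act ::
    "'k::field \<Rightarrow> 'k \<Rightarrow> (int list \<Rightarrow>\<^sub>0 'k) \<Rightarrow> nat \<Rightarrow> (int list \<Rightarrow>\<^sub>0 'k)" where
  "gen_act Q q x t = lin_ext (basis_act Q q t) x"

text \<open>The action is a right action: the leftmost letter of a word acts first.\<close>

definition word_act ::
    "'k::field \<Rightarrow> 'k \<Rightarrow> (int list \<Rightarrow>\<^sub>0 'k) \<Rightarrow> word \<Rightarrow> (int list \<Rightarrow>\<^sub>0 'k)" where
  "word_act Q q x w = foldl (gen_act Q q) x (letters w)"

definition free_act ::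
    "'k::field \<Rightarrow> 'k \<Rightarrow> (int list \<Rightarrow>\<^sub>0 'k) \<Rightarrow> (word \<Rightarrow>\<^sub>0 'k) \<Rightarrow> (int list \<Rightarrow>\<^sub>0 'k)" where
  "free_act Q q x a = lin_ext (word_act Q q x) a"

text \<open>
  Elements of the Hecke algebra are cosets of the ideal of relations.  A coset acts through any of
  its representatives; \<open>hecke_act_coset\<close> below shows that the choice does not matter.
\<close>

definition hecke_act ::
    "'k::field \<Rightarrow> 'k \<Rightarrow> (int list \<Rightarrow>\<^sub>0 'k) \<Rightarrow> (word \<Rightarrow>\<^sub>0 'k) set \<Rightarrow> (int list \<Rightarrow>\<^sub>0 'k)" where
  "hecke_act Q q x h = free_act Q q x (SOME a. a \<in> h)"

text \<open>
  Endomorphisms of the right module are functions on the tensor space, made extensional outside it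
  so that equal endomorphisms are equal elements.  Linearity over the field is the case of scalar
  elements of the Hecke algebra.
\<close>

definition schur_B :: "'k::field \<Rightarrow> 'k \<Rightarrow> nat \<Rightarrow> nat \<Rightarrow>
    ((int list \<Rightarrow>\<^sub>0 'k) \<Rightarrow> (int list \<Rightarrow>\<^sub>0 'k)) ring" where
  "schur_B Q q n d =
     (let V = tensor_space n d in
      \<lparr>carrier = {f \<in> V \<rightarrow>\<^sub>E V.
          (\<forall>x \<in> V. \<forall>y \<in> V. f (x + y) = f x + f y) \<and>
          (\<forall>h \<in> carrier (hecke_B Q q d). \<forall>x \<in> V. f (hecke_act Q q x h) = hecke_act Q q (f x) h)},
       mult = (\<lambda>f g. compose V f g), one = (\<lambda>x\<in>V. x),
       zero = (\<lambda>x\<in>V. 0), add = (\<lambda>f g. \<lambda>x\<in>V. f x + g x)\<rparr>)"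

definition f_B :: "nat \<Rightarrow> 'k::field \<Rightarrow> 'k \<Rightarrow> 'k" where
  "f_B d Q q = (\<Prod>i \<in> {1 - int d..int d - 1}. Q powi (-2) + q powi (2 * i))"

definition root_of_unity :: "'k::field \<Rightarrow> bool" where
  "root_of_unity x \<longleftrightarrow> (\<exists>m::nat. m > 0 \<and> x ^ m = 1)"

definition primitive_root_of_unity :: "nat \<Rightarrow> 'k::field \<Rightarrow> bool" where
  "primitive_root_of_unity l x \<longleftrightarrow> l > 0 \<and> x ^ l = 1 \<and> (\<forall>m. 0 < m \<and> m < l \<longrightarrow> x ^ m \<noteq> 1)"

section \<open>Well-definedness\<close>

lemma lookup_scale [simp]:
  "Poly_Mapping.lookup (scale c x) k = c * Poly_Mapping.lookup x k"
  by (simp add: scale_def Poly_Mapping.map.rep_eq when_def)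

lemma scale_single [simp]: "scale c (Poly_Mapping.single k b) = Poly_Mapping.single k (c * b)"
  by (rule poly_mapping_eqI) (simp add: lookup_single when_def)

interpretation scale: vector_space scale
  by unfold_locales (auto intro!: poly_mapping_eqI simp: lookup_add algebra_simps)

lemma keys_scale: "Poly_Mapping.keys (scale c x) \<subseteq> Poly_Mapping.keys x"
  by (auto simp: in_keys_iff)

lemma lin_ext_superset:
  assumes "finite A" "Poly_Mapping.keys x \<subseteq> A"
  shows "lin_ext g x = (\<Sum>k \<in> A. scale (Poly_Mapping.lookup x k) (g k))"
  unfolding lin_ext_def
  by (rule sum.mono_neutral_left) (use assms in \<open>auto simp: in_keys_iff\<close>)

lemma lin_ext_single [simp]: "lin_ext g (Poly_Mapping.single k c) = scale c (g k)"
  by (subst lin_ext_superset[of "{k}"]) auto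

lemma lin_ext_add: "lin_ext g (x + y) = lin_ext g x + lin_ext g y"
proof -
  let ?A = "Poly_Mapping.keys x \<union> Poly_Mapping.keys y"
  have "Poly_Mapping.keys (x + y) \<subseteq> ?A"
    by (rule Poly_Mapping.keys_add)
  then show ?thesis
    by (simp add: lin_ext_superset[of ?A] lookup_add scale.scale_left_distrib sum.distrib)
qed

lemma lin_ext_scale: "lin_ext g (scale c x) = scale c (lin_ext g x)"
  by (simp add: lin_ext_superset[of "Poly_Mapping.keys x"] keys_scale scale.scale_sum_right)

lemma lin_ext_0 [simp]: "lin_ext g 0 = 0"
  by (simp add: lin_ext_def)

lemma lin_ext_diff: "lin_ext g (x - y) = lin_ext g x - lin_ext g y"
  using lin_ext_add[of g "x - y" y] by (simp add: algebra_simps)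

lemma poly_mapping_expand:
  fixes x :: "'a \<Rightarrow>\<^sub>0 'k::field"
  shows "x = (\<Sum>k \<in> Poly_Mapping.keys x. Poly_Mapping.single k (Poly_Mapping.lookup x k))"
  by (rule poly_mapping_eqI)
     (auto simp: lookup_sum lookup_single when_def in_keys_iff intro!: sum.neutral)

lemma poly_mapping_span_induct [case_names zero single add]:
  fixes x :: "'a \<Rightarrow>\<^sub>0 'k::field"
  assumes "P 0"
    and "\<And>k c. k \<in> Poly_Mapping.keys x \<Longrightarrow> P (Poly_Mapping.single k c)"
    and "\<And>y z. P y \<Longrightarrow> P z \<Longrightarrow> P (y + z)"
  shows "P x"
proof -
  have "P (\<Sum>k \<in> A. Poly_Mapping.single k (Poly_Mapping.lookup x k))"
    if "finite A" "A \<subseteq> Poly_Mapping.keys x" for A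
    using that by (induction A rule: finite_induct) (auto intro: assms)
  then show ?thesis
    by (subst poly_mapping_expand) simp
qed

lemma free_algebra_simps:
  "mult (free_algebra d) = (*)" "one (free_algebra d) = 1"
  "zero (free_algebra d) = 0" "add (free_algebra d) = (+)"
  by (simp_all add: free_algebra_def)

lemma free_algebra_ring: "ring (free_algebra d :: (word \<Rightarrow>\<^sub>0 'k::field) ring)"
proof -
  let ?R = "free_algebra d :: (word \<Rightarrow>\<^sub>0 'k) ring"
  have add: "a + b \<in> carrier ?R" if "a \<in> carrier ?R" "b \<in> carrier ?R" for a b
    using that Poly_Mapping.keys_add[of a b] by (fastforce simp: free_algebra_def)
  have mult: "a * b \<in> carrier ?R" if "a \<in> carrier ?R" "b \<in> carrier ?R" for a b
    using that Poly_Mapping.keys_mult[of a b]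
    by (fastforce simp: free_algebra_def plus_word_def)
  have zero: "0 \<in> carrier ?R" and one: "1 \<in> carrier ?R"
    by (simp_all add: free_algebra_def zero_word_def)
  have uminus: "- a \<in> carrier ?R" if "a \<in> carrier ?R" for a
    using that by (simp add: free_algebra_def)
  have "abelian_group ?R"
  proof (rule abelian_groupI)
    fix x assume "x \<in> carrier ?R"
    then show "\<exists>y \<in> carrier ?R. y \<oplus>\<^bsub>?R\<^esub> x = \<zero>\<^bsub>?R\<^esub>"
      by (intro bexI[of _ "- x"]) (simp_all add: free_algebra_simps uminus)
  qed (simp_all add: free_algebra_simps add zero ac_simps)
  moreover have "monoid ?R"
    by (rule monoidI) (simp_all add: free_algebra_simps mult one mult.assoc)
  ultimately show ?thesis
    by (rule ringI) (simp_all add: free_algebra_simps distrib_left distrib_right)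
qed

lemma hecke_relators_carrier:
  "hecke_relators Q q d \<subseteq> carrier (free_algebra d :: (word \<Rightarrow>\<^sub>0 'k::field) ring)"
proof -
  let ?R = "free_algebra d :: (word \<Rightarrow>\<^sub>0 'k) ring"
  interpret ring ?R by (rule free_algebra_ring)
  have mult: "a * b \<in> carrier ?R" if "a \<in> carrier ?R" "b \<in> carrier ?R" for a b
    using m_closed[OF that] by (simp add: free_algebra_def)
  have add: "a + b \<in> carrier ?R" if "a \<in> carrier ?R" "b \<in> carrier ?R" for a b
    using a_closed[OF that] by (simp add: free_algebra_def)
  have diff: "a - b \<in> carrier ?R" if "a \<in> carrier ?R" "b \<in> carrier ?R" for a b
    using that Poly_Mapping.keys_diff[of a b] by (fastforce simp: free_algebra_def)
  have one: "1 \<in> carrier ?R"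
    using one_closed by (simp add: free_algebra_def)
  have gen: "gen i \<in> carrier ?R" if "i < d" for i
    using that by (simp add: free_algebra_def gen_def)
  have scalar: "scalar c \<in> carrier ?R" for c
    by (simp add: free_algebra_def scalar_def zero_word_def)
  show ?thesis
    unfolding hecke_relators_def power2_eq_square
    by (auto intro!: mult add diff one gen scalar)
qed

lemma hecke_ideal_ideal: "ideal (hecke_ideal Q q d) (free_algebra d)"
  unfolding hecke_ideal_def
  by (rule ring.genideal_ideal[OF free_algebra_ring hecke_relators_carrier])

lemma gen_act_add: "gen_act Q q (x + y) t = gen_act Q q x t + gen_act Q q y t"
  by (simp add: gen_act_def lin_ext_add)

lemma gen_act_scale: "gen_act Q q (scale c x) t = scale c (gen_act Q q x t)"
  by (simp add: gen_act_def lin_ext_scale)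

lemma gen_act_basis_vec: "gen_act Q q (basis_vec \<mu>) t = basis_act Q q t \<mu>"
  by (simp add: gen_act_def basis_vec_def)

lemma word_act_add: "word_act Q q (x + y) w = word_act Q q x w + word_act Q q y w"
proof -
  have "foldl (gen_act Q q) (x + y) ts = foldl (gen_act Q q) x ts + foldl (gen_act Q q) y ts" for ts
    by (induction ts arbitrary: x y) (simp_all add: gen_act_add)
  then show ?thesis
    by (simp add: word_act_def)
qed

lemma word_act_scale: "word_act Q q (scale c x) w = scale c (word_act Q q x w)"
proof -
  have "foldl (gen_act Q q) (scale c x) ts = scale c (foldl (gen_act Q q) x ts)" for ts
    by (induction ts arbitrary: x) (simp_all add: gen_act_scale)
  then show ?thesis
    by (simp add: word_act_def)
qed

lemma word_act_plus: "word_act Q q x (u + w) = word_act Q q (word_act Q q x u) w"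
  by (simp add: word_act_def plus_word_def)

lemma free_act_add: "free_act Q q (x + y) a = free_act Q q x a + free_act Q q y a"
  by (simp add: free_act_def lin_ext_def word_act_add scale.scale_right_distrib sum.distrib)

lemma free_act_scale: "free_act Q q (scale c x) a = scale c (free_act Q q x a)"
  by (simp add: free_act_def lin_ext_def word_act_scale scale.scale_sum_right mult.commute)

lemma free_act_zero [simp]: "free_act Q q 0 a = 0"
  using free_act_scale[of Q q 0 0 a] by simp

lemma free_act_plus: "free_act Q q x (a + b) = free_act Q q x a + free_act Q q x b"
  by (simp add: free_act_def lin_ext_add)

lemma free_act_diff: "free_act Q q x (a - b) = free_act Q q x a - free_act Q q x b"
  by (simp add: free_act_def lin_ext_diff)

lemma free_act_single: "free_act Q q x (Poly_Mapping.single w c) = scale c (word_act Q q x w)"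
  by (simp add: free_act_def)

lemma free_act_mult: "free_act Q q x (a * b) = free_act Q q (free_act Q q x a) b"
proof (induction b rule: poly_mapping_span_induct)
  case zero
  show ?case by (simp add: free_act_def)
next
  case (single w c)
  show ?case
  proof (induction a rule: poly_mapping_span_induct)
    case zero
    show ?case by (simp add: free_act_def[of _ _ _ 0])
  next
    case (single u e)
    show ?case
      by (simp add: mult_single free_act_single word_act_plus word_act_scale mult.commute)
  next
    case (add y z)
    then show ?case by (simp add: distrib_right free_act_plus free_act_add)
  qed
next
  case (add y z)
  then show ?case by (simp add: distrib_left free_act_plus)
qed

lemma free_act_gen: "free_act Q q x (gen i) = gen_act Q q x i"
  by (simp add: gen_def free_act_single word_act_def)

lemma free_act_scalar: "free_act Q q x (scalar c) = scale c x"
  by (simp add: scalar_def free_act_single word_act_def zero_word_def)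

lemma free_act_one: "free_act Q q x 1 = x"
  using free_act_scalar[of Q q x 1] by (simp add: scalar_def)

lemma tensor_space_zero: "0 \<in> tensor_space n d"
  by (simp add: tensor_space_def)

lemma tensor_space_add:
  "x \<in> tensor_space n d \<Longrightarrow> y \<in> tensor_space n d \<Longrightarrow> x + y \<in> tensor_space n d"
  using Poly_Mapping.keys_add[of x y] by (auto simp: tensor_space_def)

lemma tensor_space_scale: "x \<in> tensor_space n d \<Longrightarrow> scale c x \<in> tensor_space n d"
  using keys_scale[of c x] by (auto simp: tensor_space_def)

lemma tensor_space_uminus: "x \<in> tensor_space n d \<Longrightarrow> - x \<in> tensor_space n d"
  by (simp add: tensor_space_def)

lemma tensor_space_lin_ext:
  assumes "\<And>k. k \<in> Poly_Mapping.keys x \<Longrightarrow> g k \<in> tensor_space n d"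
  shows "lin_ext g x \<in> tensor_space n d"
proof -
  have "(\<Sum>k \<in> A. scale (Poly_Mapping.lookup x k) (g k)) \<in> tensor_space n d"
    if "finite A" "A \<subseteq> Poly_Mapping.keys x" for A
    using that
    by (induction A rule: finite_induct)
       (auto intro!: tensor_space_zero tensor_space_add tensor_space_scale assms)
  then show ?thesis
    by (simp add: lin_ext_def)
qed

lemma reflect_multi_indices:
  assumes "\<mu> \<in> multi_indices n d" "t < d"
  shows "reflect \<mu> t \<in> multi_indices n d"
proof -
  have mem: "\<mu> ! i \<in> index_set n" if "i < d" for i
    using that assms nth_mem[of i \<mu>] by (auto simp: multi_indices_def)
  have "- k \<in> index_set n" if "k \<in> index_set n" for k
    using that by (auto simp: index_set_def Let_def split: if_splits)
  then show ?thesis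
    using assms mem[of 0] mem[of t] mem[of "t - 1"]
    by (auto simp: multi_indices_def reflect_def dest!: subsetD[OF set_update_subset_insert])
qed

lemma gen_act_closed:
  assumes "x \<in> tensor_space n d" "t < d"
  shows "gen_act Q q x t \<in> tensor_space n d"
  unfolding gen_act_def
proof (rule tensor_space_lin_ext)
  fix \<mu> assume "\<mu> \<in> Poly_Mapping.keys x"
  then have \<mu>: "\<mu> \<in> multi_indices n d"
    using assms by (auto simp: tensor_space_def)
  have "basis_vec \<nu> \<in> tensor_space n d" if "\<nu> \<in> multi_indices n d" for \<nu>
    using that by (simp add: tensor_space_def basis_vec_def)
  then show "basis_act Q q t \<mu> \<in> tensor_space n d"
    using \<mu> reflect_multi_indices[OF \<mu> assms(2)]
    by (auto simp: basis_act_def intro!: tensor_space_add tensor_space_scale)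
qed

lemma free_act_closed:
  assumes "x \<in> tensor_space n d" "a \<in> carrier (free_algebra d)"
  shows "free_act Q q x a \<in> tensor_space n d"
  unfolding free_act_def
proof (rule tensor_space_lin_ext)
  fix w assume "w \<in> Poly_Mapping.keys a"
  then have "set (letters w) \<subseteq> {..<d}"
    using assms by (auto simp: free_algebra_def)
  moreover have "foldl (gen_act Q q) y ts \<in> tensor_space n d"
    if "set ts \<subseteq> {..<d}" "y \<in> tensor_space n d" for ts y
    using that by (induction ts arbitrary: y) (auto intro: gen_act_closed)
  ultimately show "word_act Q q x w \<in> tensor_space n d"
    using assms by (simp add: word_act_def)
qed

lemma gen_act_0_Cons:
  "gen_act Q q (basis_vec (a # ys)) 0 =
     (if a > 0 then basis_vec (- a # ys)
      else if a = 0 then scale (inverse Q) (basis_vec (- a # ys))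
      else basis_vec (- a # ys) + scale (inverse Q - Q) (basis_vec (a # ys)))"
  by (simp add: gen_act_basis_vec basis_act_def reflect_def)

lemma gen_act_Suc_append:
  assumes "t = Suc (length xs)"
  shows "gen_act Q q (basis_vec (xs @ a # b # ys)) t =
     (if a < b then basis_vec (xs @ b # a # ys)
      else if a = b then scale (inverse q) (basis_vec (xs @ b # a # ys))
      else basis_vec (xs @ b # a # ys) + scale (inverse q - q) (basis_vec (xs @ a # b # ys)))"
  using assms by (simp add: gen_act_basis_vec basis_act_def reflect_def nth_append list_update_append)

lemma gen_act_Suc2_append:
  assumes "t = Suc (Suc (length xs))"
  shows "gen_act Q q (basis_vec (xs @ a # b # c # ys)) t =
     (if b < c then basis_vec (xs @ a # c # b # ys)
      else if b = c then scale (inverse q) (basis_vec (xs @ a # c # b # ys))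
      else basis_vec (xs @ a # c # b # ys) + scale (inverse q - q) (basis_vec (xs @ a # b # c # ys)))"
  using gen_act_Suc_append[of t "xs @ [a]" Q q b c ys] assms by simp

lemmas gen_act_1 = gen_act_Suc_append[of "Suc 0" "[]", simplified]

lemmas vec_eq_simps = poly_mapping_eq_iff fun_eq_iff lookup_add lookup_minus lookup_scale

lemma free_act_zero_on_basis:
  assumes "x \<in> tensor_space n d"
    and "\<And>\<mu>. length \<mu> = d \<Longrightarrow> free_act Q q (basis_vec \<mu>) a = 0"
  shows "free_act Q q x a = 0"
proof (induction x rule: poly_mapping_span_induct)
  case zero
  show ?case by simp
next
  case (single \<mu> c)
  then have "length \<mu> = d"
    using assms(1) by (auto simp: tensor_space_def multi_indices_def)
  then show ?case
    using assms(2)[of \<mu>] free_act_scale[of Q q c "basis_vec \<mu>" a] by (simp add: basis_vec_def)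
next
  case (add y z)
  then show ?case by (simp add: free_act_add)
qed

lemmas free_act_simps =
  power2_eq_square free_act_diff free_act_plus free_act_mult free_act_gen free_act_scalar
  free_act_one gen_act_add gen_act_scale

lemma split_at2:
  assumes "Suc i < length \<mu>"
  obtains xs a b ys where "\<mu> = xs @ a # b # ys" "length xs = i"
  using assms id_take_nth_drop[of i \<mu>] id_take_nth_drop[of 0 "drop (Suc i) \<mu>"]
  by (metis Cons_nth_drop_Suc Suc_lessD append_take_drop_id length_take less_imp_le_nat min.absorb2)

lemma quadratic_0:
  assumes "Q \<noteq> 0" "1 \<le> length \<mu>"
  shows "gen_act Q q (gen_act Q q (basis_vec \<mu>) 0) 0 =
    scale (inverse Q - Q) (gen_act Q q (basis_vec \<mu>) 0) + basis_vec \<mu>"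
proof -
  obtain a ys where "\<mu> = a # ys" using assms(2) by (cases \<mu>) auto
  then show ?thesis
    using assms(1)
    by (auto simp: gen_act_0_Cons gen_act_add gen_act_scale vec_eq_simps field_simps)
qed

lemma quadratic_Suc:
  assumes "q \<noteq> 0" "1 \<le> i" "i < length \<mu>"
  shows "gen_act Q q (gen_act Q q (basis_vec \<mu>) i) i =
    scale (inverse q - q) (gen_act Q q (basis_vec \<mu>) i) + basis_vec \<mu>"
proof -
  obtain xs a b ys where "\<mu> = xs @ a # b # ys" "length xs = i - 1"
    using split_at2[of "i - 1" \<mu> thesis] assms by simp
  then show ?thesis
    using assms(1,2)
    by (auto simp: gen_act_Suc_append gen_act_add gen_act_scale vec_eq_simps field_simps)
qed

lemma braid_3:
  assumes "q \<noteq> 0" "1 \<le> i" "i + 2 \<le> length \<mu>"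
  shows "gen_act Q q (gen_act Q q (gen_act Q q (basis_vec \<mu>) i) (i+1)) i =
    gen_act Q q (gen_act Q q (gen_act Q q (basis_vec \<mu>) (i+1)) i) (i+1)"
proof -
  obtain xs a b zs where 1: "\<mu> = xs @ a # b # zs" "length xs = i - 1"
    using split_at2[of "i - 1" \<mu> thesis] assms by simp
  then obtain c ys where 2: "zs = c # ys"
    using assms by (cases zs) auto
  have i: "i = Suc (length xs)" "i + 1 = Suc (Suc (length xs))"
    using 1 assms by auto
  show ?thesis
    unfolding 1 2 unfolding i
    using assms(1)
    by (cases a b rule: linorder_cases; cases b c rule: linorder_cases;
        cases a c rule: linorder_cases;
        simp add: gen_act_Suc_append gen_act_Suc2_append gen_act_add gen_act_scale;
        simp add: vec_eq_simps field_simps)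
qed

lemma braid_4:
  assumes "q \<noteq> 0" "Q \<noteq> 0" "2 \<le> length \<mu>"
  shows "gen_act Q q (gen_act Q q (gen_act Q q (gen_act Q q (basis_vec \<mu>) 0) 1) 0) 1 =
    gen_act Q q (gen_act Q q (gen_act Q q (gen_act Q q (basis_vec \<mu>) 1) 0) 1) 0"
proof -
  obtain a b ys where \<mu>: "\<mu> = a # b # ys"
    using assms(3) by (cases \<mu>; cases "tl \<mu>") auto
  show ?thesis
    unfolding \<mu> using assms(1,2)
    by (cases a "0 :: int" rule: linorder_cases; cases b "0 :: int" rule: linorder_cases;
        cases a b rule: linorder_cases; cases a "- b" rule: linorder_cases;
        simp add: gen_act_0_Cons gen_act_1 gen_act_add gen_act_scale;
        simp add: vec_eq_simps field_simps)
qed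

lemma commute_far:
  assumes "i + 1 < j" "j < length \<mu>"
  shows "gen_act Q q (gen_act Q q (basis_vec \<mu>) i) j = gen_act Q q (gen_act Q q (basis_vec \<mu>) j) i"
proof -
  obtain us c e zs where 1: "\<mu> = us @ c # e # zs" "length us = j - 1"
    using split_at2[of "j - 1" \<mu> thesis] assms by simp
  show ?thesis
  proof (cases i)
    case 0
    then obtain a ys where 2: "us = a # ys"
      using 1 assms by (cases us) auto
    have "j = Suc (length (a' # ys))" for a' :: int
      using 1 2 assms by auto
    note far = gen_act_Suc_append[OF this, unfolded append_Cons]
    show ?thesis
      unfolding 1 2 0
      by (simp add: far gen_act_0_Cons gen_act_add gen_act_scale;
          simp add: vec_eq_simps algebra_simps)
  next
    case (Suc k)
    then obtain xs a b ys where 2: "us = xs @ a # b # ys" "length xs = k"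
      using split_at2[of k us thesis] 1 assms by simp
    have "j = Suc (length (xs @ a' # b' # ys))" for a' b' :: int
      using 1 2 Suc assms by auto
    note far = gen_act_Suc_append[OF this, unfolded append_Cons append_assoc]
    have i: "i = Suc (length xs)"
      using 2 Suc by simp
    show ?thesis
      unfolding 1 2
      by (simp add: far gen_act_Suc_append[OF i] gen_act_add gen_act_scale;
          simp add: vec_eq_simps algebra_simps)
  qed
qed

lemma relators_act_zero:
  assumes "q \<noteq> 0" "Q \<noteq> 0" "r \<in> hecke_relators Q q d" "x \<in> tensor_space n d"
  shows "free_act Q q x r = 0"
proof (rule free_act_zero_on_basis[OF assms(4)])
  fix \<mu> :: "int list" assume \<mu>: "length \<mu> = d"
  have far: "gen_act Q q (gen_act Q q (basis_vec \<mu>) i) j = gen_act Q q (gen_act Q q (basis_vec \<mu>) j) i"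
    if "i < d" "j < d" "\<bar>int i - int j\<bar> > 1" for i j
    using commute_far[of i j \<mu> Q q] commute_far[of j i \<mu> Q q] that \<mu>
    by (cases i j rule: linorder_cases) auto
  show "free_act Q q (basis_vec \<mu>) r = 0"
    using assms(3) quadratic_0[OF assms(2), of \<mu> q] quadratic_Suc[OF assms(1), of _ \<mu> Q]
      braid_3[OF assms(1), of _ \<mu> Q] braid_4[OF assms(1,2), of \<mu>] far \<mu>
    by (auto simp: hecke_relators_def free_act_simps split: if_splits)
qed

lemma hecke_ideal_act_zero:
  assumes "q \<noteq> 0" "Q \<noteq> 0" "a \<in> hecke_ideal Q q d" "x \<in> tensor_space n d"
  shows "free_act Q q x a = 0"
proof -
  let ?R = "free_algebra d :: (word \<Rightarrow>\<^sub>0 'a) ring"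
  let ?A = "{a \<in> carrier ?R. \<forall>x \<in> tensor_space n d. free_act Q q x a = 0}"
  interpret ring ?R by (rule free_algebra_ring)
  have inv: "\<ominus>\<^bsub>?R\<^esub> a = - a" if "a \<in> carrier ?R" for a
  proof (rule minus_equality)
    show "- a \<in> carrier ?R" using that by (simp add: free_algebra_def)
  qed (use that in \<open>simp_all add: free_algebra_simps\<close>)
  have "ideal ?A ?R"
  proof (rule idealI)
    show "subgroup ?A (add_monoid ?R)"
    proof (rule add.subgroupI)
      show "?A \<noteq> {}"
        using zero_closed by (auto simp: free_algebra_simps free_act_def)
    next
      fix a assume a: "a \<in> ?A"
      then have "- a \<in> carrier ?R" using inv[of a] a_inv_closed[of a] by auto
      moreover have "free_act Q q x (- a) = 0" if "x \<in> tensor_space n d" for x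
        using a that free_act_diff[of Q q x 0 a] by (auto simp: free_act_def)
      ultimately show "\<ominus>\<^bsub>?R\<^esub> a \<in> ?A"
        using a inv[of a] by auto
    next
      fix a b assume "a \<in> ?A" "b \<in> ?A"
      then show "a \<oplus>\<^bsub>?R\<^esub> b \<in> ?A"
        using a_closed[of a b] by (auto simp: free_algebra_simps free_act_plus)
    qed auto
  next
    fix a r assume "a \<in> ?A" "r \<in> carrier ?R"
    then show "r \<otimes>\<^bsub>?R\<^esub> a \<in> ?A" "a \<otimes>\<^bsub>?R\<^esub> r \<in> ?A"
      using m_closed[of a r] m_closed[of r a]
      by (auto simp: free_algebra_simps free_act_mult free_act_closed)
  qed (rule free_algebra_ring)
  then have "hecke_ideal Q q d \<subseteq> ?A"
    unfolding hecke_ideal_def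
    by (rule genideal_minimal)
       (use hecke_relators_carrier relators_act_zero[OF assms(1,2)] in blast)
  then show ?thesis
    using assms(3,4) by auto
qed

lemma hecke_act_coset:
  assumes "q \<noteq> 0" "Q \<noteq> 0" "x \<in> tensor_space n d"
    and "h \<in> carrier (hecke_B Q q d)" "a \<in> h"
  shows "hecke_act Q q x h = free_act Q q x a"
proof -
  let ?R = "free_algebra d :: (word \<Rightarrow>\<^sub>0 'a) ring"
  obtain c where "h = a_r_coset ?R (hecke_ideal Q q d) c"
    using assms(4) by (auto simp: hecke_B_def FactRing_def A_RCOSETS_def RCOSETS_def a_r_coset_def)
  then have "free_act Q q x b = free_act Q q x c" if "b \<in> h" for b
    using that hecke_ideal_act_zero[OF assms(1,2) _ assms(3)]
    by (auto simp: a_r_coset_def r_coset_def free_algebra_simps free_act_plus)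
  then show ?thesis
    using assms(5) someI[of "\<lambda>a. a \<in> h" a] by (simp add: hecke_act_def)
qed

lemma hecke_act_closed:
  assumes "x \<in> tensor_space n d" "h \<in> carrier (hecke_B Q q d)"
  shows "hecke_act Q q x h \<in> tensor_space n d"
proof -
  let ?R = "free_algebra d :: (word \<Rightarrow>\<^sub>0 'a) ring"
  interpret ideal "hecke_ideal Q q d" ?R by (rule hecke_ideal_ideal)
  obtain c where c: "c \<in> carrier ?R" "h = a_r_coset ?R (hecke_ideal Q q d) c"
    using assms(2) by (auto simp: hecke_B_def FactRing_def A_RCOSETS_def RCOSETS_def a_r_coset_def)
  have "c \<in> h"
    using a_rcos_self[OF c(1)] c(2) by simp
  then have "(SOME a. a \<in> h) \<in> h"
    by (rule someI)
  moreover have "h \<subseteq> carrier ?R"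
    using a_r_coset_subset_G[OF a_subset c(1)] c(2) by simp
  ultimately show ?thesis
    unfolding hecke_act_def using free_act_closed[OF assms(1)] by blast
qed

lemma hecke_act_add: "hecke_act Q q (x + y) h = hecke_act Q q x h + hecke_act Q q y h"
  by (simp add: hecke_act_def free_act_add)

lemma hecke_act_uminus: "hecke_act Q q (- x) h = - hecke_act Q q x h"
  using hecke_act_add[of Q q x "- x" h] by (simp add: hecke_act_def eq_neg_iff_add_eq_0 add.commute)

lemma schur_B_ring: "ring (schur_B Q q n d)"
proof -
  let ?S = "schur_B Q q n d" and ?V = "tensor_space n d"
  note V = tensor_space_zero tensor_space_add tensor_space_uminus hecke_act_closed
  have "abelian_group ?S"
  proof (rule abelian_groupI)
    fix f assume f: "f \<in> carrier ?S"
    then have "f x \<in> ?V" if "x \<in> ?V" for x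
      using that by (auto simp: schur_B_def Let_def)
    with f show "\<exists>g \<in> carrier ?S. g \<oplus>\<^bsub>?S\<^esub> f = \<zero>\<^bsub>?S\<^esub>"
      by (intro bexI[of _ "\<lambda>x\<in>?V. - f x"])
         (auto simp: schur_B_def Let_def hecke_act_uminus fun_eq_iff V)
  qed (auto simp: schur_B_def Let_def hecke_act_add fun_eq_iff V Pi_iff ac_simps
        PiE_def extensional_def hecke_act_def[of _ _ 0])
  moreover have "monoid ?S"
    by (rule monoidI)
       (auto simp: schur_B_def Let_def compose_def fun_eq_iff V PiE_def Pi_iff extensional_def)
  ultimately show ?thesis
    by (rule ringI)
       (auto simp: schur_B_def Let_def compose_def fun_eq_iff V PiE_def Pi_iff)
qed

end

theory Submission
  imports Defs
begin

text \<open>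
  Semisimplicity of the endomorphism algebra is first turned into a property of single operators:
  every endomorphism \<open>f\<close> of the tensor space has a generalized inverse, that is an endomorphism \<open>g\<close>
  with \<open>f g f = f\<close> (\<open>semisimple_schur_B_iff\<close>).  In one direction one uses a complement of the left
  ideal generated by \<open>f\<close>; in the other, a regular ring whose principal left ideals cannot decrease
  forever is split by idempotents, and kernels in a space of finite dimension bound such chains.

  If \<open>q\<^sup>2\<^sup>j \<noteq> 1\<close> for \<open>0 < j \<le> d\<close>, every submodule of the tensor space has a complement, and hence every
  endomorphism has a generalized inverse (\<open>regular_if_separated\<close>).  Together with \<open>f_B \<noteq> 0\<close> the
  hypothesis separates the residues of boxes of bipartitions.  The
  Jucys--Murphy elements \<open>L\<^sub>0 = T\<^sub>0\<close>, \<open>L\<^sub>k = T\<^sub>k L\<^sub>k\<^sub>-\<^sub>1 T\<^sub>k\<close> are then simultaneously diagonalizable, with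
  eigenvalues the residues of the boxes added by standard tableaux of pairs of partitions: given the
  eigenvalues of \<open>L\<^sub>0, \<dots>, L\<^sub>k\<^sub>-\<^sub>1\<close>, those of \<open>L\<^sub>k\<close> satisfy an explicit polynomial equation, and a root
  belonging to a box that cannot be added is excluded by the braid relation (\<open>spectral\<close>).  A double
  coset decomposition shows that a weight vector \<open>x\<close> spans its weight space in the module that it
  generates (\<open>cyc_weight_space\<close>).  Intertwiners lead from any other weight of this module back to that
  of \<open>x\<close>, so the module is simple (\<open>cyc_simple\<close>), and modules spanned by simple submodules have
  complements (\<open>complement\<close>).

  For \<open>n = 1\<close> the tensor space is a line.  For \<open>n = 2\<close> it has, for every \<open>q\<close>, a basis of pure tensors
  that are eigenvectors of the Jucys--Murphy elements with distinct systems of eigenvalues; every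
  endomorphism is diagonal in it (\<open>sign_vec_endo\<close>) and diagonal operators have generalized inverses.

  For \<open>n = 3\<close>, if \<open>q\<^sup>2\<close> is a primitive \<open>l\<close>th root of unity with \<open>l \<le> d\<close>, an endomorphism \<open>E\<close> without
  generalized inverse replaces one of the letters \<open>0\<close> by \<open>1\<close> or \<open>-1\<close> in words with exactly \<open>l\<close>
  letters \<open>0\<close>.  There is a vector \<open>y\<close> with \<open>E y \<noteq> 0\<close> and \<open>E G E y = 0\<close> for every endomorphism \<open>G\<close>,
  because the relevant coefficients of \<open>G E y\<close> are multiples of \<open>1 + q\<^sup>-\<^sup>2 + \<dots> + q\<^sup>-\<^sup>2\<^sup>(\<^sup>l\<^sup>-\<^sup>1\<^sup>) = 0\<close>
  (\<open>raise_zeros_not_regular\<close>); \<open>E = E G E\<close> would contradict this.  For larger \<open>n\<close> the three-letter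
  space is mapped into the tensor space and back (\<open>not_regular_transfer\<close>).  For odd \<open>n\<close> this is an
  inclusion and a projection; for even \<open>n\<close> the missing letter \<open>0\<close> is replaced by letters \<open>1\<close> and \<open>-1\<close>,
  and the composite multiplies the test vector by a product of factors \<open>1 + Q\<^sup>-\<^sup>2 q\<^sup>-\<^sup>2\<^sup>i\<close> that do not
  vanish as \<open>f_B \<noteq> 0\<close>.
\<close>

section \<open>Von Neumann regularity and semisimplicity\<close>

definition regular_ring :: "('a, 'm) ring_scheme \<Rightarrow> bool" where
  "regular_ring R \<longleftrightarrow>
     (\<forall>f \<in> carrier R. \<exists>g \<in> carrier R. f = f \<otimes>\<^bsub>R\<^esub> g \<otimes>\<^bsub>R\<^esub> f)"

context ring
begin

lemma left_idealI:
  assumes "I \<subseteq> carrier R" "\<zero> \<in> I" "\<And>a b. a \<in> I \<Longrightarrow> b \<in> I \<Longrightarrow> a \<oplus> b \<in> I"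
    and "\<And>r a. r \<in> carrier R \<Longrightarrow> a \<in> I \<Longrightarrow> r \<otimes> a \<in> I"
  shows "left_ideal R I"
  unfolding left_ideal_def
proof
  show "additive_subgroup I R"
  proof (rule additive_subgroup.intro, rule add.subgroupI)
    fix a assume a: "a \<in> I"
    then have "\<ominus> a = \<ominus> \<one> \<otimes> a"
      using assms(1) l_minus[OF one_closed, of a] by auto
    with a show "\<ominus> a \<in> I" using assms(4)[of "\<ominus> \<one>" a] by simp
  qed (use assms in auto)
qed (use assms(4) in blast)

lemma left_idealD:
  assumes "left_ideal R I"
  shows "I \<subseteq> carrier R" "\<zero> \<in> I" "a \<in> I \<Longrightarrow> b \<in> I \<Longrightarrow> a \<oplus> b \<in> I"
    "a \<in> I \<Longrightarrow> \<ominus> a \<in> I" "a \<in> I \<Longrightarrow> b \<in> I \<Longrightarrow> a \<ominus> b \<in> I"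
    "r \<in> carrier R \<Longrightarrow> a \<in> I \<Longrightarrow> r \<otimes> a \<in> I"
proof -
  have *: "subgroup I (add_monoid R)"
    using assms by (simp add: left_ideal_def additive_subgroup_def)
  show 1: "I \<subseteq> carrier R" "\<zero> \<in> I" "a \<in> I \<Longrightarrow> b \<in> I \<Longrightarrow> a \<oplus> b \<in> I"
    using subgroup.subset[OF *] subgroup.one_closed[OF *] subgroup.m_closed[OF *] by auto
  have 2: "\<ominus> a \<in> I" if "a \<in> I" for a
    using subgroup.m_inv_closed[OF * that] by (simp add: a_inv_def)
  then show "a \<in> I \<Longrightarrow> \<ominus> a \<in> I" .
  show "a \<in> I \<Longrightarrow> b \<in> I \<Longrightarrow> a \<ominus> b \<in> I"
    using subgroup.m_closed[OF *, of a "\<ominus> b"] 2 by (simp add: a_minus_def)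
  show "r \<in> carrier R \<Longrightarrow> a \<in> I \<Longrightarrow> r \<otimes> a \<in> I"
    using assms by (simp add: left_ideal_def)
qed

definition ideal_sum :: "'a set \<Rightarrow> 'a set \<Rightarrow> 'a set" where
  "ideal_sum I J = {x. \<exists>a \<in> I. \<exists>b \<in> J. x = a \<oplus> b}"

lemma ideal_sumI: "a \<in> I \<Longrightarrow> b \<in> J \<Longrightarrow> a \<oplus> b \<in> ideal_sum I J"
  by (auto simp: ideal_sum_def)

lemma ideal_sumE:
  assumes "x \<in> ideal_sum I J"
  obtains a b where "a \<in> I" "b \<in> J" "x = a \<oplus> b"
  using assms by (auto simp: ideal_sum_def)

lemma ideal_sum_mono: "J \<subseteq> J' \<Longrightarrow> ideal_sum I J \<subseteq> ideal_sum I J'"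
  by (auto simp: ideal_sum_def)

lemma ideal_sum_upper:
  assumes "left_ideal R I" "left_ideal R J"
  shows "I \<subseteq> ideal_sum I J" "J \<subseteq> ideal_sum I J"
proof -
  note I = left_idealD[OF assms(1)] and J = left_idealD[OF assms(2)]
  have "x \<in> ideal_sum I J" if "x \<in> I" for x
    using ideal_sumI[OF that J(2)] I(1) that by auto
  moreover have "x \<in> ideal_sum I J" if "x \<in> J" for x
    using ideal_sumI[OF I(2) that] J(1) that by auto
  ultimately show "I \<subseteq> ideal_sum I J" "J \<subseteq> ideal_sum I J" by auto
qed

lemma left_ideal_sum:
  assumes "left_ideal R I" "left_ideal R J"
  shows "left_ideal R (ideal_sum I J)"
proof (rule left_idealI)
  note I = left_idealD[OF assms(1)] and J = left_idealD[OF assms(2)]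
  show "ideal_sum I J \<subseteq> carrier R" using I(1) J(1) by (auto simp: ideal_sum_def)
  show "\<zero> \<in> ideal_sum I J" using ideal_sumI[OF I(2) J(2)] by simp
  show "x \<oplus> y \<in> ideal_sum I J" if x: "x \<in> ideal_sum I J" and y: "y \<in> ideal_sum I J" for x y
  proof -
    obtain a b where ab: "x = a \<oplus> b" "a \<in> I" "b \<in> J" using x by (rule ideal_sumE)
    obtain c e where ce: "y = c \<oplus> e" "c \<in> I" "e \<in> J" using y by (rule ideal_sumE)
    have "a \<in> carrier R" "b \<in> carrier R" "c \<in> carrier R" "e \<in> carrier R"
      using I(1) J(1) ab ce by auto
    then have "x \<oplus> y = (a \<oplus> c) \<oplus> (b \<oplus> e)"
      using ab ce by (simp add: a_ac)
    then show ?thesis using ideal_sumI[OF I(3)[OF ab(2) ce(2)] J(3)[OF ab(3) ce(3)]] by simp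
  qed
  show "r \<otimes> x \<in> ideal_sum I J" if "r \<in> carrier R" and x: "x \<in> ideal_sum I J" for r x
  proof -
    obtain a b where ab: "x = a \<oplus> b" "a \<in> I" "b \<in> J" using x by (rule ideal_sumE)
    then have "a \<in> carrier R" "b \<in> carrier R"
      using I(1) J(1) by auto
    then have "r \<otimes> x = r \<otimes> a \<oplus> r \<otimes> b"
      using that(1) ab by (simp add: r_distr)
    then show ?thesis using ideal_sumI[OF I(6)[OF that(1) ab(2)] J(6)[OF that(1) ab(3)]] by simp
  qed
qed

lemma left_ideal_inter:
  assumes "left_ideal R I" "left_ideal R J"
  shows "left_ideal R (I \<inter> J)"
  using left_idealD[OF assms(1)] left_idealD[OF assms(2)] by (intro left_idealI) auto

lemma left_ideal_finsum:
  assumes "left_ideal R I" "\<And>x. x \<in> F \<Longrightarrow> h x \<in> I"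
  shows "finsum R h F \<in> I"
  using assms(2)
proof (induction F rule: infinite_finite_induct)
  case (insert x F)
  then have "finsum R h (insert x F) = h x \<oplus> finsum R h F"
    using left_idealD(1)[OF assms(1)] by (intro finsum_insert) auto
  then show ?case using insert left_idealD(3)[OF assms(1)] by simp
qed (use left_idealD(2)[OF assms(1)] in auto)

text \<open>
  The summands are absorbed one at a time: a simple \<open>J\<close> that is not yet inside \<open>I + C\<close> meets it
  only in zero, so that \<open>C\<close> may be enlarged by \<open>J\<close> without meeting \<open>I\<close>.
\<close>

lemma left_ideal_complement:
  assumes I: "left_ideal R I" and "finite F" "\<And>J. J \<in> F \<Longrightarrow> simple_left_ideal R J"
  shows "\<exists>C. left_ideal R C \<and> I \<inter> C = {\<zero>} \<and> (\<forall>J \<in> F. J \<subseteq> ideal_sum I C)"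
  using assms(2,3)
proof (induction F rule: finite_induct)
  case empty
  have "left_ideal R {\<zero>}" by (rule left_idealI) auto
  then show ?case using left_idealD(2)[OF I] by (intro exI[of _ "{\<zero>}"]) auto
next
  case (insert J F)
  have "\<exists>C. left_ideal R C \<and> I \<inter> C = {\<zero>} \<and> (\<forall>J \<in> F. J \<subseteq> ideal_sum I C)"
    by (rule insert.IH) (rule insert.prems, simp)
  then obtain C where C: "left_ideal R C" "I \<inter> C = {\<zero>}" "\<And>J. J \<in> F \<Longrightarrow> J \<subseteq> ideal_sum I C"
    by blast
  have J: "left_ideal R J" and Js: "\<And>J'. left_ideal R J' \<Longrightarrow> J' \<subseteq> J \<Longrightarrow> J' = {\<zero>} \<or> J' = J"
    using insert.prems(1)[of J] by (auto simp: simple_left_ideal_def)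
  have S: "left_ideal R (ideal_sum I C)" by (rule left_ideal_sum[OF I C(1)])
  note Id = left_idealD[OF I] and Jd = left_idealD[OF J] and Cd = left_idealD[OF C(1)]
  have "J \<inter> ideal_sum I C = {\<zero>} \<or> J \<inter> ideal_sum I C = J"
    by (rule Js[OF left_ideal_inter[OF J S] Int_lower1])
  then consider "J \<subseteq> ideal_sum I C" | "J \<inter> ideal_sum I C = {\<zero>}" by blast
  then show ?case
  proof cases
    case 1
    then show ?thesis using C by (intro exI[of _ C]) simp
  next
    case 2
    let ?D = "ideal_sum C J"
    have D: "left_ideal R ?D" by (rule left_ideal_sum[OF C(1) J])
    have "I \<inter> ?D \<subseteq> {\<zero>}"
    proof
      fix x assume "x \<in> I \<inter> ?D"
      then have "x \<in> I" "x \<in> ?D" by auto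
      obtain c j where x: "c \<in> C" "j \<in> J" "x = c \<oplus> j" using \<open>x \<in> ?D\<close> by (rule ideal_sumE)
      have car: "x \<in> carrier R" "c \<in> carrier R" "j \<in> carrier R"
        using Id(1) Cd(1) Jd(1) x \<open>x \<in> I\<close> by auto
      have "j = x \<oplus> (\<ominus> c)" using x(3) car by (simp add: a_comm[of _ "\<ominus> c"] r_neg1)
      then have "j \<in> ideal_sum I C" using ideal_sumI[OF \<open>x \<in> I\<close> Cd(4)[OF x(1)]] by simp
      then have "j = \<zero>" using 2 x(2) by blast
      then have "x \<in> C" using x car by simp
      then show "x \<in> {\<zero>}" using C(2) \<open>x \<in> I\<close> by blast
    qed
    then have "I \<inter> ?D = {\<zero>}" using Id(2) left_idealD(2)[OF D] by blast
    moreover have "J' \<subseteq> ideal_sum I ?D" if "J' \<in> insert J F" for J'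
    proof (cases "J' = J")
      case True
      then show ?thesis
        using ideal_sum_upper(2)[OF C(1) J] ideal_sum_upper(2)[OF I D] by blast
    next
      case False
      then have "J' \<subseteq> ideal_sum I C" using that C(3) by blast
      then show ?thesis using ideal_sum_mono[OF ideal_sum_upper(1)[OF C(1) J]] by blast
    qed
    ultimately show ?thesis using D by (intro exI[of _ ?D]) simp
  qed
qed

definition principal :: "'a \<Rightarrow> 'a set" where
  "principal f = {x. \<exists>g \<in> carrier R. x = g \<otimes> f}"

lemma principalI: "g \<in> carrier R \<Longrightarrow> x = g \<otimes> f \<Longrightarrow> x \<in> principal f"
  by (auto simp: principal_def)

lemma principalE:
  assumes "x \<in> principal f"
  obtains g where "g \<in> carrier R" "x = g \<otimes> f"
  using assms by (auto simp: principal_def)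

lemma left_ideal_principal:
  assumes f: "f \<in> carrier R"
  shows "left_ideal R (principal f)"
proof (rule left_idealI)
  show "principal f \<subseteq> carrier R" using f by (auto simp: principal_def)
  show "\<zero> \<in> principal f" using f by (intro principalI[of \<zero>]) auto
  show "a \<oplus> b \<in> principal f" if a: "a \<in> principal f" and b: "b \<in> principal f" for a b
  proof -
    obtain g h where gh: "g \<in> carrier R" "h \<in> carrier R" "a = g \<otimes> f" "b = h \<otimes> f"
      using a b by (elim principalE)
    then have "a \<oplus> b = (g \<oplus> h) \<otimes> f" using f by (simp add: l_distr)
    then show ?thesis using gh by (intro principalI) auto
  qed
  show "r \<otimes> a \<in> principal f" if r: "r \<in> carrier R" and a: "a \<in> principal f" for r a
  proof -
    obtain g where g: "g \<in> carrier R" "a = g \<otimes> f"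
      using a by (rule principalE)
    then have "r \<otimes> a = (r \<otimes> g) \<otimes> f" using f r by (simp add: m_assoc)
    then show ?thesis using g r by (intro principalI) auto
  qed
qed

lemma principal_self: "f \<in> carrier R \<Longrightarrow> f \<in> principal f"
  by (rule principalI[OF one_closed]) simp

lemma principal_subset: "left_ideal R I \<Longrightarrow> f \<in> I \<Longrightarrow> principal f \<subseteq> I"
  using left_idealD(6) by (auto simp: principal_def)

text \<open>
  With \<open>C\<close> a complement of the left ideal \<open>R f\<close> and \<open>1 = g f + c\<close> accordingly, \<open>f - f g f = f c\<close> lies
  in \<open>R f\<close> and in \<open>C\<close>.
\<close>

lemma semisimple_imp_regular:
  assumes "semisimple_ring R"
  shows "regular_ring R"
  unfolding regular_ring_def
proof
  fix f assume f: "f \<in> carrier R"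
  obtain F where F: "finite F" "\<And>I. I \<in> F \<Longrightarrow> simple_left_ideal R I"
    and sum: "\<And>x. x \<in> carrier R \<Longrightarrow> \<exists>!h. h \<in> (\<Pi>\<^sub>E I\<in>F. I) \<and> x = finsum R h F"
    using assms unfolding semisimple_ring_def by (elim conjE exE) auto
  note I = left_ideal_principal[OF f]
  obtain C where C: "left_ideal R C" "principal f \<inter> C = {\<zero>}"
    "\<And>J. J \<in> F \<Longrightarrow> J \<subseteq> ideal_sum (principal f) C"
    using left_ideal_complement[OF I F] by blast
  obtain h where h: "h \<in> (\<Pi>\<^sub>E I\<in>F. I)" "\<one> = finsum R h F"
    using sum[OF one_closed] by blast
  have "finsum R h F \<in> ideal_sum (principal f) C"
    by (rule left_ideal_finsum[OF left_ideal_sum[OF I C(1)]]) (use C(3) h(1) in blast)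
  then obtain g c where gc: "g \<in> carrier R" "\<one> = g \<otimes> f \<oplus> c" "c \<in> C"
    unfolding h(2)[symmetric] by (elim ideal_sumE principalE) auto
  have c: "c \<in> carrier R" using gc(3) left_idealD(1)[OF C(1)] by blast
  have fgf: "f \<otimes> g \<otimes> f \<in> carrier R" "f \<otimes> c \<in> carrier R" using f gc(1) c by auto
  have "f = f \<otimes> (g \<otimes> f \<oplus> c)" using gc(2) f by (metis r_one)
  then have eq: "f = f \<otimes> g \<otimes> f \<oplus> f \<otimes> c" using f gc(1) c by (simp add: r_distr m_assoc)
  have "f \<otimes> c = f \<ominus> f \<otimes> g \<otimes> f"
    using fgf by (subst (2) eq) (simp add: a_minus_def a_comm[of _ "\<ominus> (f \<otimes> g \<otimes> f)"] r_neg1)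
  moreover have "f \<ominus> f \<otimes> g \<otimes> f \<in> principal f"
  proof (rule left_idealD(5)[OF I])
    show "f \<in> principal f" by (rule principal_self[OF f])
    show "f \<otimes> g \<otimes> f \<in> principal f" using f gc(1) by (intro principalI) auto
  qed
  moreover have "f \<otimes> c \<in> C" using left_idealD(6)[OF C(1) f gc(3)] .
  ultimately have "f \<otimes> c = \<zero>" using C(2) by (metis IntI singletonD)
  then have "f = f \<otimes> g \<otimes> f" using eq fgf by (metis r_zero)
  then show "\<exists>g\<in>carrier R. f = f \<otimes> g \<otimes> f" using gc(1) by blast
qed

text \<open>
  A ring element generating a minimal nonzero principal left ideal generates a simple one.  Writing
  the generator of such an ideal inside \<open>R e\<close> as an idempotent \<open>f\<close>, the idempotents \<open>e f\<close> and
  \<open>e - e f\<close> are orthogonal and split \<open>R e\<close>; the measure \<open>m\<close> makes this process stop.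
\<close>

lemma regular_imp_semisimple:
  fixes m :: "'a \<Rightarrow> nat"
  assumes reg: "regular_ring R"
    and m: "\<And>x y. x \<in> carrier R \<Longrightarrow> y \<in> carrier R \<Longrightarrow> principal x \<subset> principal y \<Longrightarrow> m x < m y"
  shows "semisimple_ring R"
proof -
  have minimal: "\<exists>f \<in> carrier R. f \<noteq> \<zero> \<and> f \<in> principal e \<and> f \<otimes> f = f \<and> simple_left_ideal R (principal f)"
    if e: "e \<in> carrier R" "e \<noteq> \<zero>" for e
  proof -
    let ?P = "\<lambda>f. f \<in> carrier R \<and> f \<noteq> \<zero> \<and> f \<in> principal e"
    have "?P e" using e principal_self by simp
    then obtain f0 where f0: "?P f0" "\<And>y. ?P y \<Longrightarrow> m f0 \<le> m y"
      using ex_has_least_nat[of ?P e m] by blast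
    then obtain g where g: "g \<in> carrier R" "f0 = f0 \<otimes> g \<otimes> f0"
      using reg unfolding regular_ring_def by blast
    define f where "f = g \<otimes> f0"
    have f: "f \<in> carrier R" using f0 g by (simp add: f_def)
    have "f0 \<otimes> f = f0" using g f0 by (simp add: f_def m_assoc)
    then have ff: "f \<otimes> f = f" and fn: "f \<noteq> \<zero>"
      using f0 g f by (auto simp: f_def m_assoc)
    have fP: "f \<in> principal f0" using g(1) unfolding f_def by (rule principalI) simp
    have f0P: "f0 \<in> principal f" using \<open>f0 \<otimes> f = f0\<close> f0 by (intro principalI[of f0]) auto
    have eqP: "principal f = principal f0"
      using principal_subset[OF left_ideal_principal[of f0] fP] f0
        principal_subset[OF left_ideal_principal[OF f] f0P] by blast
    have sub: "principal f0 \<subseteq> principal e"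
      using principal_subset[OF left_ideal_principal[OF e(1)]] f0 by blast
    have "simple_left_ideal R (principal f)"
      unfolding simple_left_ideal_def
    proof (intro conjI allI impI)
      show "left_ideal R (principal f)" by (rule left_ideal_principal[OF f])
      show "principal f \<noteq> {\<zero>}" using principal_self[OF f] fn by blast
      fix J assume J: "left_ideal R J \<and> J \<subseteq> principal f"
      show "J = {\<zero>} \<or> J = principal f"
      proof (cases "J = {\<zero>}")
        case False
        then obtain y where y: "y \<in> J" "y \<noteq> \<zero>" using left_idealD(2)[of J] J by blast
        have yc: "y \<in> carrier R" using y J left_idealD(1) by blast
        have yP: "?P y" using y yc J eqP sub by blast
        have "principal y \<subseteq> principal f0" using principal_subset[of J y] J y eqP by blast
        then have "principal y = principal f0"
          using m[OF yc, of f0] f0(1) f0(2)[OF yP] by (meson leD psubsetI)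
        then show ?thesis using principal_subset[of J y] J y eqP by blast
      qed simp
    qed
    moreover have "f \<in> principal e" using sub fP by blast
    ultimately show ?thesis using f ff fn by blast
  qed
  have split: "\<exists>F. finite F \<and> (\<forall>I \<in> F. simple_left_ideal R I \<and> I \<subseteq> principal e) \<and>
      (\<forall>x \<in> principal e. \<exists>!h. h \<in> (\<Pi>\<^sub>E I\<in>F. I) \<and> x = finsum R h F)"
    if "e \<in> carrier R" "e \<otimes> e = e" for e
    using that
  proof (induction "m e" arbitrary: e rule: less_induct)
    case less
    note e = less.prems
    show ?case
    proof (cases "e = \<zero>")
      case True
      then have "principal e = {\<zero>}" unfolding principal_def by auto
      then show ?thesis by (intro exI[of _ "{}"]) auto
    next
      case False
      obtain f where f: "f \<in> carrier R" "f \<noteq> \<zero>" "f \<in> principal e" "f \<otimes> f = f"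
        "simple_left_ideal R (principal f)"
        using minimal[OF e(1) False] by blast
      have fe: "f \<otimes> e = f" using f(3) e by (auto elim!: principalE simp: m_assoc)
      define p where "p = e \<otimes> f"
      define r where "r = e \<ominus> e \<otimes> f"
      have p: "p \<in> carrier R" and r: "r \<in> carrier R" using e f by (auto simp: p_def r_def)
      have ep: "e = p \<oplus> r"
        using e(1) p by (simp add: r_def flip: p_def) (simp add: a_minus_def a_comm[of e] r_neg1 r_neg2)
      have fp: "f \<otimes> p = f" using e f fe by (simp add: p_def flip: m_assoc)
      have ee: "e \<otimes> p = p" using e f by (simp add: p_def flip: m_assoc)
      have pp: "p \<otimes> p = p" using e f fp by (simp add: p_def m_assoc)
      have pe: "p \<otimes> e = p" using e f fe by (simp add: p_def m_assoc)
      have er: "e \<otimes> r = r" using e p ee unfolding r_def p_def[symmetric] by (simp add: a_minus_def r_distr r_minus)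
      have re: "r \<otimes> e = r" using e p pe unfolding r_def p_def[symmetric] by (simp add: a_minus_def l_distr l_minus)
      have pr: "p \<otimes> r = \<zero>" using e p pe pp unfolding r_def p_def[symmetric] by (simp add: a_minus_def r_distr r_minus r_neg)
      have rp: "r \<otimes> p = \<zero>" using e p ee pp unfolding r_def p_def[symmetric] by (simp add: a_minus_def l_distr l_minus r_neg)
      have rr: "r \<otimes> r = r"
        using e p r er pr unfolding r_def[unfolded p_def[symmetric]] 
        by (simp add: a_minus_def l_distr l_minus)
      have Pf: "principal f = principal p"
      proof
        have "f \<in> principal p" using fp f(1) by (intro principalI) auto
        then show "principal f \<subseteq> principal p" by (rule principal_subset[OF left_ideal_principal[OF p]])
        have "p \<in> principal f" using e unfolding p_def by (intro principalI) auto
        then show "principal p \<subseteq> principal f" by (rule principal_subset[OF left_ideal_principal[OF f(1)]])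
      qed
      have pP: "p \<in> principal e" using pe p by (intro principalI) auto
      have rP: "r \<in> principal e" using re r by (intro principalI) auto
      have subs: "principal p \<subseteq> principal e" "principal r \<subseteq> principal e"
        using principal_subset[OF left_ideal_principal[OF e(1)]] pP rP by auto
      have fix_p: "x \<otimes> p = x" "x \<otimes> r = \<zero>" if "x \<in> principal p" for x
        using that p r pp pr by (auto elim!: principalE simp: m_assoc)
      have fix_r: "x \<otimes> r = x" "x \<otimes> p = \<zero>" if "x \<in> principal r" for x
        using that p r rr rp by (auto elim!: principalE simp: m_assoc)
      have p0: "p \<noteq> \<zero>" using fp f by auto
      have "p \<notin> principal r" using fix_r(2)[of p] pp p0 by auto
      then have "principal r \<subset> principal e" using subs pP by blast
      then have "m r < m e" by (rule m[OF r e(1)])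
      from less.hyps[OF this r rr] obtain F where F: "finite F"
        "\<And>I. I \<in> F \<Longrightarrow> simple_left_ideal R I \<and> I \<subseteq> principal r"
        and F3: "\<And>x. x \<in> principal r \<Longrightarrow> \<exists>!h. h \<in> (\<Pi>\<^sub>E I\<in>F. I) \<and> x = finsum R h F"
        by (elim exE conjE) auto
      have notin: "principal p \<notin> F"
      proof
        assume "principal p \<in> F"
        then have "p \<in> principal r" using F(2) principal_self[OF p] by blast
        then show False using \<open>p \<notin> principal r\<close> by blast
      qed
      have Fc: "h I \<in> carrier R" if "h \<in> (\<Pi>\<^sub>E I\<in>F. I)" "I \<in> F" for h I
        using that(1) F(2)[OF that(2)] left_idealD(1)[OF left_ideal_principal[OF r]] that(2)
        by (auto simp: PiE_def Pi_def)
      have sumr: "finsum R h F \<in> principal r" if "\<And>I. I \<in> F \<Longrightarrow> h I \<in> I" for h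
        by (rule left_ideal_finsum[OF left_ideal_principal[OF r]]) (use that F(2) in blast)
      let ?F = "insert (principal p) F"
      have ins: "finsum R h ?F = h (principal p) \<oplus> finsum R h F" if "h \<in> (\<Pi>\<^sub>E I\<in>?F. I)" for h
      proof (rule finsum_insert[OF F(1) notin])
        show "h \<in> F \<rightarrow> carrier R"
          using Fc[of "restrict h F"] that by (auto simp: PiE_def Pi_def)
        show "h (principal p) \<in> carrier R"
          using that left_idealD(1)[OF left_ideal_principal[OF p]] by (auto simp: PiE_def Pi_def)
      qed
      have "\<exists>!h. h \<in> (\<Pi>\<^sub>E I\<in>?F. I) \<and> x = finsum R h ?F" if x: "x \<in> principal e" for x
      proof -
        have xc: "x \<in> carrier R" using x left_idealD(1)[OF left_ideal_principal[OF e(1)]] by blast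
        have xe: "x \<otimes> e = x" using x e by (auto elim!: principalE simp: m_assoc)
        have xp: "x \<otimes> p \<in> principal p" and xr: "x \<otimes> r \<in> principal r"
          using xc by (auto intro: principalI)
        have xs: "x = x \<otimes> p \<oplus> x \<otimes> r" using xe xc p r ep by (metis r_distr)
        obtain h where h: "h \<in> (\<Pi>\<^sub>E I\<in>F. I)" "x \<otimes> r = finsum R h F"
          and hu: "\<And>h'. h' \<in> (\<Pi>\<^sub>E I\<in>F. I) \<Longrightarrow> x \<otimes> r = finsum R h' F \<Longrightarrow> h' = h"
          using F3[OF xr] by (elim ex1E conjE) metis
        let ?h = "h(principal p := x \<otimes> p)"
        have hF: "?h \<in> (\<Pi>\<^sub>E I\<in>?F. I)" using h(1) xp notin by (auto simp: PiE_def extensional_def)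
        have "finsum R ?h F = finsum R h F"
          by (rule finsum_cong') (use notin Fc[OF h(1)] in auto)
        then have "x = finsum R ?h ?F" using ins[OF hF] h(2) xs by simp
        moreover have "k = ?h" if k: "k \<in> (\<Pi>\<^sub>E I\<in>?F. I)" "x = finsum R k ?F" for k
        proof -
          have kp: "k (principal p) \<in> principal p" and kr: "finsum R k F \<in> principal r"
            using k(1) sumr[of k] by auto
          have kc: "k (principal p) \<in> carrier R" "finsum R k F \<in> carrier R"
            using kp kr left_idealD(1)[OF left_ideal_principal[OF p]]
              left_idealD(1)[OF left_ideal_principal[OF r]] by auto
          have eq: "x = k (principal p) \<oplus> finsum R k F" using k ins by simp
          have 1: "x \<otimes> p = k (principal p)"
            using kc p fix_p(1)[OF kp] fix_r(2)[OF kr] by (subst eq) (simp add: l_distr)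
          have 2: "x \<otimes> r = finsum R k F"
            using kc r fix_p(2)[OF kp] fix_r(1)[OF kr] by (subst eq) (simp add: l_distr)
          have k': "restrict k F \<in> (\<Pi>\<^sub>E I\<in>F. I)" using k(1) by auto
          have "finsum R (restrict k F) F = finsum R k F"
            by (rule finsum_cong') (use Fc[OF k'] in \<open>auto simp: restrict_def\<close>)
          then have "restrict k F = h" using hu[OF k'] 2 by simp
          then have "h I = (if I \<in> F then k I else undefined)" for I by auto
          moreover have "k I = undefined" if "I \<notin> ?F" for I
            using k(1) that by (auto simp: PiE_def extensional_def)
          ultimately show "k = ?h"
            using 1 by (intro ext) (metis fun_upd_apply insertE)
        qed
        ultimately show ?thesis using hF by (intro ex1I[of _ ?h]) auto
      qed
      moreover have "\<forall>I \<in> ?F. simple_left_ideal R I \<and> I \<subseteq> principal e"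
        using f(5) subs unfolding Pf by (auto dest!: F(2))
      ultimately show ?thesis using F(1) by (intro exI[of _ ?F]) simp
    qed
  qed
  have "principal \<one> = carrier R"
    by (auto elim!: principalE intro!: principalI)
  then show ?thesis
    unfolding semisimple_ring_def
    using split[OF one_closed] ring_axioms by auto
qed

end

section \<open>Simultaneous eigenvectors of commuting operators\<close>

locale linear_operators = vector_space scale
  for scale :: "'a::field \<Rightarrow> 'b::ab_group_add \<Rightarrow> 'b" (infixr "*s" 75)
begin

abbreviation lin :: "('b \<Rightarrow> 'b) \<Rightarrow> bool" where
  "lin \<equiv> module_hom scale scale"

lemma linI:
  assumes "\<And>x y. f (x + y) = f x + f y" "\<And>c x. f (c *s x) = c *s f x"
  shows "lin f"
  using assms by unfold_locales auto

lemma lin_comp: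
  assumes "lin f" "lin g"
  shows "lin (\<lambda>x. f (g x))"
  using assms by (intro linI) (simp_all add: module_hom.add module_hom.scale)

lemma subspace_sum2:
  assumes "subspace A" "subspace B"
  shows "subspace {a + b | a b. a \<in> A \<and> b \<in> B}"
  using subspace_sums[OF assms] .

lemma finite_span_subset:
  assumes "finite A" "A \<subseteq> span B"
  shows "\<exists>F. finite F \<and> F \<subseteq> B \<and> A \<subseteq> span F"
  using assms
proof (induction A rule: finite_induct)
  case empty
  then show ?case by (intro exI[of _ "{}"]) auto
next
  case (insert x A)
  obtain F where F: "finite F" "F \<subseteq> B" "A \<subseteq> span F" using insert by auto
  obtain t r where t: "finite t" "t \<subseteq> B" "x = (\<Sum>a\<in>t. r a *s a)"
    using insert.prems unfolding span_explicit by auto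
  have "x \<in> span t" unfolding t(3) by (intro span_sum span_scale span_base)
  then have "x \<in> span (F \<union> t)" using span_mono[of t "F \<union> t"] by blast
  moreover have "A \<subseteq> span (F \<union> t)" using F(3) span_mono[of F "F \<union> t"] by blast
  ultimately show ?case using F t by (intro exI[of _ "F \<union> t"]) auto
qed

lemma dim_strict_mono:
  assumes "subspace A" "A \<subset> B" "B \<subseteq> span F" "finite F"
  shows "dim A < dim B"
proof -
  obtain C where C: "C \<subseteq> A" "independent C" "A \<subseteq> span C" "card C = dim A"
    using basis_exists[of A] by auto
  obtain D where D: "D \<subseteq> B" "independent D" "B \<subseteq> span D" "card D = dim B"
    using basis_exists[of B] by auto
  obtain a where a: "a \<in> B" "a \<notin> A" using assms(2) by blast
  have "span C \<subseteq> A" by (rule span_minimal[OF C(1) assms(1)])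
  then have "a \<notin> span C" using a by blast
  then have "independent (insert a C)" "a \<notin> C" using C(2) independent_insertI span_base by blast+
  moreover have "finite D"
    using independent_span_bound[OF assms(4) D(2)] D(1) assms(3) by auto
  moreover have "insert a C \<subseteq> span D" using a C D assms(2) by auto
  ultimately have "finite (insert a C)" "card (insert a C) \<le> card D"
    using independent_span_bound[of D "insert a C"] by auto
  then show ?thesis using C D \<open>a \<notin> C\<close> by simp
qed

primrec shifts :: "(('b \<Rightarrow> 'b) \<times> 'a) list \<Rightarrow> 'b \<Rightarrow> 'b" where
  "shifts [] x = x"
| "shifts (p # ps) x = fst p (shifts ps x) - snd p *s shifts ps x"

lemma lin_shifts:
  assumes "\<And>p. p \<in> set ps \<Longrightarrow> lin (fst p)"
  shows "lin (shifts ps)"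
  using assms
proof (induction ps)
  case Nil
  then show ?case by (auto intro: linI)
next
  case (Cons p ps)
  then have "lin (shifts ps)" "lin (fst p)" by auto
  then show ?case by (intro linI) (simp_all add: module_hom.add module_hom.scale algebra_simps
      scale_right_distrib scale_right_diff_distrib scale_left_commute[of _ "snd p"])
qed

lemma shifts_append: "shifts (ps @ rs) x = shifts ps (shifts rs x)"
  by (induction ps) auto

lemma shifts_commute:
  assumes "lin g" "\<And>p x. p \<in> set ps \<Longrightarrow> g (fst p x) = fst p (g x)"
  shows "g (shifts ps x) = shifts ps (g x)"
  using assms by (induction ps) (auto simp: module_hom.diff module_hom.scale)

lemma shifts_eigen:
  assumes "\<And>p. p \<in> set ps \<Longrightarrow> lin (fst p) \<and> (\<exists>c. fst p x = c *s x \<and> c \<noteq> snd p)"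
  shows "\<exists>g. g \<noteq> 0 \<and> shifts ps x = g *s x"
  using assms
proof (induction ps)
  case Nil
  then show ?case by (intro exI[of _ 1]) auto
next
  case (Cons p ps)
  then obtain g where g: "g \<noteq> 0" "shifts ps x = g *s x" by force
  obtain c where c: "lin (fst p)" "fst p x = c *s x" "c \<noteq> snd p" using Cons.prems[of p] by auto
  have "shifts (p # ps) x = ((c - snd p) * g) *s x"
    using c g by (simp add: module_hom.scale algebra_simps scale_left_diff_distrib)
  then show ?case using c g by (intro exI[of _ "(c - snd p) * g"]) auto
qed

text \<open>
  The vectors annihilated by some product of factors \<open>f - r\<close> with \<open>(f, r)\<close> in \<open>P\<close>.  With commuting
  operators and \<open>P\<close> the pairs that differ from a given system of eigenvalues, this is a subspace which
  contains the eigenvectors of all other systems and meets the given common eigenspace in zero; it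
  replaces a direct sum decomposition.
\<close>

definition killed :: "(('b \<Rightarrow> 'b) \<times> 'a) set \<Rightarrow> 'b set" where
  "killed P = {x. \<exists>ps. set ps \<subseteq> P \<and> shifts ps x = 0}"

definition commuting_ops :: "('b \<Rightarrow> 'b) set \<Rightarrow> bool" where
  "commuting_ops A \<longleftrightarrow> (\<forall>f \<in> A. lin f) \<and> (\<forall>f \<in> A. \<forall>g \<in> A. \<forall>x. f (g x) = g (f x))"

lemma shifts_swap:
  assumes "commuting_ops A" "fst ` set ps \<subseteq> A" "fst ` set rs \<subseteq> A"
  shows "shifts ps (shifts rs x) = shifts rs (shifts ps x)"
proof (rule shifts_commute)
  show "lin (shifts ps)" using assms by (intro lin_shifts) (auto simp: commuting_ops_def)
  fix p x assume p: "p \<in> set rs"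
  show "shifts ps (fst p x) = fst p (shifts ps x)"
  proof (rule shifts_commute[symmetric])
    have "fst p \<in> A" using p assms by blast
    then show "lin (fst p)" using assms(1) by (simp add: commuting_ops_def)
    fix p' y assume "p' \<in> set ps"
    then have "fst p' \<in> A" using assms by blast
    then show "fst p (fst p' y) = fst p' (fst p y)"
      using \<open>fst p \<in> A\<close> assms(1) by (simp add: commuting_ops_def)
  qed
qed

lemma subspace_killed:
  assumes "commuting_ops A" "fst ` P \<subseteq> A"
  shows "subspace (killed P)"
proof (rule subspaceI)
  have l: "lin (shifts ps)" if "set ps \<subseteq> P" for ps
    using that assms by (intro lin_shifts) (auto simp: commuting_ops_def)
  have "shifts [] 0 = 0" by simp
  then show "0 \<in> killed P" unfolding killed_def by (auto intro: exI[of _ "[]"])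
  show "x + y \<in> killed P" if xy: "x \<in> killed P" "y \<in> killed P" for x y
  proof -
    have "\<exists>ps. set ps \<subseteq> P \<and> shifts ps x = 0" "\<exists>rs. set rs \<subseteq> P \<and> shifts rs y = 0"
      using xy unfolding killed_def by simp_all
    then obtain ps rs where *: "set ps \<subseteq> P" "shifts ps x = 0" "set rs \<subseteq> P" "shifts rs y = 0"
      by (elim exE conjE)
    have "fst ` set ps \<subseteq> A" "fst ` set rs \<subseteq> A" using * assms by auto
    then have "shifts ps (shifts rs x) = shifts rs (shifts ps x)"
      by (rule shifts_swap[OF assms(1)])
    then have "shifts (ps @ rs) (x + y) = 0"
      using * by (simp add: shifts_append module_hom.add[OF l] module_hom.zero[OF l])
    then show ?thesis using * unfolding killed_def by (auto intro!: exI[of _ "ps @ rs"])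
  qed
  show "c *s x \<in> killed P" if x: "x \<in> killed P" for c x
  proof -
    obtain ps where "set ps \<subseteq> P" "shifts ps x = 0" using x by (auto simp: killed_def)
    then show ?thesis using l[of ps] unfolding killed_def
      by (auto intro!: exI[of _ ps] simp: module_hom.scale)
  qed
qed

lemma killed_stable:
  assumes "lin g" "\<And>p x. p \<in> P \<Longrightarrow> g (fst p x) = fst p (g x)" "x \<in> killed P"
  shows "g x \<in> killed P"
proof -
  obtain ps where ps: "set ps \<subseteq> P" "shifts ps x = 0" using assms(3) by (auto simp: killed_def)
  have "shifts ps (g x) = g (shifts ps x)"
    by (rule shifts_commute[symmetric]) (use assms ps in auto)
  then show ?thesis using ps module_hom.zero[OF assms(1)] by (auto simp: killed_def intro!: exI[of _ ps])
qed

lemma killed_eigenvector: "(f, r) \<in> P \<Longrightarrow> f x = r *s x \<Longrightarrow> x \<in> killed P"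
  by (auto simp: killed_def intro!: exI[of _ "[(f, r)]"])

lemma killed_eq_0:
  assumes "x \<in> killed P" "\<And>p. p \<in> P \<Longrightarrow> lin (fst p) \<and> (\<exists>c. fst p x = c *s x \<and> c \<noteq> snd p)"
  shows "x = 0"
proof -
  obtain ps where ps: "set ps \<subseteq> P" "shifts ps x = 0" using assms(1) by (auto simp: killed_def)
  obtain g where "g \<noteq> 0" "shifts ps x = g *s x"
    using shifts_eigen[of ps x] assms(2) ps(1) by blast
  then show ?thesis using ps by simp
qed

abbreviation roots :: "('b \<Rightarrow> 'b) \<Rightarrow> 'a list \<Rightarrow> (('b \<Rightarrow> 'b) \<times> 'a) list" where
  "roots f cs \<equiv> map (Pair f) cs"

text \<open>
  With \<open>y\<close> the image of \<open>x\<close> under the product over the other roots, a multiple of \<open>y\<close> is the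
  component of \<open>x\<close> for the first root, and the remainder is annihilated by the other factors.
\<close>

lemma eigen_decomposition:
  assumes f: "lin f" and "subspace N" "\<And>x. x \<in> N \<Longrightarrow> f x \<in> N"
    and "distinct cs" "x \<in> N" "shifts (roots f cs) x = 0"
  shows "x \<in> span (\<Union>c\<in>set cs. {y \<in> N. f y = c *s y})"
  using assms(4-6)
proof (induction cs arbitrary: x)
  case Nil
  then show ?case by (simp add: span_zero)
next
  case (Cons c cs)
  define y where "y = shifts (roots f cs) x"
  have lp: "lin (shifts (roots f cs))" by (rule lin_shifts) (use f in auto)
  have sN: "shifts (roots f ds) z \<in> N" if "z \<in> N" for ds z
    using that by (induction ds) (auto intro!: subspace_diff subspace_scale assms)
  have fy: "f y = c *s y" using Cons.prems(3) by (simp add: y_def)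
  have "lin (fst p) \<and> (\<exists>c. fst p y = c *s y \<and> c \<noteq> snd p)" if "p \<in> set (roots f cs)" for p
    using that f fy Cons.prems(1) by auto
  then have "\<exists>g. g \<noteq> 0 \<and> shifts (roots f cs) y = g *s y" by (rule shifts_eigen)
  then obtain g where g: "g \<noteq> 0" "shifts (roots f cs) y = g *s y" by blast
  let ?x = "x - inverse g *s y"
  have yN: "y \<in> N" unfolding y_def by (rule sN[OF Cons.prems(2)])
  have "shifts (roots f cs) ?x = 0"
    using g lp by (simp add: module_hom.diff module_hom.scale flip: y_def)
  moreover have "?x \<in> N" using yN Cons.prems(2) assms(2) by (intro subspace_diff subspace_scale)
  ultimately have "?x \<in> span (\<Union>c\<in>set cs. {y \<in> N. f y = c *s y})"
    using Cons.IH Cons.prems(1) by simp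
  then have "?x \<in> span (\<Union>c\<in>set (c # cs). {y \<in> N. f y = c *s y})"
    by (rule rev_subsetD[OF _ span_mono]) auto
  moreover have "inverse g *s y \<in> span (\<Union>c\<in>set (c # cs). {y \<in> N. f y = c *s y})"
    using yN fy by (intro span_scale span_base) auto
  ultimately have "?x + inverse g *s y \<in> span (\<Union>c\<in>set (c # cs). {y \<in> N. f y = c *s y})"
    by (rule span_add)
  then show ?case by simp
qed

end

section \<open>Boxes, residues and standard sequences\<close>

text \<open>
  A pair of partitions is encoded by two Maya diagrams \<open>s (c, _) :: int \<Rightarrow> bool\<close>, one for each value
  of \<open>c\<close>.  The node \<open>(c, i)\<close> stands for a box of content \<open>i\<close> in the component \<open>c\<close>; adding it moves
  the bead at \<open>i\<close> to the empty place \<open>i - 1\<close>.  A list of nodes, the last added one first, is standard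
  if every node can be added in turn.
\<close>

type_synonym node = "bool \<times> int"

definition up :: "node \<Rightarrow> node" where "up b = (fst b, snd b + 1)"
definition dn :: "node \<Rightarrow> node" where "dn b = (fst b, snd b - 1)"

lemma up_dn_simps [simp]:
  "fst (up b) = fst b" "snd (up b) = snd b + 1" "fst (dn b) = fst b" "snd (dn b) = snd b - 1"
  "up (dn b) = b" "dn (up b) = b" "up b \<noteq> b" "dn b \<noteq> b" "b \<noteq> up b" "b \<noteq> dn b" "up b \<noteq> dn b" "dn b \<noteq> up b"
  "b \<noteq> up (up b)" "b \<noteq> dn (dn b)"
  by (auto simp: up_def dn_def prod_eq_iff)

lemma up_eq_iff: "up b = c \<longleftrightarrow> b = dn c" "dn b = c \<longleftrightarrow> b = up c"
  by (auto simp: up_def dn_def prod_eq_iff)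

primrec diagram :: "node list \<Rightarrow> node \<Rightarrow> bool" where
  "diagram [] = (\<lambda>b. snd b \<ge> 0)"
| "diagram (b # a) = (diagram a)(b := False, dn b := True)"

definition addable :: "node list \<Rightarrow> node \<Rightarrow> bool" where
  "addable a b \<longleftrightarrow> diagram a b \<and> \<not> diagram a (dn b)"

definition removable :: "node list \<Rightarrow> node \<Rightarrow> bool" where
  "removable a b \<longleftrightarrow> \<not> diagram a b \<and> diagram a (dn b)"

primrec std :: "node list \<Rightarrow> bool" where
  "std [] = True"
| "std (b # a) \<longleftrightarrow> std a \<and> addable a b"

primrec addables :: "node list \<Rightarrow> node list" where
  "addables [] = [(True, 0), (False, 0)]"
| "addables (b # a) = filter (addable (b # a)) (up b # dn b # remove1 b (addables a))"

lemma addable_Cons: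
  assumes "addable a b"
  shows "addable (b # a) c \<longleftrightarrow> c \<noteq> b \<and> (addable a c \<or> (c = up b \<and> diagram a c) \<or> (c = dn b \<and> \<not> diagram a (dn c)))"
  using assms unfolding addable_def
  by (cases "c = b"; cases "c = up b"; cases "c = dn b") (auto simp: up_eq_iff)

lemma not_adjacent:
  assumes "addable a b" "addable a c"
  shows "c \<noteq> up b" "c \<noteq> dn b"
  using assms by (auto simp: addable_def)

lemma addables:
  assumes "std a"
  shows "set (addables a) = {b. addable a b} \<and> distinct (addables a)"
  using assms
proof (induction a)
  case Nil
  then show ?case by (auto simp: addable_def prod_eq_iff)
next
  case (Cons b a)
  then have IH: "set (addables a) = {c. addable a c}" "distinct (addables a)" and b: "addable a b"
    by auto
  have "c \<in> set (addables (b # a)) \<longleftrightarrow> addable (b # a) c" for c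
    unfolding addables.simps set_filter list.set set_remove1_eq[OF IH(2)] IH(1)
    using addable_Cons[OF b, of c] by blast
  then have "set (addables (b # a)) = {c. addable (b # a) c}" by blast
  moreover have "up b \<notin> set (addables a)" "dn b \<notin> set (addables a)"
    using IH(1) not_adjacent[OF b] by blast+
  ultimately show ?case using IH(2) by simp
qed

text \<open>
  The contents of the addable boxes of a partition of size \<open>k > 0\<close> lie between minus its number of
  rows and its number of columns, and these two numbers add up to at most \<open>k + 1\<close>.
\<close>

lemma diagram_bounds:
  assumes "std a"
  defines "k \<equiv> \<lambda>c. int (length (filter (\<lambda>b. fst b = c) a))"
  shows "\<exists>A B. 0 \<le> A \<and> A \<le> k c \<and> 0 \<le> B \<and> B \<le> k c \<and> A + B \<le> k c + 1 \<and>
    (\<forall>i\<ge>A. diagram a (c, i)) \<and> (\<forall>i < -B. \<not> diagram a (c, i))"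
  using assms(1) unfolding k_def
proof (induction a)
  case Nil
  then show ?case by (intro exI[of _ 0]) auto
next
  case (Cons b a)
  let ?k = "int (length (filter (\<lambda>b. fst b = c) a))"
  obtain A B where AB: "0 \<le> A" "A \<le> ?k" "0 \<le> B" "B \<le> ?k" "A + B \<le> ?k + 1"
    "\<And>i. i \<ge> A \<Longrightarrow> diagram a (c, i)" "\<And>i. i < -B \<Longrightarrow> \<not> diagram a (c, i)"
    using Cons by auto
  show ?case
  proof (cases "fst b = c")
    case False
    then show ?thesis using AB by (intro exI[of _ A] exI[of _ B]) (auto simp: dn_def)
  next
    case True
    then obtain i where b: "b = (c, i)" by (cases b) auto
    have i: "- B \<le> i" "i \<le> A"
      using Cons.prems b AB(6)[of "i - 1"] AB(7)[of i] by (force simp: addable_def dn_def)+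
    let ?A = "max A (i + 1)" and ?B = "max B (1 - i)"
    have "?A + ?B \<le> ?k + 2"
      using i AB(1-5) by (auto simp: max_def)
    moreover have "?A \<le> ?k + 1" "?B \<le> ?k + 1" using i AB(1-5) by auto
    ultimately show ?thesis
      using AB True b i by (intro exI[of _ ?A] exI[of _ ?B]) (auto simp: dn_def)
  qed
qed

lemma addable_bounds:
  assumes a: "std a" and "addable a (c, i)" "addable a (c', j)"
  shows "c = c' \<Longrightarrow> \<bar>i - j\<bar> \<le> int (length a) + 1" "c \<noteq> c' \<Longrightarrow> \<bar>i - j\<bar> \<le> int (length a)"
proof -
  define k where "k = (\<lambda>c. int (length (filter (\<lambda>b. fst b = c) a)))"
  have bounds: "\<exists>A B. 0 \<le> A \<and> A \<le> k c \<and> 0 \<le> B \<and> B \<le> k c \<and> A + B \<le> k c + 1 \<and>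
      (\<forall>i. addable a (c, i) \<longrightarrow> - B \<le> i \<and> i \<le> A)" for c
  proof -
    obtain A B where AB: "0 \<le> A" "A \<le> k c" "0 \<le> B" "B \<le> k c" "A + B \<le> k c + 1"
      "\<And>i. i \<ge> A \<Longrightarrow> diagram a (c, i)" "\<And>i. i < -B \<Longrightarrow> \<not> diagram a (c, i)"
      using diagram_bounds[OF a, of c] unfolding k_def by auto
    have "- B \<le> i \<and> i \<le> A" if "addable a (c, i)" for i
      using that AB(6)[of "i - 1"] AB(7)[of i] by (force simp: addable_def dn_def)
    then show ?thesis using AB by blast
  qed
  have len: "k c + k c' \<le> int (length a)" if "c \<noteq> c'"
  proof -
    have "length (filter (\<lambda>b. fst b = c') a) = length (filter (\<lambda>b. \<not> fst b = c) a)"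
      using that by (intro arg_cong[where f = length] filter_cong) auto
    then show ?thesis using sum_length_filter_compl[of "\<lambda>b. fst b = c" a] by (simp add: k_def)
  qed
  have le: "k c \<le> int (length a)" by (simp add: k_def)
  obtain A B where 1: "0 \<le> A" "A \<le> k c" "0 \<le> B" "B \<le> k c" "A + B \<le> k c + 1"
    "\<And>i. addable a (c, i) \<Longrightarrow> - B \<le> i \<and> i \<le> A"
    using bounds[of c] by blast
  obtain A' B' where 2: "A' \<le> k c'" "B' \<le> k c'" "\<And>i. addable a (c', i) \<Longrightarrow> - B' \<le> i \<and> i \<le> A'"
    using bounds[of c'] by blast
  show "\<bar>i - j\<bar> \<le> int (length a) + 1" if "c = c'"
    using 1(5) 1(6)[of i] 1(6)[of j] assms(2,3) le that by (auto simp: abs_le_iff)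
  show "\<bar>i - j\<bar> \<le> int (length a)" if "c \<noteq> c'"
    using 1(2,4) 1(6)[of i] 2(1,2) 2(3)[of j] assms(2,3) len[OF that] by (auto simp: abs_le_iff)
qed

lemma std_append: "std (p @ e) \<Longrightarrow> std e"
  by (induction p) auto

lemma diagram_append_swap:
  assumes "addable e u" "addable e v" "u \<noteq> v"
  shows "diagram (p @ u # v # e) = diagram (p @ v # u # e)"
proof (induction p)
  case Nil
  have "u \<noteq> dn v" "v \<noteq> dn u" "dn u \<noteq> dn v"
    using assms not_adjacent[of e u v] by (auto simp: dn_def prod_eq_iff)
  then show ?case using assms(3) by (simp add: fun_upd_twist)
qed simp

lemma std_append_swap:
  assumes "std (p @ v # u # e)" "std (u # v # e)"
  shows "std (p @ u # v # e)"
  using assms(1)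
proof (induction p)
  case Nil
  show ?case using assms(2) by simp
next
  case (Cons b p)
  have "std (v # u # e)" using Cons.prems by (auto dest: std_append)
  then have "u \<noteq> v" using addable_Cons[of e u v] by auto
  then have "diagram (p @ u # v # e) = diagram (p @ v # u # e)"
    using diagram_append_swap[of e u v p] assms(2) \<open>std (v # u # e)\<close> by simp
  then have "addable (p @ u # v # e) b" using Cons.prems by (simp add: addable_def)
  then show ?case using Cons.IH Cons.prems by simp
qed

section \<open>Jucys--Murphy elements\<close>

locale hecke_module = linear_operators scale
  for scale :: "'k::field \<Rightarrow> 'v::ab_group_add \<Rightarrow> 'v" (infixr "*s" 75) +
  fixes T :: "nat \<Rightarrow> 'v \<Rightarrow> 'v" and q Q :: 'k and d :: nat
  assumes q0: "q \<noteq> 0" and Q0: "Q \<noteq> 0"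
    and T_lin: "lin (T t)"
    and quad_0: "1 \<le> d \<Longrightarrow> T 0 (T 0 x) = (inverse Q - Q) *s T 0 x + x"
    and quad: "1 \<le> i \<Longrightarrow> i < d \<Longrightarrow> T i (T i x) = (inverse q - q) *s T i x + x"
    and braid3: "1 \<le> i \<Longrightarrow> Suc i < d \<Longrightarrow> T i (T (Suc i) (T i x)) = T (Suc i) (T i (T (Suc i) x))"
    and braid4: "2 \<le> d \<Longrightarrow> T 0 (T (Suc 0) (T 0 (T (Suc 0) x))) = T (Suc 0) (T 0 (T (Suc 0) (T 0 x)))"
    and far: "Suc i < j \<Longrightarrow> j < d \<Longrightarrow> T i (T j x) = T j (T i x)"
begin

abbreviation \<kappa> :: 'k where "\<kappa> \<equiv> inverse q - q"

lemmas T_simps = module_hom.add[OF T_lin] module_hom.scale[OF T_lin] module_hom.diff[OF T_lin]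
  module_hom.zero[OF T_lin]

primrec L :: "nat \<Rightarrow> 'v \<Rightarrow> 'v" where
  "L 0 = T 0"
| "L (Suc k) = (\<lambda>x. T (Suc k) (L k (T (Suc k) x)))"

lemma L_lin: "lin (L k)"
proof (induction k)
  case (Suc k)
  show ?case unfolding L.simps by (rule lin_comp[OF T_lin lin_comp[OF Suc T_lin]])
qed (simp add: T_lin)

lemmas L_simps = module_hom.add[OF L_lin] module_hom.scale[OF L_lin] module_hom.diff[OF L_lin]
  module_hom.zero[OF L_lin]

lemma TL_above: "Suc k < t \<Longrightarrow> t < d \<Longrightarrow> T t (L k x) = L k (T t x)"
proof (induction k arbitrary: x)
  case (Suc k)
  then show ?case
    using far[of "Suc k" t x] far[of "Suc k" t "L k (T (Suc k) x)"] by simp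
next
  case 0
  then show ?case using far[of 0 t x] by simp
qed

lemma TL_below: "t < k \<Longrightarrow> k < d \<Longrightarrow> T t (L k x) = L k (T t x)"
proof (induction k arbitrary: x)
  case (Suc k)
  show ?case
  proof (cases "t = k")
    case False
    then have "t < k" "Suc t < Suc k" using Suc.prems by auto
    then show ?thesis using Suc far[of t "Suc k"] by simp
  next
    case True
    show ?thesis
    proof (cases k)
      case 0
      then show ?thesis using braid4[of x] Suc.prems True by simp
    next
      case (Suc j)
      have b: "T k (T (Suc k) (T k y)) = T (Suc k) (T k (T (Suc k) y))" for y
        using braid3[of k y] Suc Suc.prems True by simp
      have "T k (L (Suc k) x) = T k (T (Suc k) (T k (L j (T k (T (Suc k) x)))))"
        using Suc by simp
      also have "\<dots> = T (Suc k) (T k (T (Suc k) (L j (T k (T (Suc k) x)))))" by (rule b)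
      also have "\<dots> = T (Suc k) (T k (L j (T (Suc k) (T k (T (Suc k) x)))))"
        using TL_above[of j "Suc k"] Suc \<open>Suc k < d\<close> by simp
      also have "\<dots> = T (Suc k) (T k (L j (T k (T (Suc k) (T k x)))))" by (simp add: b)
      also have "\<dots> = L (Suc k) (T k x)" using Suc by simp
      finally show ?thesis using True by simp
    qed
  qed
qed simp

lemma LL_less: "j < k \<Longrightarrow> k < d \<Longrightarrow> L j (L k x) = L k (L j x)"
  by (induction j arbitrary: x) (simp_all add: TL_below)

lemma LL_commute: "j < d \<Longrightarrow> k < d \<Longrightarrow> L j (L k x) = L k (L j x)"
  using LL_less[of j k x] LL_less[of k j x] by (cases j k rule: linorder_cases) auto

lemma L_Suc_T:
  assumes "Suc k < d"
  shows "L (Suc k) (T (Suc k) x) = T (Suc k) (L k x) + \<kappa> *s L (Suc k) x"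
  using quad[of "Suc k" x] assms by (simp add: T_simps L_simps)

lemma L_T_Suc:
  assumes "Suc k < d"
  shows "L k (T (Suc k) x) = T (Suc k) (L (Suc k) x) - \<kappa> *s L (Suc k) x"
  using quad[of "Suc k" "L k (T (Suc k) x)"] assms by simp

text \<open>
  Let \<open>H\<^sub>k\<close> be the algebra generated by \<open>T\<^sub>0, \<dots>, T\<^sub>k\<^sub>-\<^sub>1\<close>.  The \<open>H\<^sub>k\<close>-submodules are the sets \<open>N\<close> with
  \<open>stab k N\<close>, and \<open>cyc k x\<close> below is \<open>H\<^sub>k x\<close>.  As \<open>L\<^sub>k\<close> commutes with \<open>H\<^sub>k\<close>, its eigenspaces are
  \<open>H\<^sub>k\<close>-submodules.
\<close>

definition stab :: "nat \<Rightarrow> 'v set \<Rightarrow> bool" where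
  "stab k N \<longleftrightarrow> subspace N \<and> (\<forall>t<k. \<forall>x\<in>N. T t x \<in> N)"

lemma stabI: "subspace N \<Longrightarrow> (\<And>t x. t < k \<Longrightarrow> x \<in> N \<Longrightarrow> T t x \<in> N) \<Longrightarrow> stab k N"
  by (simp add: stab_def)

lemma stabD: "stab k N \<Longrightarrow> subspace N" "stab k N \<Longrightarrow> t < k \<Longrightarrow> x \<in> N \<Longrightarrow> T t x \<in> N"
  by (auto simp: stab_def)

lemma stab_mono: "stab k N \<Longrightarrow> j \<le> k \<Longrightarrow> stab j N"
  by (auto simp: stab_def)

lemma stab_Int: "stab k N \<Longrightarrow> stab k M \<Longrightarrow> stab k (N \<inter> M)"
  by (auto simp: stab_def subspace_inter)

lemma stab_L: "stab k N \<Longrightarrow> j < k \<Longrightarrow> x \<in> N \<Longrightarrow> L j x \<in> N"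
  by (induction j arbitrary: x) (auto simp: stab_def)

lemma stab_eigenspace: "m < d \<Longrightarrow> k \<le> m \<Longrightarrow> stab k {x. L m x = r *s x}"
proof (rule stabI)
  show "subspace {x. L m x = r *s x}"
    by (rule subspaceI) (auto simp: L_simps scale_right_distrib scale_left_commute)
  show "T t x \<in> {x. L m x = r *s x}" if "m < d" "k \<le> m" "t < k" "x \<in> {x. L m x = r *s x}" for t x
    using that TL_below[of t m x] by (simp add: T_simps)
qed

lemma stab_sum2:
  assumes "stab k A" "stab k B"
  shows "stab k {a + b | a b. a \<in> A \<and> b \<in> B}"
proof (rule stabI)
  show "subspace {a + b | a b. a \<in> A \<and> b \<in> B}"
    using assms by (intro subspace_sum2) (auto simp: stab_def)
  show "T t x \<in> {a + b | a b. a \<in> A \<and> b \<in> B}"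
    if t: "t < k" and x: "x \<in> {a + b | a b. a \<in> A \<and> b \<in> B}" for t x
  proof -
    obtain a b where "x = a + b" "a \<in> A" "b \<in> B" using x by blast
    then have "T t x = T t a + T t b" "T t a \<in> A" "T t b \<in> B"
      using assms t by (auto simp: T_simps stab_def)
    then show ?thesis by blast
  qed
qed

lemma stab_span:
  assumes "\<And>A. A \<in> F \<Longrightarrow> stab k A"
  shows "stab k (span (\<Union>F))"
proof (rule stabI)
  fix t x assume t: "t < k" and "x \<in> span (\<Union>F)"
  have "subspace {x. T t x \<in> span (\<Union>F)}"
    by (rule module_hom.subspace_linear_preimage[OF T_lin]) simp
  moreover have "\<Union>F \<subseteq> {x. T t x \<in> span (\<Union>F)}"
    using assms t by (auto simp: stab_def intro!: span_base)
  ultimately have "span (\<Union>F) \<subseteq> {x. T t x \<in> span (\<Union>F)}" by (intro span_minimal)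
  then show "T t x \<in> span (\<Union>F)" using \<open>x \<in> span (\<Union>F)\<close> by blast
qed simp

lemma stab_killed: "stab k (killed {(L k, s) | s. s \<noteq> r})" if "k < d"
proof (rule stabI)
  show "subspace (killed {(L k, s) | s. s \<noteq> r})"
    by (rule subspace_killed[of "{L k}"]) (auto simp: commuting_ops_def L_lin)
  show "T t x \<in> killed {(L k, s) | s. s \<noteq> r}" if "t < k" "x \<in> killed {(L k, s) | s. s \<noteq> r}" for t x
    by (rule killed_stable[OF T_lin]) (use that \<open>k < d\<close> in \<open>auto simp: TL_below\<close>)
qed

definition cyc :: "nat \<Rightarrow> 'v \<Rightarrow> 'v set" where
  "cyc k x = \<Inter>{N. stab k N \<and> x \<in> N}"

lemma stab_cyc: "stab k (cyc k x)"
  unfolding cyc_def stab_def by (auto intro!: subspace_Inter)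

lemma cyc_self: "x \<in> cyc k x"
  by (auto simp: cyc_def)

lemma cyc_minimal: "stab k N \<Longrightarrow> x \<in> N \<Longrightarrow> cyc k x \<subseteq> N"
  by (auto simp: cyc_def)

lemma cyc_subset: "y \<in> cyc k x \<Longrightarrow> cyc k y \<subseteq> cyc k x"
  by (rule cyc_minimal[OF stab_cyc])

definition res :: "node \<Rightarrow> 'k" where
  "res b = (if fst b then inverse Q else - Q) * q powi (- 2 * snd b)"

lemma res_nonzero: "res b \<noteq> 0"
  using q0 Q0 by (simp add: res_def)

lemma res_up: "res (up b) = inverse (q\<^sup>2) * res b" and res_dn: "res (dn b) = q\<^sup>2 * res b"
proof -
  have "q powi (- 2 * snd b + (- 2)) = q powi (- 2 * snd b) * q powi (- 2)"
    using q0 by (intro power_int_add) auto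
  moreover have "q powi (- 2 * snd b + 2) = q powi (- 2 * snd b) * q powi 2"
    using q0 by (intro power_int_add) auto
  moreover have "q powi (- 2) = inverse (q\<^sup>2)" "q powi 2 = q\<^sup>2"
    by (simp_all add: power_int_minus)
  ultimately show "res (up b) = inverse (q\<^sup>2) * res b" "res (dn b) = q\<^sup>2 * res b"
    by (simp_all add: res_def algebra_simps)
qed

text \<open>
  The weight space of a sequence of boxes: the common eigenspace of \<open>L\<^sub>0, L\<^sub>1, \<dots>\<close> for the residues of
  the boxes in the order in which they were added.
\<close>

primrec W :: "node list \<Rightarrow> 'v set" where
  "W [] = UNIV"
| "W (b # a) = {x \<in> W a. L (length a) x = res b *s x}"

lemma stab_W: "stab 0 (W a)"
proof (induction a)
  case (Cons b a)
  have "W (b # a) = W a \<inter> {x. L (length a) x = res b *s x}" by auto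
  moreover have "subspace {x. L (length a) x = res b *s x}"
    by (rule subspaceI) (auto simp: L_simps scale_right_distrib scale_left_commute)
  ultimately show ?case using Cons by (simp add: stab_def subspace_inter)
qed (simp add: stab_def)

lemma subspace_W: "subspace (W a)"
  using stab_W by (simp add: stab_def)

lemma W_append: "x \<in> W (p @ a) \<Longrightarrow> x \<in> W a"
  by (induction p) auto

lemma W_T: "x \<in> W a \<Longrightarrow> length a < t \<Longrightarrow> t < d \<Longrightarrow> T t x \<in> W a"
  by (induction a) (auto simp: TL_above[symmetric] T_simps)

lemma W_L: "x \<in> W a \<Longrightarrow> length a \<le> d \<Longrightarrow> k < d \<Longrightarrow> L k x \<in> W a"
  by (induction a) (auto simp: L_simps LL_commute[of _ k])

text \<open>
  For an eigenvector \<open>x\<close> of \<open>L\<^sub>m\<close> with eigenvalue \<open>b\<close> the commutation rule turns the factors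
  \<open>L\<^sub>m - c\<close> behind \<open>T\<^sub>m\<^sub>+\<^sub>1\<close> into factors \<open>L\<^sub>m\<^sub>+\<^sub>1 - c\<close> in front of \<open>x\<close>.
\<close>

lemma shifts_through_T:
  assumes "Suc m < d" "L m x = b *s x" "w = shifts (roots (L (Suc m)) cs) x"
  shows "shifts (roots (L m) cs) (L m (T (Suc m) x) - b *s T (Suc m) x) =
    T (Suc m) (L (Suc m) w - b *s w) - \<kappa> *s L (Suc m) w"
  unfolding assms(3)
proof (induction cs)
  case Nil
  show ?case using assms(1) by (simp add: L_T_Suc T_simps del: L.simps)
next
  case (Cons c cs)
  define w where "w = shifts (roots (L (Suc m)) cs) x"
  define z where "z = L (Suc m) w - b *s w"
  have lw: "L m w = b *s w"
  proof -
    have "L m w = shifts (roots (L (Suc m)) cs) (L m x)"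
      unfolding w_def by (rule shifts_commute[OF L_lin]) (use assms(1) LL_commute[of m "Suc m"] in auto)
    also have "\<dots> = b *s w"
      unfolding w_def assms(2) by (rule module_hom.scale[OF lin_shifts]) (auto simp: L_lin simp del: L.simps)
    finally show ?thesis .
  qed
  have llw: "L m (L (Suc m) w) = b *s L (Suc m) w"
    using LL_commute[of m "Suc m" w] assms(1) lw by (simp add: L_simps del: L.simps)
  have "shifts (roots (L m) (c # cs)) (L m (T (Suc m) x) - b *s T (Suc m) x)
    = L m (T (Suc m) z - \<kappa> *s L (Suc m) w) - c *s (T (Suc m) z - \<kappa> *s L (Suc m) w)"
    using Cons by (simp add: w_def[symmetric] z_def[symmetric] del: L.simps)
  also have "\<dots> = T (Suc m) (L (Suc m) (L (Suc m) w - c *s w) - b *s (L (Suc m) w - c *s w))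
      - \<kappa> *s L (Suc m) (L (Suc m) w - c *s w)"
    using assms(1) llw
    by (simp add: L_simps T_simps L_T_Suc z_def scale_right_diff_distrib scale_right_distrib
      scale_left_diff_distrib algebra_simps scale_left_commute del: L.simps)
  finally show ?case by (simp add: w_def del: L.simps)
qed

text \<open>
  If the eigenvalues of \<open>L\<^sub>m\<close> on the span of \<open>x\<close> and \<open>T\<^sub>m\<^sub>+\<^sub>1 x\<close> are among \<open>b\<close> and \<open>cs\<close>, those of
  \<open>L\<^sub>m\<^sub>+\<^sub>1\<close> on \<open>x\<close> are among \<open>q\<^sup>-\<^sup>2 b\<close>, \<open>q\<^sup>2 b\<close> and \<open>cs\<close>.
\<close>

lemma next_eigenvalues:
  assumes "Suc m < d" "L m x = b *s x"
    and "shifts (roots (L m) cs) (L m (T (Suc m) x) - b *s T (Suc m) x) = 0"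
  shows "shifts (roots (L (Suc m)) (inverse (q\<^sup>2) * b # q\<^sup>2 * b # cs)) x = 0"
proof -
  define y where "y = shifts (roots (L (Suc m)) cs) x"
  define M where "M = L (Suc m)"
  have M: "M (u + v) = M u + M v" "M (u - v) = M u - M v" "M (c *s u) = c *s M u" for u v c
    by (simp_all add: M_def L_simps del: L.simps)
  have ly: "L m y = b *s y"
  proof -
    have "L m y = shifts (roots (L (Suc m)) cs) (L m x)"
      unfolding y_def by (rule shifts_commute[OF L_lin]) (use assms(1) LL_commute[of m "Suc m"] in auto)
    also have "\<dots> = b *s y"
      unfolding y_def assms(2) by (rule module_hom.scale[OF lin_shifts]) (auto simp: L_lin simp del: L.simps)
    finally show ?thesis .
  qed
  have 1: "T (Suc m) (M y - b *s y) = \<kappa> *s M y"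
    using shifts_through_T[OF assms(1,2) refl, of cs] assms(3) by (simp add: y_def M_def del: L.simps)
  then have "T (Suc m) (T (Suc m) (M y - b *s y)) = \<kappa> *s T (Suc m) (M y)"
    by (simp add: T_simps)
  then have "\<kappa> *s T (Suc m) (M y - b *s y) + (M y - b *s y) = \<kappa> *s T (Suc m) (M y)"
    using quad[of "Suc m"] assms(1) by simp
  then have 2: "M y - b *s y = \<kappa> *s b *s T (Suc m) y"
    by (simp add: T_simps scale_right_diff_distrib algebra_simps)
  have "M (T (Suc m) y) = b *s T (Suc m) y + \<kappa> *s M y"
    using L_Suc_T[OF assms(1), of y] ly by (simp add: M_def T_simps del: L.simps)
  then have "M (M y - b *s y) = \<kappa> *s b *s (b *s T (Suc m) y + \<kappa> *s M y)"
    by (simp add: 2 M)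
  also have "\<dots> = b *s (M y - b *s y) + (\<kappa> * \<kappa> * b) *s M y"
    by (simp add: 2 scale_right_distrib scale_left_commute mult_ac)
  finally have "M (M y) - b *s M y = b *s M y - (b * b) *s y + (\<kappa> * \<kappa> * b) *s M y"
    by (simp only: M scale_right_diff_distrib scale_scale)
  then have "M (M y) = b *s M y + (b *s M y - (b * b) *s y + (\<kappa> * \<kappa> * b) *s M y)"
    by (metis add.commute diff_add_cancel)
  then have 3: "M (M y) = (2 * b + \<kappa> * \<kappa> * b) *s M y - (b * b) *s y"
    by (simp only: mult_2 scale_left_distrib) (simp only: algebra_simps)
  have c: "2 * b + \<kappa> * \<kappa> * b = q\<^sup>2 * b + inverse (q\<^sup>2) * b" "inverse (q\<^sup>2) * b * (q\<^sup>2 * b) = b * b"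
    using q0 by (simp_all add: field_simps power2_eq_square)
  have "shifts (roots M [inverse (q\<^sup>2) * b, q\<^sup>2 * b]) y
    = M (M y) - (q\<^sup>2 * b + inverse (q\<^sup>2) * b) *s M y + (inverse (q\<^sup>2) * b * (q\<^sup>2 * b)) *s y"
    by (simp add: M scale_right_diff_distrib scale_left_distrib algebra_simps)
  also have "\<dots> = 0" unfolding 3 c by simp
  finally show ?thesis by (simp add: y_def M_def del: L.simps)
qed

end

section \<open>The spectrum of the Jucys--Murphy elements\<close>

locale separated_hecke_module = hecke_module scale T q Q d
  for scale :: "'k::field \<Rightarrow> 'v::ab_group_add \<Rightarrow> 'v" (infixr "*s" 75) and T q Q d +
  assumes sep_q: "0 < j \<Longrightarrow> j \<le> d \<Longrightarrow> q ^ (2 * j) \<noteq> 1"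
    and sep_Q: "\<bar>i\<bar> < int d \<Longrightarrow> Q powi (-2) + q powi (2 * i) \<noteq> 0"
begin

lemma res_neq_same:
  assumes "i \<noteq> j" "\<bar>i - j\<bar> \<le> int d"
  shows "res (c, i) \<noteq> res (c, j)"
proof -
  have neq: "q powi (-2 * i) \<noteq> q powi (-2 * j)" if ij: "i < j" "j - i \<le> int d" for i j
  proof
    assume eq: "q powi (-2 * i) = q powi (-2 * j)"
    have "q powi (-2 * i) = q powi (-2 * j + 2 * (j - i))" by simp
    also have "\<dots> = q powi (-2 * j) * q powi (2 * (j - i))" using q0 by (intro power_int_add) auto
    finally have "q powi (2 * (j - i)) = 1" using eq q0 by simp
    moreover have "2 * (j - i) = int (2 * nat (j - i))" using ij by simp
    ultimately have "q ^ (2 * nat (j - i)) = 1" by (metis power_int_of_nat)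
    then show False using sep_q[of "nat (j - i)"] ij by auto
  qed
  have "q powi (-2 * i) \<noteq> q powi (-2 * j)"
    using neq[of i j] neq[of j i] assms by (cases "i < j") (auto simp: abs_le_iff)
  then show ?thesis using Q0 by (simp add: res_def)
qed

lemma res_neq_cross:
  assumes "c \<noteq> c'" "\<bar>i - j\<bar> < int d"
  shows "res (c, i) \<noteq> res (c', j)"
proof -
  have neq: "inverse Q * q powi (-2 * i) \<noteq> - Q * q powi (-2 * j)" if "\<bar>i - j\<bar> < int d" for i j
  proof
    assume eq: "inverse Q * q powi (-2 * i) = - Q * q powi (-2 * j)"
    have "q powi (-2 * j) = q powi (-2 * i + 2 * (i - j))" by simp
    also have "\<dots> = q powi (-2 * i) * q powi (2 * (i - j))" using q0 by (intro power_int_add) auto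
    finally have "inverse Q * q powi (-2 * i) = (- Q * q powi (2 * (i - j))) * q powi (-2 * i)"
      using eq by (simp add: mult_ac)
    moreover have "q powi (-2 * i) \<noteq> 0" using q0 by simp
    ultimately have "inverse Q = - Q * q powi (2 * (i - j))"
      using mult_right_cancel[of "q powi (-2 * i)" "inverse Q" "- Q * q powi (2 * (i - j))"] by blast
    then have "inverse Q * inverse Q = (- Q * q powi (2 * (i - j))) * inverse Q"
      by (rule arg_cong)
    then have "Q powi (-2) + q powi (2 * (i - j)) = 0"
      using Q0 by (simp add: power_int_minus power2_eq_square)
    then show False using sep_Q[OF that] by blast
  qed
  show ?thesis
    using assms neq[of i j] neq[of j i] unfolding res_def
    by (cases c; cases c') (auto simp: abs_minus_commute)
qed

lemma res_neq:
  assumes "b \<noteq> c" "fst b = fst c \<Longrightarrow> \<bar>snd b - snd c\<bar> \<le> int d"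
    "fst b \<noteq> fst c \<Longrightarrow> \<bar>snd b - snd c\<bar> < int d"
  shows "res b \<noteq> res c"
proof (cases "fst b = fst c")
  case True
  then have "snd b \<noteq> snd c" using assms(1) by (auto simp: prod_eq_iff)
  then have "res (fst b, snd b) \<noteq> res (fst b, snd c)" using assms(2)[OF True] by (rule res_neq_same)
  moreover have "(fst b, snd c) = c" using True by (simp add: prod_eq_iff)
  ultimately show ?thesis by simp
next
  case False
  from res_neq_cross[OF this assms(3)[OF this]] show ?thesis unfolding prod.collapse .
qed

lemma addable_dist:
  assumes "std a" "addable a b" "addable a c"
  shows "fst b = fst c \<Longrightarrow> \<bar>snd b - snd c\<bar> \<le> int (length a) + 1"
    "fst b \<noteq> fst c \<Longrightarrow> \<bar>snd b - snd c\<bar> \<le> int (length a)"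
  using addable_bounds[OF assms(1), of "fst b" "snd b" "fst c" "snd c"] assms(2,3)
  unfolding prod.collapse by blast+

lemma res_inj:
  assumes "std a" "length a < d" "addable a b" "addable a c" "res b = res c"
  shows "b = c"
  using res_neq[of b c] addable_dist[OF assms(1,3,4)] assms(2,5) by force

lemma res_neighbour_neq:
  assumes "std a" "Suc (length a) < d" "addable a b" "addable a c" "b \<noteq> c"
  shows "res (up b) \<noteq> res c" "res (dn b) \<noteq> res c"
proof -
  have "up b \<noteq> c" "dn b \<noteq> c" using not_adjacent[OF assms(3,4)] by auto
  then show "res (up b) \<noteq> res c" "res (dn b) \<noteq> res c"
    using addable_dist[OF assms(1,3,4)] assms(2) by - (rule res_neq; force)+
qed

lemma res_up_neq: "1 \<le> d \<Longrightarrow> res (up b) \<noteq> res b" and res_dn_neq: "1 \<le> d \<Longrightarrow> res (dn b) \<noteq> res b"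
  by (rule res_neq; simp)+

lemma res_up_dn_neq: "2 \<le> d \<Longrightarrow> res (up b) \<noteq> res (dn b)"
  by (rule res_neq; simp)

lemma q4_neq: "2 \<le> d \<Longrightarrow> q\<^sup>2 \<noteq> -1"
proof
  assume d: "2 \<le> d" and "q\<^sup>2 = -1"
  then have "q ^ (2 * 2) = 1" unfolding power_mult by simp
  then show False using sep_q[of 2] d by simp
qed

lemma res_consecutive_neq:
  assumes "std (v # u # e)" "Suc (length e) < d"
  shows "res u \<noteq> res v"
proof -
  have *: "std e" "addable e u" "addable (u # e) v" using assms by auto
  then consider "addable e v" "v \<noteq> u" | "v = up u" | "v = dn u" using addable_Cons by blast
  then show ?thesis
    using res_inj[OF *(1) _ *(2), of v] res_up_neq[of u] res_dn_neq[of u] assms(2)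
    by cases auto
qed

definition \<alpha> :: "node \<Rightarrow> node \<Rightarrow> 'k" where
  "\<alpha> u v = \<kappa> * res v / (res v - res u)"

text \<open>
  The operator \<open>T\<^sub>i - \<alpha> u v\<close> intertwines: it exchanges the eigenvalues \<open>u\<close> and \<open>v\<close> of \<open>L\<^sub>i\<^sub>-\<^sub>1\<close> and
  \<open>L\<^sub>i\<close>, and its square is a scalar which vanishes only for adjacent contents.
\<close>

lemma intertwiner:
  assumes "Suc i < d" "res u \<noteq> res v" "L i y = res u *s y" "L (Suc i) y = res v *s y"
  shows "L i (T (Suc i) y - \<alpha> u v *s y) = res v *s (T (Suc i) y - \<alpha> u v *s y)"
    "L (Suc i) (T (Suc i) y - \<alpha> u v *s y) = res u *s (T (Suc i) y - \<alpha> u v *s y)"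
proof -
  have a: "\<alpha> u v * (res v - res u) = \<kappa> * res v" using assms(2) by (simp add: \<alpha>_def)
  have "L i (T (Suc i) y - \<alpha> u v *s y) - res v *s (T (Suc i) y - \<alpha> u v *s y)
    = (\<alpha> u v * (res v - res u) - \<kappa> * res v) *s y"
    using assms by (simp add: L_simps L_T_Suc T_simps scale_left_diff_distrib scale_right_diff_distrib
        right_diff_distrib algebra_simps del: L.simps)
  then show "L i (T (Suc i) y - \<alpha> u v *s y) = res v *s (T (Suc i) y - \<alpha> u v *s y)"
    by (simp add: a)
  have "L (Suc i) (T (Suc i) y - \<alpha> u v *s y) - res u *s (T (Suc i) y - \<alpha> u v *s y)
    = (\<kappa> * res v - \<alpha> u v * (res v - res u)) *s y"
    using assms by (simp add: L_simps L_Suc_T T_simps scale_left_diff_distrib scale_right_diff_distrib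
        right_diff_distrib algebra_simps del: L.simps)
  then show "L (Suc i) (T (Suc i) y - \<alpha> u v *s y) = res u *s (T (Suc i) y - \<alpha> u v *s y)"
    by (simp add: a)
qed

lemma intertwiner_norm:
  fixes a p r u v :: 'k
  assumes "a * a = (p - r) * a + 1" "a * (v - u) = (p - r) * v" "p * r = 1"
  shows "(v - p\<^sup>2 * u) * (v - r\<^sup>2 * u) = 0"
proof -
  have "((p - r) * v) * ((p - r) * v) = (a * a) * ((v - u) * (v - u))"
    unfolding assms(2)[symmetric] by (simp only: mult_ac)
  also have "\<dots> = (p - r) * (a * (v - u)) * (v - u) + (v - u) * (v - u)"
    unfolding assms(1) by (simp add: algebra_simps)
  finally have "((p - r) * v) * ((p - r) * v) = (p - r) * ((p - r) * v) * (v - u) + (v - u) * (v - u)"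
    unfolding assms(2) .
  then have h: "(v - u) * (v - u) - (p - r) * (p - r) * v * u = 0"
    by (simp add: algebra_simps)
  have eq: "(v - p\<^sup>2 * u) * (v - r\<^sup>2 * u) = (v - u) * (v - u) - (p - r) * (p - r) * v * u
      + ((p * r)\<^sup>2 - 1) * u * u - 2 * (p * r - 1) * v * u"
    by (simp add: power2_eq_square algebra_simps)
  show ?thesis unfolding eq h assms(3) by simp
qed

lemma intertwiner_nonzero:
  assumes "Suc i < d" "res v \<noteq> res u" "res v \<noteq> res (up u)" "res v \<noteq> res (dn u)" "y \<noteq> 0"
  shows "T (Suc i) y - \<alpha> u v *s y \<noteq> 0"
proof
  assume "T (Suc i) y - \<alpha> u v *s y = 0"
  then have t: "T (Suc i) y = \<alpha> u v *s y" by simp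
  have "(\<alpha> u v * \<alpha> u v) *s y = (\<kappa> * \<alpha> u v + 1) *s y"
    using quad[of "Suc i" y] assms(1) by (simp add: t T_simps scale_left_distrib)
  then have "\<alpha> u v * \<alpha> u v = \<kappa> * \<alpha> u v + 1" using assms(5) by simp
  moreover have "\<alpha> u v * (res v - res u) = \<kappa> * res v" using assms(2) by (simp add: \<alpha>_def)
  moreover have "inverse q * q = 1" using q0 by simp
  ultimately have "(res v - (inverse q)\<^sup>2 * res u) * (res v - q\<^sup>2 * res u) = 0"
    by (rule intertwiner_norm)
  then show False using assms(3,4) by (simp add: res_up res_dn power_inverse)
qed

lemma W_intertwiner:
  assumes "y \<in> W (v # u # e)" "Suc (length e) < d" "res u \<noteq> res v"
  shows "T (Suc (length e)) y - \<alpha> u v *s y \<in> W (u # v # e)"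
proof -
  have "y \<in> W e" "L (length e) y = res u *s y" "L (Suc (length e)) y = res v *s y"
    using assms(1) by (auto simp del: L.simps)
  moreover from this have "T (Suc (length e)) y - \<alpha> u v *s y \<in> W e"
    using W_T[of y e "Suc (length e)"] assms(2) subspace_W
    by (intro subspace_diff subspace_scale) auto
  ultimately show ?thesis
    using intertwiner[OF assms(2,3), of y] by (simp del: L.simps)
qed

lemma shifts_remove1:
  assumes "lin f" "b \<in> set cs"
  shows "shifts (roots f (map h cs)) z = shifts (roots f (map h (remove1 b cs))) (f z - h b *s z)"
  using assms(2)
proof (induction cs)
  case (Cons c cs)
  show ?case
  proof (cases "c = b")
    case True
    have l: "lin (shifts (roots f (map h cs)))" by (rule lin_shifts) (use assms in auto)
    have "f (shifts (roots f (map h cs)) z) = shifts (roots f (map h cs)) (f z)"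
      by (rule shifts_commute[OF assms(1)]) auto
    then show ?thesis using True by (simp add: module_hom.diff[OF l] module_hom.scale[OF l] del: map_map)
  next
    case False
    then show ?thesis using Cons by (simp del: map_map)
  qed
qed simp

text \<open>
  On the weight space of \<open>a\<close> the next Jucys--Murphy element satisfies the polynomial whose roots are the
  residues of the addable boxes.
\<close>

definition spectral :: "node list \<Rightarrow> bool" where
  "spectral a \<longleftrightarrow> (\<forall>x \<in> W a. shifts (roots (L (length a)) (map res (addables a))) x = 0)"

lemma eigenvalue_addable:
  assumes "spectral a" "std a" "z \<in> W a" "L (length a) z = r *s z" "z \<noteq> 0"
  shows "\<exists>b. addable a b \<and> res b = r"
proof (rule ccontr)
  assume no: "\<not> ?thesis"
  have "lin (fst p) \<and> (\<exists>c. fst p z = c *s z \<and> c \<noteq> snd p)"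
    if p: "p \<in> set (roots (L (length a)) (map res (addables a)))" for p
  proof -
    obtain b where "p = (L (length a), res b)" "addable a b"
      using p addables[OF assms(2)] by auto
    moreover from this have "r \<noteq> res b" using no by blast
    ultimately show ?thesis using assms(4) L_lin by (intro conjI exI[of _ r]) auto
  qed
  from shifts_eigen[of _ z, OF this] obtain g where
    "g \<noteq> 0" "shifts (roots (L (length a)) (map res (addables a))) z = g *s z"
    by blast
  then show False using assms(1,3,5) by (simp add: spectral_def)
qed

text \<open>
  Otherwise the intertwiner would give an eigenvector for the sequence in which \<open>b\<close> is added before \<open>c\<close>,
  but \<open>b\<close> is not addable to \<open>e\<close>.
\<close>

lemma T_adjacent_scalar:
  assumes "spectral e" "std (b # c # e)" "Suc (length e) < d" "b = up c \<or> b = dn c" "y \<in> W (b # c # e)"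
  shows "T (Suc (length e)) y = \<alpha> c b *s y"
proof (rule ccontr)
  assume "T (Suc (length e)) y \<noteq> \<alpha> c b *s y"
  then have nz: "T (Suc (length e)) y - \<alpha> c b *s y \<noteq> 0" by simp
  have e: "std e" "addable e c" "addable (c # e) b" using assms(2) by auto
  have "T (Suc (length e)) y - \<alpha> c b *s y \<in> W (c # b # e)"
    by (rule W_intertwiner[OF assms(5,3) res_consecutive_neq[OF assms(2,3)]])
  then have "T (Suc (length e)) y - \<alpha> c b *s y \<in> W e"
    "L (length e) (T (Suc (length e)) y - \<alpha> c b *s y) = res b *s (T (Suc (length e)) y - \<alpha> c b *s y)"
    by (auto simp del: L.simps)
  then obtain b' where b': "addable e b'" "res b' = res b"
    using eigenvalue_addable[OF assms(1) e(1) _ _ nz] by blast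
  have "b' \<noteq> c" using b' res_up_neq[of c] res_dn_neq[of c] assms(3,4) by auto
  then have "addable (c # e) b'" using addable_Cons[OF e(2)] b' by blast
  then have "b' = b" using res_inj[of "c # e" b' b] assms(2,3) b' by simp
  then show False using not_adjacent[OF e(2) b'(1)] assms(4) by blast
qed

text \<open>
  If the boxes \<open>c, b, c\<close> with \<open>b\<close> next to \<open>c\<close> occurred in a row, two neighbouring generators would act
  on \<open>y\<close> by scalars, one by \<open>q\<^sup>-\<^sup>1\<close> and one by \<open>-q\<close>.  The braid relation makes these scalars equal, which
  means \<open>q\<^sup>2 = -1\<close>.
\<close>

lemma no_return:
  assumes "spectral e" "spectral (c # e)" "std (b # c # e)" "Suc (Suc (length e)) < d"
    "b = up c \<or> b = dn c" "y \<in> W (b # c # e)" "L (Suc (Suc (length e))) y = res c *s y"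
  shows "y = 0"
proof (rule ccontr)
  assume y: "y \<noteq> 0"
  let ?i = "Suc (length e)"
  have e: "std e" "addable e c" "addable (c # e) b" using assms(3) by auto
  have rbc: "res b \<noteq> res c" using res_consecutive_neq[OF assms(3)] assms(4) by simp
  have 1: "T ?i y = \<alpha> c b *s y" by (rule T_adjacent_scalar) (use assms in auto)
  have 2: "T (Suc ?i) y = \<alpha> b c *s y"
  proof (rule ccontr)
    assume "T (Suc ?i) y \<noteq> \<alpha> b c *s y"
    then have nz: "T (Suc ?i) y - \<alpha> b c *s y \<noteq> 0" by simp
    have "y \<in> W (c # b # c # e)" using assms(6,7) by (simp del: L.simps)
    then have "T (Suc ?i) y - \<alpha> b c *s y \<in> W (b # c # c # e)"
      using W_intertwiner[of y c b "c # e"] assms(4) rbc by (simp del: L.simps W.simps)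
    then have "T (Suc ?i) y - \<alpha> b c *s y \<in> W (c # e)"
      "L (length (c # e)) (T (Suc ?i) y - \<alpha> b c *s y) = res c *s (T (Suc ?i) y - \<alpha> b c *s y)"
      by (auto simp del: L.simps)
    then obtain b' where b': "addable (c # e) b'" "res b' = res c"
      using eigenvalue_addable[OF assms(2) _ _ _ nz, of "res c"] e by (auto simp del: L.simps W.simps)
    then have "b' \<noteq> c" "addable e b' \<or> b' = up c \<or> b' = dn c" using addable_Cons[OF e(2)] by blast+
    then show False using res_inj[OF e(1) _ e(2), of b'] b' res_up_neq[of c] res_dn_neq[of c] assms(4) by auto
  qed
  have "(\<alpha> c b * \<alpha> b c * \<alpha> c b) *s y = (\<alpha> b c * \<alpha> c b * \<alpha> b c) *s y"
    using braid3[of ?i y] assms(4) by (simp add: 1 2 T_simps)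
  then have eq: "\<alpha> c b * \<alpha> b c * \<alpha> c b = \<alpha> b c * \<alpha> c b * \<alpha> b c" using y by simp
  have k: "\<kappa> \<noteq> 0"
    using sep_q[of 1] assms(4) q0 by (auto simp: field_simps power2_eq_square)
  have "\<alpha> c b \<noteq> 0" "\<alpha> b c \<noteq> 0" using k rbc res_nonzero by (auto simp: \<alpha>_def)
  then have "\<alpha> c b = \<alpha> b c" using eq by simp
  then have "\<kappa> * res b * (res c - res b) = \<kappa> * res c * (res b - res c)"
    using rbc by (simp add: \<alpha>_def frac_eq_eq)
  then have "\<kappa> * (res c - res b) * (res b + res c) = 0" by (simp add: algebra_simps)
  then have "res b = - res c" using k rbc by (simp add: eq_neg_iff_add_eq_0)
  moreover have "res b = inverse (q\<^sup>2) * res c \<or> res b = q\<^sup>2 * res c"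
    using assms(5) res_up[of c] res_dn[of c] by auto
  ultimately have "inverse (q\<^sup>2) * res c = - 1 * res c \<or> q\<^sup>2 * res c = -1 * res c" by auto
  then have "inverse (q\<^sup>2) = - 1 \<or> q\<^sup>2 = -1"
    using res_nonzero[of c] by (metis mult_cancel_right)
  then have "q\<^sup>2 = -1" by (metis inverse_inverse_eq inverse_minus_eq inverse_1)
  then show False using q4_neq assms(4) by simp
qed

text \<open>
  A removable node can be moved to the end of a standard sequence by exchanging neighbours whose
  contents are not adjacent, and intertwiners carry eigenvectors along.
\<close>

lemma move_removable:
  assumes "std a" "removable a c" "length a < d" "y \<in> W a" "y \<noteq> 0" "stab (length a) N" "y \<in> N"
  shows "\<exists>e y'. std (c # e) \<and> length (c # e) = length a \<and> diagram (c # e) = diagram a \<and>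
    y' \<in> W (c # e) \<and> y' \<in> N \<and> y' \<noteq> 0"
  using assms
proof (induction a arbitrary: y N)
  case Nil
  then show ?case by (auto simp: removable_def)
next
  case (Cons r a)
  show ?case
  proof (cases "r = c")
    case True
    then show ?thesis using Cons.prems by blast
  next
    case False
    have ra: "std a" "addable a r" using Cons.prems by auto
    have "c \<noteq> dn r" "dn c \<noteq> r" using Cons.prems(2) by (auto simp: removable_def up_eq_iff)
    then have "removable a c" "c \<noteq> up r"
      using Cons.prems(2) False by (auto simp: removable_def up_eq_iff)
    let ?N = "N \<inter> {x. L (length a) x = res r *s x}"
    have "stab (length a) ?N"
      using stab_mono[OF Cons.prems(6)] stab_eigenspace Cons.prems(3) by (intro stab_Int) auto
    moreover have yW: "y \<in> W a" and "y \<in> ?N" using Cons.prems(4,7) by auto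
    moreover have "length a < d" using Cons.prems(3) by simp
    ultimately have "\<exists>e y'. std (c # e) \<and> length (c # e) = length a \<and> diagram (c # e) = diagram a \<and>
      y' \<in> W (c # e) \<and> y' \<in> ?N \<and> y' \<noteq> 0"
      by (intro Cons.IH[OF ra(1) \<open>removable a c\<close> _ yW Cons.prems(5)])
    then obtain e y' where e: "std (c # e)" "length (c # e) = length a"
      "diagram (c # e) = diagram a" "y' \<in> W (c # e)" "y' \<in> ?N" "y' \<noteq> 0"
      by blast
    have len: "length a = Suc (length e)" "Suc (length e) < d" using e(2) Cons.prems(3) by auto
    have rce: "addable (c # e) r" using ra(2) unfolding addable_def e(3) .
    then have re: "addable e r"
      using addable_Cons[of e c r] e(1) \<open>c \<noteq> dn r\<close> \<open>c \<noteq> up r\<close> by (auto simp: up_eq_iff)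
    have ce: "std e" "addable e c" using e(1) by auto
    have cr: "addable (r # e) c" using addable_Cons[OF re] ce(2) False by blast
    have neq: "res r \<noteq> res c" "res r \<noteq> res (up c)" "res r \<noteq> res (dn c)"
      using res_inj[OF ce(1) _ ce(2) re] res_neighbour_neq[OF ce(1) len(2) ce(2) re] False len by auto
    let ?y = "T (length a) y' - \<alpha> c r *s y'"
    have "y' \<in> W (r # c # e)" using e(4,5) len by (simp del: L.simps)
    then have 1: "?y \<in> W (c # r # e)"
      using W_intertwiner[of y' r c e] len neq(1) by (simp del: L.simps W.simps)
    have 2: "?y \<noteq> 0" using intertwiner_nonzero[of "length e" r c y'] len neq e(6) by simp
    have "T (length a) y' \<in> N" using stabD(2)[OF Cons.prems(6)] e(5) by simp
    then have 3: "?y \<in> N" using e(5) stabD(1)[OF Cons.prems(6)] by (intro subspace_diff subspace_scale) auto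
    have "r \<noteq> c" using False by blast
    have 4: "diagram (c # r # e) = diagram (r # a)"
      using diagram_append_swap[OF ce(2) re, of "[]"] False e(3) by simp
    have "std (c # r # e)" using ce re cr by simp
    then show ?thesis using 1 2 3 4 len by (intro exI[of _ "r # e"] exI[of _ ?y]) simp
  qed
qed

lemma spectral_Nil: "1 \<le> d \<Longrightarrow> spectral []"
  unfolding spectral_def
proof
  fix x assume d: "1 \<le> d"
  have r: "res (True, 0) = inverse Q" "res (False, 0) = - Q" by (simp_all add: res_def)
  have "T 0 (T 0 x + Q *s x) - inverse Q *s (T 0 x + Q *s x)
    = T 0 (T 0 x) - (inverse Q - Q) *s T 0 x - (inverse Q * Q) *s x"
    by (simp add: T_simps scale_right_distrib scale_left_diff_distrib algebra_simps)
  also have "\<dots> = 0" using quad_0[OF d, of x] Q0 by simp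
  finally show "shifts (roots (L (length [])) (map res (addables []))) x = 0"
    using r by simp
qed

text \<open>
  A candidate eigenvalue that is not the residue of an addable node is \<open>res c\<close> with \<open>c\<close> next to the
  last node \<open>b\<close> and removable before \<open>b\<close> was added.
\<close>

lemma candidate_excluded:
  assumes sp: "\<And>a'. length a' \<le> length a \<Longrightarrow> std a' \<Longrightarrow> spectral a'"
    and a: "std (b # a)" "Suc (length a) < d" and c: "c = up b \<or> c = dn b" "\<not> addable (b # a) c"
    and y: "y \<in> W (b # a)" "L (Suc (length a)) y = res c *s y"
  shows "y = 0"
proof (rule ccontr)
  assume nz: "y \<noteq> 0"
  have b: "std a" "addable a b" using a by auto
  have "removable a c"
    using c b(2) unfolding addable_Cons[OF b(2)] removable_def addable_def by (auto simp: up_eq_iff)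
  let ?N = "{x. L (length a) x = res b *s x} \<inter> {x. L (Suc (length a)) x = res c *s x}"
  have "stab (length a) ?N"
    using a(2) by (intro stab_Int stab_eigenspace) auto
  moreover have "y \<in> ?N" and yW: "y \<in> W a" using y by (auto simp del: L.simps)
  moreover have "length a < d" using a(2) by simp
  ultimately have "\<exists>e y'. std (c # e) \<and> length (c # e) = length a \<and> diagram (c # e) = diagram a \<and>
      y' \<in> W (c # e) \<and> y' \<in> ?N \<and> y' \<noteq> 0"
    by (intro move_removable[OF b(1) \<open>removable a c\<close> _ yW nz])
  then obtain e y' where e: "std (c # e)" "length (c # e) = length a"
    "diagram (c # e) = diagram a" "y' \<in> W (c # e)" "y' \<in> ?N" "y' \<noteq> 0"
    by blast
  have len: "length a = Suc (length e)" using e(2) by simp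
  have "addable (c # e) b" using b(2) unfolding addable_def e(3) .
  then have "std (b # c # e)" using e(1) by simp
  moreover have "spectral e" "spectral (c # e)" using sp e(1,2) by auto
  moreover have "b = up c \<or> b = dn c" using c(1) by (auto simp: up_eq_iff)
  moreover have "y' \<in> W (b # c # e)" "L (Suc (Suc (length e))) y' = res c *s y'"
    using e(4,5) len by (auto simp del: L.simps)
  ultimately have "y' = 0" using no_return[of e c b y'] a(2) len by simp
  then show False using e(6) by blast
qed

text \<open>
  Adding \<open>b\<close> replaces the root \<open>res b\<close> of the polynomial for \<open>a\<close> by \<open>res (up b)\<close> and \<open>res (dn b)\<close>.  These
  roots are distinct, so the weight space is a sum of eigenspaces, and the eigenspaces for boxes that
  are not addable vanish.
\<close>

lemma spectral_Cons:
  assumes sp: "\<And>a'. length a' \<le> length a \<Longrightarrow> std a' \<Longrightarrow> spectral a'"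
    and a: "std (b # a)" "Suc (length a) < d"
  shows "spectral (b # a)"
  unfolding spectral_def
proof
  fix x assume x: "x \<in> W (b # a)"
  have b: "std a" "addable a b" using a by auto
  let ?M = "L (Suc (length a))" and ?cs = "up b # dn b # remove1 b (addables a)"
  have dist: "distinct (addables a)" and set: "set (addables a) = {c. addable a c}"
    using addables[OF b(1)] by auto
  have sc: "c = up b \<or> c = dn b \<or> (addable a c \<and> c \<noteq> b)" if "c \<in> set ?cs" for c
    using that dist set by auto
  have inj: "res u \<noteq> res v" if "addable a u" "addable a v" "u \<noteq> v" for u v
    using res_inj[OF b(1) _ that(1,2)] that(3) a(2) by auto
  have "inj_on res (set ?cs)"
  proof (rule inj_onI)
    fix u v assume uv: "u \<in> set ?cs" "v \<in> set ?cs" "res u = res v"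
    show "u = v"
      using sc[OF uv(1)] sc[OF uv(2)] uv(3) inj[of u v] res_neighbour_neq[OF b(1) a(2) b(2), of u]
        res_neighbour_neq[OF b(1) a(2) b(2), of v] res_up_dn_neq[of b] a(2)
      by auto
  qed
  moreover have "distinct ?cs"
  proof -
    have "up b \<notin> set (addables a)" "dn b \<notin> set (addables a)"
      using set not_adjacent[OF b(2)] by blast+
    then show ?thesis using dist by (simp add: distinct_remove1)
  qed
  ultimately have "distinct (map res ?cs)" by (simp add: distinct_map del: remove1.simps)
  moreover have "shifts (roots ?M (map res ?cs)) x = 0"
  proof -
    have "x \<in> W a" "L (length a) x = res b *s x" using x by auto
    moreover have "T (Suc (length a)) x \<in> W a" using W_T[OF \<open>x \<in> W a\<close>] a(2) by simp
    moreover have "b \<in> set (addables a)" using set b by simp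
    ultimately have "shifts (roots (L (length a)) (map res (remove1 b (addables a))))
      (L (length a) (T (Suc (length a)) x) - res b *s T (Suc (length a)) x) = 0"
      using sp[OF _ b(1)] shifts_remove1[OF L_lin, of b "addables a" "length a" res "T (Suc (length a)) x"]
      by (simp add: spectral_def del: map_map)
    from next_eigenvalues[OF a(2) \<open>L (length a) x = res b *s x\<close> this]
    show ?thesis by (simp only: list.map res_up res_dn)
  qed
  moreover have "?M z \<in> W (b # a)" if "z \<in> W (b # a)" for z
    using W_L[OF that, of "Suc (length a)"] a(2) by (simp del: L.simps W.simps)
  ultimately have "x \<in> span (\<Union>r\<in>set (map res ?cs). {y \<in> W (b # a). ?M y = r *s y})"
    using x by (intro eigen_decomposition[OF L_lin subspace_W]) auto
  moreover have "(\<Union>r\<in>set (map res ?cs). {y \<in> W (b # a). ?M y = r *s y})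
    \<subseteq> {z. shifts (roots ?M (map res (addables (b # a)))) z = 0}"
  proof
    fix y assume "y \<in> (\<Union>r\<in>set (map res ?cs). {y \<in> W (b # a). ?M y = r *s y})"
    then obtain c where c: "c \<in> set ?cs" "y \<in> W (b # a)" "?M y = res c *s y"
      unfolding set_map by blast
    have l: "lin (shifts (roots ?M cs))" for cs by (rule lin_shifts) (auto simp: L_lin simp del: L.simps)
    show "y \<in> {z. shifts (roots ?M (map res (addables (b # a)))) z = 0}"
    proof (cases "addable (b # a) c")
      case True
      then have "c \<in> set (addables (b # a))" using addables[OF a(1)] by blast
      from shifts_remove1[OF L_lin this, of "Suc (length a)" res y] c(3)
      show ?thesis by (simp add: module_hom.zero[OF l] del: map_map addables.simps L.simps)
    next
      case False
      then have "c = up b \<or> c = dn b" using sc[OF c(1)] addable_Cons[OF b(2), of c] by blast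
      from candidate_excluded[OF sp a this False c(2,3)] have "y = 0" by blast
      then show ?thesis by (simp add: module_hom.zero[OF l] del: map_map addables.simps L.simps)
    qed
  qed
  moreover have "subspace {z. shifts (roots ?M (map res (addables (b # a)))) z = 0}"
    by (rule module_hom.subspace_kernel, rule lin_shifts) (auto simp: L_lin simp del: L.simps)
  ultimately have "x \<in> {z. shifts (roots ?M (map res (addables (b # a)))) z = 0}"
    using span_minimal by blast
  then show "shifts (roots (L (length (b # a))) (map res (addables (b # a)))) x = 0"
    by (simp del: map_map addables.simps L.simps)
qed

theorem spectral: "std a \<Longrightarrow> length a < d \<Longrightarrow> spectral a"
proof (induction "length a" arbitrary: a rule: less_induct)
  case less
  then show ?case
  proof (cases a)
    case Nil
    then show ?thesis using less.prems spectral_Nil by simp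
  next
    case (Cons b a')
    then have "spectral a''" if "length a'' \<le> length a'" "std a''" for a''
      using less that by simp
    then show ?thesis using spectral_Cons[of a' b] Cons less.prems by simp
  qed
qed

lemma weight_step:
  assumes "stab k N" "length a < k" "k \<le> d" "std a" "x \<in> N \<inter> W a"
  shows "x \<in> span (\<Union>b\<in>{b. addable a b}. N \<inter> W (b # a))"
proof -
  have "distinct (map res (addables a))"
    using addables[OF assms(4)] res_inj[OF assms(4)] assms(2,3)
    by (auto simp: distinct_map intro!: inj_onI)
  moreover have "shifts (roots (L (length a)) (map res (addables a))) x = 0"
    using spectral[OF assms(4)] assms by (simp add: spectral_def)
  moreover have "L (length a) y \<in> N \<inter> W a" if "y \<in> N \<inter> W a" for y
    using that stab_L[OF assms(1,2)] W_L[of y a "length a"] assms(2,3) by auto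
  moreover have "subspace (N \<inter> W a)" using stabD(1)[OF assms(1)] subspace_W by (rule subspace_inter)
  ultimately have "x \<in> span (\<Union>r\<in>set (map res (addables a)). {y \<in> N \<inter> W a. L (length a) y = r *s y})"
    using assms(5) by (intro eigen_decomposition[OF L_lin]) auto
  also have "\<dots> \<subseteq> span (\<Union>b\<in>{b. addable a b}. N \<inter> W (b # a))"
    using addables[OF assms(4)] by (intro span_mono) auto
  finally show ?thesis .
qed

text \<open>
  The eigenvalues of the next Jucys--Murphy element on a weight space are simple, so that each box
  splits the weight space further.
\<close>

lemma weight_decomposition:
  assumes "stab k N" "k \<le> d" "x \<in> N"
  shows "x \<in> span (\<Union>a\<in>{a. std a \<and> length a = k}. N \<inter> W a)"
proof -
  have "x \<in> span (\<Union>a\<in>{a. std a \<and> length a = j}. N \<inter> W a)" if "j \<le> k" for j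
    using that
  proof (induction j)
    case 0
    have "x \<in> N \<inter> W []" using assms(3) by simp
    then show ?case by (intro span_base) (auto intro!: exI[of _ "[]"])
  next
    case (Suc j)
    let ?S = "\<lambda>j. \<Union>a\<in>{a. std a \<and> length a = j}. N \<inter> W a"
    have "?S j \<subseteq> span (?S (Suc j))"
    proof
      fix y assume "y \<in> ?S j"
      then obtain a where a: "std a" "length a = j" "y \<in> N \<inter> W a" by auto
      then have "y \<in> span (\<Union>b\<in>{b. addable a b}. N \<inter> W (b # a))"
        using Suc.prems by (intro weight_step[OF assms(1) _ assms(2)]) auto
      moreover have "(\<Union>b\<in>{b. addable a b}. N \<inter> W (b # a)) \<subseteq> ?S (Suc j)"
      proof
        fix z assume "z \<in> (\<Union>b\<in>{b. addable a b}. N \<inter> W (b # a))"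
        then obtain b where "addable a b" "z \<in> N \<inter> W (b # a)" by blast
        then show "z \<in> ?S (Suc j)" using a(1,2) by (intro UN_I[of "b # a"]) auto
      qed
      ultimately show "y \<in> span (?S (Suc j))" using span_mono by blast
    qed
    then have "span (?S j) \<subseteq> span (?S (Suc j))" by (rule span_minimal) simp
    then show ?case using Suc by auto
  qed
  then show ?thesis by simp
qed

lemma weight_vector_exists:
  assumes "stab k N" "k \<le> d" "x \<in> N" "x \<noteq> 0"
  shows "\<exists>a y. std a \<and> length a = k \<and> y \<in> N \<inter> W a \<and> y \<noteq> 0"
proof (rule ccontr)
  assume "\<not> ?thesis"
  then have "(\<Union>a\<in>{a. std a \<and> length a = k}. N \<inter> W a) \<subseteq> {0}" by blast
  then have "span (\<Union>a\<in>{a. std a \<and> length a = k}. N \<inter> W a) \<subseteq> {0}" by (rule span_minimal) simp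
  from subsetD[OF this weight_decomposition[OF assms(1-3)]] show False using assms(4) by simp
qed

end

section \<open>Simplicity of the modules generated by weight vectors\<close>

context separated_hecke_module
begin

text \<open>
  The space \<open>H\<^sub>k x + H\<^sub>k T\<^sub>k H\<^sub>k x\<close>.
\<close>

definition mackey :: "nat \<Rightarrow> 'v \<Rightarrow> 'v set" where
  "mackey k x = span (\<Union>(insert (cyc k x) ((\<lambda>y. cyc k (T k y)) ` cyc k x)))"

lemma stab_mackey: "stab k (mackey k x)"
  unfolding mackey_def by (rule stab_span) (auto intro: stab_cyc)

lemma mackey_upper: "cyc k x \<subseteq> mackey k x" "y \<in> cyc k x \<Longrightarrow> cyc k (T k y) \<subseteq> mackey k x"
  unfolding mackey_def by (auto intro!: span_base)

lemma mackey_minimal: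
  assumes "subspace N" "cyc k x \<subseteq> N" "\<And>y. y \<in> cyc k x \<Longrightarrow> cyc k (T k y) \<subseteq> N"
  shows "mackey k x \<subseteq> N"
  unfolding mackey_def using assms by (intro span_minimal) auto

lemma cyc_eigen:
  assumes "k < d" "L k x = r *s x" "y \<in> cyc k x"
  shows "L k y = r *s y"
  using cyc_minimal[OF stab_eigenspace[OF assms(1) order_refl], of x r] assms by blast

lemma cyc_0: "cyc 0 x \<subseteq> span {x}"
  by (rule cyc_minimal) (auto simp: stab_def intro: span_base)

lemma T_weight:
  assumes "std (v # u # e)" "Suc (length e) < d" "y \<in> W (v # u # e)"
  shows "T (Suc (length e)) y - \<alpha> u v *s y \<in> W (u # v # e)"
    "T (Suc (length e)) y = \<alpha> u v *s y \<or> std (u # v # e)"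
proof -
  show "T (Suc (length e)) y - \<alpha> u v *s y \<in> W (u # v # e)"
    by (rule W_intertwiner[OF assms(3,2) res_consecutive_neq[OF assms(1,2)]])
  have e: "std e" "addable e u" "addable (u # e) v" using assms(1) by auto
  show "T (Suc (length e)) y = \<alpha> u v *s y \<or> std (u # v # e)"
  proof (cases "v = up u \<or> v = dn u")
    case True
    then show ?thesis
      using T_adjacent_scalar[OF spectral[OF e(1)] assms(1,2) True assms(3)] assms(2) by simp
  next
    case False
    then have v: "addable e v" "v \<noteq> u" using e(3) addable_Cons[OF e(2)] by blast+
    then have "addable (v # e) u" using addable_Cons[OF v(1)] e(2) by blast
    then show ?thesis using e(1) v(1) by simp
  qed
qed

lemma weight_eigen_node:
  assumes "std a" "length a < d" "y \<in> W a" "y \<noteq> 0" "L (length a) y = res b *s y"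
  shows "\<exists>b'. res b' = res b \<and> std (b' # a) \<and> y \<in> W (b' # a)"
proof -
  obtain b' where "addable a b'" "res b' = res b"
    using eigenvalue_addable[OF spectral[OF assms(1,2)] assms(1,3,5,4)] by blast
  then show ?thesis using assms by (intro exI[of _ b']) simp
qed

text \<open>
  On a weight vector \<open>x\<close> the double cosets of \<open>H\<^sub>k\<close> in \<open>H\<^sub>k\<^sub>+\<^sub>1\<close> give \<open>H\<^sub>k\<^sub>+\<^sub>1 x = H\<^sub>k x + H\<^sub>k T\<^sub>k H\<^sub>k x\<close>.  The point is that \<open>T\<^sub>k h T\<^sub>k y\<close> stays in the
  right-hand side: up to terms of lower order \<open>T\<^sub>k y\<close> is again a weight vector, so that by induction
  \<open>h\<close> may be taken from \<open>H\<^sub>k\<^sub>-\<^sub>1\<close> or \<open>H\<^sub>k\<^sub>-\<^sub>1 T\<^sub>k\<^sub>-\<^sub>1 H\<^sub>k\<^sub>-\<^sub>1\<close>, and the braid relation applies.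
\<close>

theorem cyc_Suc_subset_mackey:
  assumes "std (b # a)" "length a = k" "k < d" "x \<in> W (b # a)"
  shows "cyc (Suc k) x \<subseteq> mackey k x"
  using assms
proof (induction k arbitrary: b a x)
  case 0
  then have t: "T 0 x = res b *s x" and s: "subspace (mackey 0 x)"
    using stabD(1)[OF stab_mackey] by auto
  have x: "x \<in> mackey 0 x" using mackey_upper(1) cyc_self by blast
  have "cyc (Suc 0) x \<subseteq> span {x}"
  proof (rule cyc_minimal, rule stabI)
    fix t y assume "t < Suc 0" "y \<in> span {x}"
    then show "T t y \<in> span {x}"
      using t by (auto simp: span_singleton T_simps scale_left_commute)
  qed (auto intro: span_base)
  also have "\<dots> \<subseteq> mackey 0 x" using x s by (intro span_minimal) auto
  finally show ?case .
next
  case (Suc j)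
  let ?k = "Suc j"
  let ?C = "cyc ?k x" and ?X = "mackey ?k x"
  define P where "P = {w. T ?k w \<in> ?X}"
  have a: "std a" "length a < d" "x \<in> W a" and lx: "L ?k x = res b *s x"
    using Suc.prems by (auto simp del: L.simps)
  have sX: "subspace ?X" using stabD(1)[OF stab_mackey] .
  have sP: "subspace P"
    unfolding P_def using sX by (rule module_hom.subspace_linear_preimage[OF T_lin])
  have TC: "T ?k y \<in> ?X" if "y \<in> ?C" for y
    using mackey_upper(2)[OF that] cyc_self by blast
  then have CP: "?C \<subseteq> P" by (auto simp: P_def)
  have CX: "?C \<subseteq> ?X" by (rule mackey_upper)
  have eigC: "L ?k y = res b *s y" if "y \<in> ?C" for y
    using cyc_eigen[OF Suc.prems(3) lx that] .
  define Y where "Y = {y \<in> ?C. cyc ?k (T ?k y) \<subseteq> P}"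
  have sY: "subspace Y"
  proof (rule subspaceI)
    have "0 \<in> ?C" by (rule subspace_0[OF stabD(1)[OF stab_cyc]])
    moreover from this have "cyc ?k 0 \<subseteq> P" using cyc_subset CP by blast
    ultimately show "0 \<in> Y" by (simp add: Y_def T_simps)
    fix u v c assume u: "u \<in> Y"
    have "cyc ?k (T ?k (c *s u)) \<subseteq> cyc ?k (T ?k u)"
      by (rule cyc_subset) (simp add: T_simps subspace_scale[OF stabD(1)[OF stab_cyc] cyc_self])
    then show "c *s u \<in> Y" using u subspace_scale[OF stabD(1)[OF stab_cyc]] by (auto simp: Y_def)
    assume v: "v \<in> Y"
    have "cyc ?k (T ?k (u + v)) \<subseteq> {r + s | r s. r \<in> cyc ?k (T ?k u) \<and> s \<in> cyc ?k (T ?k v)}"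
      by (rule cyc_minimal[OF stab_sum2[OF stab_cyc stab_cyc]]) (use cyc_self in \<open>auto simp: T_simps\<close>)
    also have "\<dots> \<subseteq> P" using u v subspace_add[OF sP] by (auto simp: Y_def)
    finally show "u + v \<in> Y" using u v subspace_add[OF stabD(1)[OF stab_cyc]] by (auto simp: Y_def)
  qed
  have "?C \<inter> W a' \<subseteq> Y" if a': "std a'" "length a' = ?k" for a'
  proof
    fix y assume y: "y \<in> ?C \<inter> W a'"
    show "y \<in> Y"
    proof (cases "y = 0")
      case True
      then show ?thesis using subspace_0[OF sY] by simp
    next
      case False
      obtain b' where b': "std (b' # a')" "y \<in> W (b' # a')"
        using weight_eigen_node[OF a'(1) _ _ False, of b] eigC[of y] y a'(2) Suc.prems(3) by auto
      obtain c e where ce: "a' = c # e" using a'(2) by (cases a') auto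
      have len: "length e = j" using ce a' by simp
      have b'c: "std (b' # c # e)" "y \<in> W (b' # c # e)" using b' ce by auto
      define v where "v = T ?k y - \<alpha> c b' *s y"
      have Ty: "T ?k y = \<alpha> c b' *s y + v" by (simp add: v_def)
      have cyP: "cyc ?k (T ?k y) \<subseteq> P" if v: "cyc ?k v \<subseteq> P"
      proof -
        have "cyc ?k (T ?k y) \<subseteq> {r + s | r s. r \<in> ?C \<and> s \<in> cyc ?k v}"
        proof (rule cyc_minimal[OF stab_sum2[OF stab_cyc stab_cyc]])
          have "\<alpha> c b' *s y \<in> ?C" using y subspace_scale[OF stabD(1)[OF stab_cyc]] by blast
          then show "T ?k y \<in> {r + s | r s. r \<in> ?C \<and> s \<in> cyc ?k v}" using Ty cyc_self by blast
        qed
        also have "\<dots> \<subseteq> P" using v CP subspace_add[OF sP] by blast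
        finally show ?thesis .
      qed
      have "cyc ?k v \<subseteq> P"
      proof (cases "v = 0")
        case True
        have "0 \<in> ?C" by (rule subspace_0[OF stabD(1)[OF stab_cyc]])
        then show ?thesis using True cyc_subset CP by blast
      next
        case vn: False
        have vW: "v \<in> W (c # b' # e)" and st: "std (c # b' # e)"
          using T_weight[OF b'c(1) _ b'c(2)] len Suc.prems(3) vn unfolding v_def by auto
        then have vW': "v \<in> W (b' # e)" and st': "std (b' # e)" by auto
        have IH: "cyc ?k v \<subseteq> mackey j v"
          using Suc.IH[OF st' len _ vW'] Suc.prems(3) by simp
        have form: "\<exists>y' \<in> cyc j y. w = T ?k y' - \<alpha> c b' *s y'" if "w \<in> cyc j v" for w
        proof -
          let ?S = "(\<lambda>y'. T ?k y' - \<alpha> c b' *s y') ` cyc j y"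
          have l: "lin (\<lambda>y'. T ?k y' - \<alpha> c b' *s y')"
            by (intro linI) (simp_all add: T_simps scale_right_distrib scale_right_diff_distrib
                scale_left_commute[of _ "\<alpha> c b'"])
          have "stab j ?S"
          proof (rule stabI)
            show "subspace ?S" by (rule module_hom.subspace_image[OF l stabD(1)[OF stab_cyc]])
            fix t w assume t: "t < j" and "w \<in> ?S"
            then obtain y' where y': "y' \<in> cyc j y" "w = T ?k y' - \<alpha> c b' *s y'" by auto
            have "T t w = T ?k (T t y') - \<alpha> c b' *s T t y'"
              using far[of t ?k y'] t Suc.prems(3) y' by (simp add: T_simps)
            then show "T t w \<in> ?S" using stabD(2)[OF stab_cyc t y'(1)] by blast
          qed
          moreover have "v \<in> ?S" using cyc_self v_def by blast
          ultimately show ?thesis using cyc_minimal that by blast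
        qed
        have yC: "cyc j y \<subseteq> ?C"
          using y stab_mono[OF stab_cyc[of ?k x], of j] by (intro cyc_minimal) auto
        have "cyc j v \<subseteq> P"
        proof
          fix w assume "w \<in> cyc j v"
          then obtain y' where y': "y' \<in> cyc j y" "w = T ?k y' - \<alpha> c b' *s y'" using form by blast
          have "T ?k w = \<kappa> *s T ?k y' + y' - \<alpha> c b' *s T ?k y'"
            using quad[of ?k y'] Suc.prems(3) y'(2) by (simp add: T_simps)
          moreover have "y' \<in> ?C" using y' yC by blast
          ultimately show "w \<in> P"
            unfolding P_def using TC[of y'] CX sX
            by (auto intro!: subspace_add subspace_diff subspace_scale)
        qed
        moreover have "cyc j (T j w) \<subseteq> P" if w: "w \<in> cyc j v" for w
        proof (rule cyc_minimal)
          show "stab j P"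
          proof (rule stabI[OF sP])
            fix t z assume "t < j" "z \<in> P"
            then show "T t z \<in> P"
              using far[of t ?k z] Suc.prems(3) stabD(2)[OF stab_mackey, of t ?k "T ?k z" x]
              by (simp add: P_def)
          qed
          show "T j w \<in> P"
          proof (cases j)
            case 0
            then have "L 0 w = res b' *s w"
              using cyc_eigen[of 0 v "res b'" w] w vW' len Suc.prems(3) by auto
            then show ?thesis using \<open>cyc j v \<subseteq> P\<close> w 0 subspace_scale[OF sP] by auto
          next
            case (Suc i)
            obtain y' where y': "y' \<in> cyc j y" "w = T ?k y' - \<alpha> c b' *s y'" using form w by blast
            have Ty': "T j y' \<in> ?C" using stabD(2)[OF stab_cyc, of j ?k y' x] y' yC by auto
            have "T ?k (T j w) = T j (T ?k (T j y')) - \<alpha> c b' *s T ?k (T j y')"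
              using braid3[of j y'] Suc Suc.prems(3) y'(2) by (simp add: T_simps)
            moreover have "T j (T ?k (T j y')) \<in> ?X"
              by (rule stabD(2)[OF stab_mackey]) (use TC[OF Ty'] in auto)
            ultimately show ?thesis
              unfolding P_def using TC[OF Ty'] sX by (auto intro!: subspace_diff subspace_scale)
          qed
        qed
        ultimately have "mackey j v \<subseteq> P" by (intro mackey_minimal sP)
        then show ?thesis using IH by blast
      qed
      then show ?thesis using cyP y by (simp add: Y_def)
    qed
  qed
  then have "(\<Union>a'\<in>{a'. std a' \<and> length a' = ?k}. ?C \<inter> W a') \<subseteq> Y" by blast
  then have "span (\<Union>a'\<in>{a'. std a' \<and> length a' = ?k}. ?C \<inter> W a') \<subseteq> Y"
    using sY by (rule span_minimal)
  then have "?C \<subseteq> Y" using weight_decomposition[OF stab_cyc, of ?k _ x] Suc.prems(3) by auto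
  then have XP: "?X \<subseteq> P" by (intro mackey_minimal sP CP) (auto simp: Y_def)
  have "stab (Suc ?k) ?X"
  proof (rule stabI[OF sX])
    fix t y assume "t < Suc ?k" "y \<in> ?X"
    then show "T t y \<in> ?X"
      using XP stabD(2)[OF stab_mackey, of t ?k y x] by (cases "t = ?k") (auto simp: P_def)
  qed
  then show ?case using cyc_minimal CX cyc_self by blast
qed

text \<open>
  Modulo eigenvectors of \<open>L\<^sub>k\<close> for other eigenvalues, \<open>H\<^sub>k\<^sub>+\<^sub>1 x\<close> agrees with \<open>H\<^sub>k x\<close>; hence the weight
  space of \<open>x\<close> in the module generated by \<open>x\<close> is a line.
\<close>

theorem cyc_weight_space:
  assumes "std a" "length a = k" "k \<le> d" "x \<in> W a" "z \<in> cyc k x" "z \<in> W a"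
  shows "z \<in> span {x}"
  using assms
proof (induction k arbitrary: a z)
  case 0
  then show ?case using cyc_0 by auto
next
  case (Suc k)
  obtain b a0 where ab: "a = b # a0" using Suc.prems(2) by (cases a) auto
  have a0: "std a0" "length a0 = k" "x \<in> W a0" "z \<in> W a0" "k < d"
    and lx: "L k x = res b *s x" and lz: "L k z = res b *s z"
    using Suc.prems ab by auto
  define E where "E = killed {(L k, s) | s. s \<noteq> res b}"
  have sE: "stab k E" unfolding E_def using a0(5) by (rule stab_killed)
  define U where "U = {u + e | u e. u \<in> cyc k x \<and> e \<in> E}"
  have sU: "stab k U" unfolding U_def by (rule stab_sum2[OF stab_cyc sE])
  have CU: "cyc k x \<subseteq> U" using subspace_0[OF stabD(1)[OF sE]] unfolding U_def by force
  have EU: "E \<subseteq> U" using subspace_0[OF stabD(1)[OF stab_cyc, of k x]] unfolding U_def by force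
  have TU: "T k y \<in> U" if "y \<in> cyc k x" for y
  proof (cases k)
    case 0
    then have "T k y = res b *s y" using cyc_eigen[OF a0(5) lx that] by simp
    then show ?thesis using that CU subspace_scale[OF stabD(1)[OF sU]] by auto
  next
    case (Suc j)
    let ?P = "{y. T k y \<in> U}"
    have sP: "subspace ?P" by (rule module_hom.subspace_linear_preimage[OF T_lin stabD(1)[OF sU]])
    have "cyc k x \<inter> W a' \<subseteq> ?P" if a': "std a'" "length a' = k" for a'
    proof
      fix y assume y: "y \<in> cyc k x \<inter> W a'"
      show "y \<in> ?P"
      proof (cases "y = 0")
        case True
        then show ?thesis using subspace_0[OF sP] by simp
      next
        case False
        obtain b' where b': "res b' = res b" "std (b' # a')" "y \<in> W (b' # a')"
          using weight_eigen_node[OF a'(1) _ _ False, of b] cyc_eigen[OF a0(5) lx, of y] y a'(2) a0(5)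
          by auto
        obtain c e where ce: "a' = c # e" using a'(2) Suc by (cases a') auto
        have len: "Suc (length e) = k" using ce a' by simp
        have b'c: "std (b' # c # e)" "y \<in> W (b' # c # e)" using b' ce by auto
        define v where "v = T k y - \<alpha> c b' *s y"
        have "v \<in> W (c # b' # e)" unfolding v_def
          using T_weight(1)[OF b'c(1) _ b'c(2)] len a0(5) by simp
        then have "L k v = res c *s v" using len by auto
        moreover have "res c \<noteq> res b" using res_consecutive_neq[OF b'c(1)] len a0(5) b'(1) by simp
        ultimately have "v \<in> E" unfolding E_def by (intro killed_eigenvector[of "L k" "res c"]) auto
        moreover have "\<alpha> c b' *s y \<in> cyc k x" using y subspace_scale[OF stabD(1)[OF stab_cyc]] by blast
        moreover have "T k y = \<alpha> c b' *s y + v" by (simp add: v_def)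
        ultimately show ?thesis unfolding U_def by blast
      qed
    qed
    then have "(\<Union>a'\<in>{a'. std a' \<and> length a' = k}. cyc k x \<inter> W a') \<subseteq> ?P" by blast
    then have "span (\<Union>a'\<in>{a'. std a' \<and> length a' = k}. cyc k x \<inter> W a') \<subseteq> ?P"
      using sP by (rule span_minimal)
    then show ?thesis using weight_decomposition[OF stab_cyc, of k y x] that a0(5) by auto
  qed
  have "mackey k x \<subseteq> U"
  proof (rule mackey_minimal[OF stabD(1)[OF sU] CU])
    show "cyc k (T k y) \<subseteq> U" if "y \<in> cyc k x" for y
      by (rule cyc_minimal[OF sU TU[OF that]])
  qed
  moreover have "cyc (Suc k) x \<subseteq> mackey k x"
    by (rule cyc_Suc_subset_mackey[of b a0]) (use Suc.prems ab in auto)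
  ultimately obtain u e where ue: "z = u + e" "u \<in> cyc k x" "e \<in> E"
    using Suc.prems(5) unfolding U_def by blast
  have "L k e = res b *s e"
    using lz cyc_eigen[OF a0(5) lx ue(2)] ue(1) by (simp add: L_simps scale_right_distrib)
  then have "e = 0"
    using ue(3) unfolding E_def by (elim killed_eq_0) (auto simp: L_lin)
  then show ?case using Suc.IH[OF a0(1,2) _ a0(3), of z] ue a0 by simp
qed

text \<open>
  Exchanging two consecutive boxes of a standard sequence; the classes generated by these exchanges
  label the simple modules.
\<close>

inductive swap :: "node list \<Rightarrow> node list \<Rightarrow> bool" where
  "std (p @ v # u # e) \<Longrightarrow> std (p @ u # v # e) \<Longrightarrow> swap (p @ v # u # e) (p @ u # v # e)"

lemma swap_std: "swap\<^sup>*\<^sup>* a b \<Longrightarrow> std a \<Longrightarrow> std b \<and> length b = length a"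
  by (induction rule: rtranclp_induct) (auto elim: swap.cases)

lemma W_append_intertwiner:
  assumes "y \<in> W (p @ v # u # e)" "length (p @ v # u # e) \<le> d" "res u \<noteq> res v"
  shows "T (Suc (length e)) y - \<alpha> u v *s y \<in> W (p @ u # v # e)"
  using assms(1,2)
proof (induction p)
  case Nil
  then show ?case using W_intertwiner[of y v u e] assms(3) by simp
next
  case (Cons r p)
  let ?m = "length (p @ v # u # e)"
  have "L ?m y = res r *s y" "T (Suc (length e)) y - \<alpha> u v *s y \<in> W (p @ u # v # e)"
    using Cons by auto
  moreover have "L ?m (T (Suc (length e)) y) = T (Suc (length e)) (L ?m y)"
    using TL_below[of "Suc (length e)" ?m y] Cons.prems(2) by simp
  ultimately have "L ?m (T (Suc (length e)) y - \<alpha> u v *s y) = res r *s (T (Suc (length e)) y - \<alpha> u v *s y)"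
    by (simp only: L_simps T_simps scale_right_diff_distrib scale_left_commute[of _ "\<alpha> u v"])
  then show ?case using \<open>T _ y - \<alpha> u v *s y \<in> W (p @ u # v # e)\<close> by simp
qed

text \<open>
  On a weight vector a generator acts by a scalar unless the two boxes concerned can be exchanged, and
  then the intertwiner leads to the weight space of the exchanged sequence.
\<close>

lemma stab_swap_class:
  assumes a: "std a" "length a = d"
  shows "stab d (span (\<Union>b\<in>{b. swap\<^sup>*\<^sup>* a b}. W b))"
proof (rule stabI)
  let ?U = "span (\<Union>b\<in>{b. swap\<^sup>*\<^sup>* a b}. W b)"
  fix t x assume t: "t < d" and x: "x \<in> ?U"
  have "T t y \<in> ?U" if b: "swap\<^sup>*\<^sup>* a b" and y: "y \<in> W b" for b y
  proof -
    have sb: "std b" "length b = d" using swap_std[OF b a(1)] a(2) by auto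
    have yU: "y \<in> ?U" using b y by (intro span_base) auto
    show ?thesis
    proof (cases t)
      case 0
      obtain p r where "b = p @ [r]" using sb(2) t by (cases b rule: rev_cases) auto
      then have "T 0 y = res r *s y" using W_append[of y p "[r]"] y by simp
      then show ?thesis using 0 yU by (simp add: span_scale)
    next
      case (Suc i)
      define p where "p = take (d - t - 1) b"
      have "length (drop (d - t - 1) b) = Suc (Suc i)" using sb(2) t Suc by simp
      then obtain v u e where "drop (d - t - 1) b = v # u # e" "length e = i"
        by (metis length_Suc_conv)
      then have e: "b = p @ v # u # e" "length e = i"
        using append_take_drop_id[of "d - t - 1" b] by (auto simp: p_def)
      have st: "std (v # u # e)" using sb(1) e(1) std_append by blast
      have yW: "y \<in> W (v # u # e)" using W_append y e(1) by blast
      have len: "Suc (length e) < d" using t Suc e(2) by simp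
      have neq: "res u \<noteq> res v" by (rule res_consecutive_neq[OF st len])
      show ?thesis
      proof (cases "T t y = \<alpha> u v *s y")
        case True
        then show ?thesis using yU by (simp add: span_scale)
      next
        case False
        then have "std (u # v # e)" using T_weight(2)[OF st len yW] Suc e(2) by simp
        then have "std (p @ u # v # e)" using std_append_swap sb(1) e(1) by blast
        then have "swap b (p @ u # v # e)" using sb(1) unfolding e(1) by (intro swap.intros) auto
        then have "swap\<^sup>*\<^sup>* a (p @ u # v # e)" using b by simp
        moreover have "T t y - \<alpha> u v *s y \<in> W (p @ u # v # e)"
          using W_append_intertwiner[of y p v u e] y e sb(2) neq Suc by simp
        ultimately have "T t y - \<alpha> u v *s y \<in> ?U" by (intro span_base) auto
        then have "(T t y - \<alpha> u v *s y) + \<alpha> u v *s y \<in> ?U" using yU by (intro span_add span_scale)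
        then show ?thesis by simp
      qed
    qed
  qed
  then have "(\<Union>b\<in>{b. swap\<^sup>*\<^sup>* a b}. W b) \<subseteq> {y. T t y \<in> ?U}" by blast
  then have "?U \<subseteq> {y. T t y \<in> ?U}"
    by (rule span_minimal) (rule module_hom.subspace_linear_preimage[OF T_lin], simp)
  then show "T t x \<in> ?U" using x by blast
qed simp

lemma separate_weights:
  assumes "std a" "std b" "length a = length b" "length a \<le> d" "a \<noteq> b"
  shows "\<exists>i<length a. \<exists>r s. r \<noteq> s \<and> (\<forall>x\<in>W a. L i x = r *s x) \<and> (\<forall>x\<in>W b. L i x = s *s x)"
  using assms
proof (induction a arbitrary: b)
  case (Cons u a)
  obtain v b' where b: "b = v # b'" using Cons.prems(3) by (cases b) auto
  show ?case
  proof (cases "a = b'")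
    case True
    have "res u \<noteq> res v"
      using res_inj[of a u v] Cons.prems b True by auto
    then show ?thesis using b True by (intro exI[of _ "length a"]) auto
  next
    case False
    then obtain i r s where "i < length a" "r \<noteq> s" "\<forall>x\<in>W a. L i x = r *s x" "\<forall>x\<in>W b'. L i x = s *s x"
      using Cons.IH[of b'] Cons.prems b by auto
    then show ?thesis using b by (intro exI[of _ i]) auto
  qed
qed simp

lemma weights_independent:
  assumes b: "std b" "length b = d" "z \<in> W b" and B: "\<And>a. a \<in> B \<Longrightarrow> std a \<and> length a = d" "b \<notin> B"
    and z: "z \<in> span (\<Union>a\<in>B. W a)"
  shows "z = 0"
proof -
  let ?P = "{(L i, r) | i r. i < d \<and> (\<exists>s. s \<noteq> r \<and> (\<forall>x\<in>W b. L i x = s *s x))}"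
  have "subspace (killed ?P)"
    by (rule subspace_killed[of "L ` {..<d}"]) (auto simp: commuting_ops_def L_lin LL_commute)
  moreover have "(\<Union>a\<in>B. W a) \<subseteq> killed ?P"
  proof
    fix x assume "x \<in> (\<Union>a\<in>B. W a)"
    then obtain a where a: "a \<in> B" "x \<in> W a" by blast
    then have "a \<noteq> b" "std a" "length a = d" using B by auto
    then obtain i r s where "i < d" "r \<noteq> s" "L i x = r *s x" "\<forall>x\<in>W b. L i x = s *s x"
      using separate_weights[of a b] b(1,2) a(2) by auto
    then show "x \<in> killed ?P" by (intro killed_eigenvector[of "L i" r]) auto
  qed
  ultimately have "z \<in> killed ?P" using z span_minimal by blast
  then show ?thesis
    by (rule killed_eq_0) (use b(3) in \<open>auto simp: L_lin\<close>)
qed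

text \<open>
  For two boxes that can be exchanged, the ratio of the residues is not \<open>1\<close>, \<open>q\<^sup>2\<close> or \<open>q\<^sup>-\<^sup>2\<close>, so that the
  intertwiners along a chain of exchanges are injective on weight vectors.
\<close>

lemma return_along_swaps:
  assumes "swap\<^sup>*\<^sup>* a b" "std a" "length a = d" "z \<in> W b" "z \<noteq> 0"
  shows "\<exists>y \<in> cyc d z \<inter> W a. y \<noteq> 0"
  using assms(1,4,5)
proof (induction arbitrary: z rule: rtranclp_induct)
  case base
  then show ?case using cyc_self by blast
next
  case (step b' b)
  have len: "length b' = d" using swap_std[OF step.hyps(1)] assms(2,3) by simp
  obtain p u v e where e: "b' = p @ v # u # e" "b = p @ u # v # e" "std b'" "std b"
    using step.hyps(2) by (elim swap.cases) auto
  have st: "std (v # u # e)" "std (u # v # e)" using e std_append by blast+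
  have le: "Suc (length e) < d" using len e(1) by simp
  have uv: "std e" "addable e u" "addable e v" "u \<noteq> v"
    using st addable_Cons[of e u v] by auto
  have neq: "res u \<noteq> res v" "res u \<noteq> res (up v)" "res u \<noteq> res (dn v)"
    using res_consecutive_neq[OF st(1) le] res_neighbour_neq[OF uv(1) le uv(3,2)] uv(4) by auto
  let ?z = "T (Suc (length e)) z - \<alpha> v u *s z"
  have "?z \<noteq> 0" using intertwiner_nonzero[OF le, of u v z] neq step.prems(2) by simp
  moreover have "?z \<in> W b'"
    using W_append_intertwiner[of z p u v e] step.prems(1) e len neq(1) by simp
  ultimately obtain y where y: "y \<in> cyc d ?z \<inter> W a" "y \<noteq> 0" using step.IH by blast
  have "?z \<in> cyc d z"
    using stabD(2)[OF stab_cyc le cyc_self] stabD(1)[OF stab_cyc] cyc_self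
    by (intro subspace_diff subspace_scale) auto
  then show ?case using y cyc_subset by blast
qed

text \<open>
  A weight \<open>b\<close> of \<open>H\<^sub>d x\<close> is reached from \<open>a\<close> by exchanges.  Going back, \<open>z\<close> generates a nonzero vector of
  weight \<open>a\<close>, which is a multiple of \<open>x\<close>.
\<close>

theorem cyc_simple:
  assumes a: "std a" "length a = d" "x \<in> W a" and b: "std b" "length b = d"
    and z: "z \<in> cyc d x" "z \<in> W b" "z \<noteq> 0"
  shows "x \<in> cyc d z"
proof -
  have "x \<in> span (\<Union>b\<in>{b. swap\<^sup>*\<^sup>* a b}. W b)" using a(3) by (intro span_base) auto
  then have "z \<in> span (\<Union>b\<in>{b. swap\<^sup>*\<^sup>* a b}. W b)"
    using cyc_minimal[OF stab_swap_class[OF a(1,2)]] z(1) by blast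
  then have "swap\<^sup>*\<^sup>* a b"
    using weights_independent[OF b z(2), of "{b. swap\<^sup>*\<^sup>* a b}"] swap_std a z(3) by auto
  then obtain y where y: "y \<in> cyc d z" "y \<in> W a" "y \<noteq> 0"
    using return_along_swaps[OF _ a(1,2) z(2,3)] by blast
  have "y \<in> cyc d x" using y(1) cyc_subset[OF z(1)] by blast
  then have "y \<in> span {x}" by (rule cyc_weight_space[OF a(1,2) order_refl a(3) _ y(2)])
  then obtain c where "y = c *s x" by (auto simp: span_singleton)
  then have "c \<noteq> 0" "x = inverse c *s y" using y(3) by auto
  then show ?thesis using y(1) subspace_scale[OF stabD(1)[OF stab_cyc]] by auto
qed

text \<open>
  The module generated by a weight vector is simple: it lies in \<open>N + C\<close> or meets it in zero, and in
  the second case \<open>C\<close> may be enlarged by it.  Finitely many weight vectors exhaust \<open>V\<close>.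
\<close>

theorem complement:
  assumes V: "stab d V" "V \<subseteq> span F" "finite F" "F \<subseteq> V" and N: "stab d N"
  shows "\<exists>C. stab d C \<and> C \<subseteq> V \<and> N \<inter> C = {0} \<and> (\<forall>x\<in>V. \<exists>u\<in>N. \<exists>c\<in>C. x = u + c)"
proof -
  have "F \<subseteq> span (\<Union>a\<in>{a. std a \<and> length a = d}. V \<inter> W a)"
    using weight_decomposition[OF V(1) order_refl] V(4) by (intro subsetI) auto
  from finite_span_subset[OF V(3) this]
  obtain G where G: "finite G" "G \<subseteq> (\<Union>a\<in>{a. std a \<and> length a = d}. V \<inter> W a)" "F \<subseteq> span G"
    by (elim exE conjE)
  have sN: "subspace N" using stabD(1)[OF N] .
  have "\<exists>C. stab d C \<and> C \<subseteq> V \<and> N \<inter> C = {0} \<and> G \<subseteq> {u + c | u c. u \<in> N \<and> c \<in> C}"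
    using G(1,2)
  proof (induction G rule: finite_induct)
    case empty
    have "stab d {0}" by (rule stabI) (auto simp: T_simps)
    then show ?case using subspace_0[OF sN] subspace_0[OF stabD(1)[OF V(1)]]
      by (intro exI[of _ "{0}"]) auto
  next
    case (insert x G)
    have "\<exists>C. stab d C \<and> C \<subseteq> V \<and> N \<inter> C = {0} \<and> G \<subseteq> {u + c | u c. u \<in> N \<and> c \<in> C}"
      by (rule insert.IH) (use insert.prems in simp)
    then obtain C where C: "stab d C" "C \<subseteq> V" "N \<inter> C = {0}" "G \<subseteq> {u + c | u c. u \<in> N \<and> c \<in> C}"
      by (elim exE conjE)
    let ?S = "{u + c | u c. u \<in> N \<and> c \<in> C}"
    obtain a where a: "std a" "length a = d" "x \<in> W a" "x \<in> V" using insert.prems by blast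
    have sS: "stab d ?S" by (rule stab_sum2[OF N C(1)])
    have sC: "subspace C" using stabD(1)[OF C(1)] .
    show ?case
    proof (cases "x \<in> ?S")
      case True
      then show ?thesis using C by (intro exI[of _ C]) auto
    next
      case False
      have int: "cyc d x \<inter> ?S \<subseteq> {0}"
      proof (rule ccontr)
        assume "\<not> cyc d x \<inter> ?S \<subseteq> {0}"
        then obtain y where "y \<in> cyc d x \<inter> ?S" "y \<noteq> 0" by blast
        then obtain b z where b: "std b" "length b = d" "z \<in> cyc d x \<inter> ?S \<inter> W b" "z \<noteq> 0"
          using weight_vector_exists[OF stab_Int[OF stab_cyc sS] order_refl] by blast
        then have "x \<in> cyc d z" using cyc_simple[OF a(1-3) b(1,2)] by blast
        then show False using cyc_minimal[OF sS] b(3) False by blast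
      qed
      let ?D = "{c + w | c w. c \<in> C \<and> w \<in> cyc d x}"
      have D: "stab d ?D" by (rule stab_sum2[OF C(1) stab_cyc])
      have "cyc d x \<subseteq> V" by (rule cyc_minimal[OF V(1) a(4)])
      then have DV: "?D \<subseteq> V" using C(2) subspace_add[OF stabD(1)[OF V(1)]] by blast
      have CD: "C \<subseteq> ?D" using subspace_0[OF stabD(1)[OF stab_cyc]] by force
      have xD: "x \<in> ?D" using subspace_0[OF sC] cyc_self by force
      have "N \<inter> ?D \<subseteq> {0}"
      proof
        fix y assume "y \<in> N \<inter> ?D"
        then obtain c w where y: "y \<in> N" "y = c + w" "c \<in> C" "w \<in> cyc d x" by blast
        then have "w = y + (- c)" by simp
        then have "w \<in> ?S" using y(1) subspace_neg[OF sC y(3)] by blast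
        then have "w = 0" using int y(4) by blast
        then show "y \<in> {0}" using C(3) y by auto
      qed
      moreover have "0 \<in> N \<inter> ?D" using subspace_0[OF sN] subspace_0[OF stabD(1)[OF D]] by blast
      ultimately have "N \<inter> ?D = {0}" by (intro antisym) (simp_all only: insert_subset empty_subsetI simp_thms)
      moreover have "insert x G \<subseteq> {u + c | u c. u \<in> N \<and> c \<in> ?D}"
      proof -
        have "x = 0 + x" by simp
        then have "x \<in> {u + c | u c. u \<in> N \<and> c \<in> ?D}" using subspace_0[OF sN] xD by blast
        then show ?thesis using C(4) CD by blast
      qed
      ultimately show ?thesis by (intro exI[of _ ?D] conjI D DV)
    qed
  qed
  then obtain C where C: "stab d C" "C \<subseteq> V" "N \<inter> C = {0}" "G \<subseteq> {u + c | u c. u \<in> N \<and> c \<in> C}"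
    by (elim exE conjE)
  have s: "subspace {u + c | u c. u \<in> N \<and> c \<in> C}"
    by (rule stabD(1)[OF stab_sum2[OF N C(1)]])
  have "V \<subseteq> {u + c | u c. u \<in> N \<and> c \<in> C}"
    using span_minimal[OF C(4) s] span_minimal[OF G(3)] V(2) by auto
  then show ?thesis using C by (intro exI[of _ C]) blast
qed

end

section \<open>Endomorphisms of the tensor space\<close>

interpretation vec: linear_operators "scale :: 'k::field \<Rightarrow> ('a \<Rightarrow>\<^sub>0 'k) \<Rightarrow> ('a \<Rightarrow>\<^sub>0 'k)" ..

definition tensor_hom :: "'k::field \<Rightarrow> 'k \<Rightarrow> nat \<Rightarrow> nat \<Rightarrow> nat \<Rightarrow>
    ((int list \<Rightarrow>\<^sub>0 'k) \<Rightarrow> (int list \<Rightarrow>\<^sub>0 'k)) \<Rightarrow> bool" where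
  "tensor_hom Q q n n' d f \<longleftrightarrow>
     (\<forall>x \<in> tensor_space n d. f x \<in> tensor_space n' d) \<and>
     (\<forall>x \<in> tensor_space n d. \<forall>y \<in> tensor_space n d. f (x + y) = f x + f y) \<and>
     (\<forall>c. \<forall>x \<in> tensor_space n d. f (scale c x) = scale c (f x)) \<and>
     (\<forall>t<d. \<forall>x \<in> tensor_space n d. f (gen_act Q q x t) = gen_act Q q (f x) t)"

abbreviation module_endo :: "'k::field \<Rightarrow> 'k \<Rightarrow> nat \<Rightarrow> nat \<Rightarrow>
    ((int list \<Rightarrow>\<^sub>0 'k) \<Rightarrow> (int list \<Rightarrow>\<^sub>0 'k)) \<Rightarrow> bool" where
  "module_endo Q q n d \<equiv> tensor_hom Q q n n d"

lemma module_endoD: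
  assumes "module_endo Q q n d f" "x \<in> tensor_space n d"
  shows "f x \<in> tensor_space n d" "y \<in> tensor_space n d \<Longrightarrow> f (x + y) = f x + f y"
    "f (scale c x) = scale c (f x)" "t < d \<Longrightarrow> f (gen_act Q q x t) = gen_act Q q (f x) t"
  using assms by (auto simp: tensor_hom_def)

lemma subspace_tensor_space: "scale.subspace (tensor_space n d)"
  by (rule scale.subspaceI) (auto intro: tensor_space_zero tensor_space_add tensor_space_scale)

lemma finite_multi_indices: "finite (multi_indices n d)"
proof -
  have "finite (index_set n)" by (simp add: index_set_def Let_def)
  then have "finite {\<mu>. set \<mu> \<subseteq> index_set n \<and> length \<mu> = d}" by (rule finite_lists_length_eq)
  moreover have "multi_indices n d = {\<mu>. set \<mu> \<subseteq> index_set n \<and> length \<mu> = d}"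
    by (auto simp: multi_indices_def)
  ultimately show ?thesis by simp
qed

lemma basis_vec_tensor_space: "\<mu> \<in> multi_indices n d \<Longrightarrow> basis_vec \<mu> \<in> tensor_space n d"
  by (simp add: tensor_space_def basis_vec_def)

lemma span_basis_vec:
  fixes x :: "int list \<Rightarrow>\<^sub>0 'k::field"
  assumes "Poly_Mapping.keys x \<subseteq> A"
  shows "x \<in> scale.span (basis_vec ` A)"
proof -
  have "Poly_Mapping.single \<mu> (Poly_Mapping.lookup x \<mu>) \<in> scale.span (basis_vec ` A)"
    if "\<mu> \<in> Poly_Mapping.keys x" for \<mu>
    using that assms scale.span_scale[OF scale.span_base[of "basis_vec \<mu>" "basis_vec ` A"], of "Poly_Mapping.lookup x \<mu>"]
    by (auto simp: basis_vec_def)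
  then have "(\<Sum>\<mu>\<in>Poly_Mapping.keys x. Poly_Mapping.single \<mu> (Poly_Mapping.lookup x \<mu>)) \<in> scale.span (basis_vec ` A)"
    by (rule scale.span_sum)
  then show ?thesis using poly_mapping_expand[of x] by simp
qed

lemma tensor_space_span: "tensor_space n d \<subseteq> scale.span (basis_vec ` multi_indices n d)"
  using span_basis_vec by (auto simp: tensor_space_def)

lemma hecke_act_representative:
  assumes "q \<noteq> 0" "Q \<noteq> 0" and a: "a \<in> carrier (free_algebra d)"
  shows "\<exists>h \<in> carrier (hecke_B Q q d). \<forall>n. \<forall>x \<in> tensor_space n d. hecke_act Q q x h = free_act Q q x a"
proof -
  let ?R = "free_algebra d :: (word \<Rightarrow>\<^sub>0 'a) ring"
  interpret ideal "hecke_ideal Q q d" ?R by (rule hecke_ideal_ideal)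
  let ?h = "a_r_coset ?R (hecke_ideal Q q d) a"
  have "?h \<in> carrier (hecke_B Q q d)"
    unfolding hecke_B_def FactRing_def using a_rcosetsI[OF a_subset a] by simp
  moreover from this have "hecke_act Q q x ?h = free_act Q q x a" if "x \<in> tensor_space n d" for n x
    using hecke_act_coset[OF assms(1,2) that] a_rcos_self[OF a] by blast
  ultimately show ?thesis by blast
qed

lemma hecke_act_cases:
  assumes "q \<noteq> 0" "Q \<noteq> 0" and h: "h \<in> carrier (hecke_B Q q d)"
  shows "\<exists>a \<in> carrier (free_algebra d). \<forall>n. \<forall>x \<in> tensor_space n d. hecke_act Q q x h = free_act Q q x a"
proof -
  let ?R = "free_algebra d :: (word \<Rightarrow>\<^sub>0 'a) ring"
  interpret ideal "hecke_ideal Q q d" ?R by (rule hecke_ideal_ideal)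
  obtain a where a: "a \<in> carrier ?R" "h = a_r_coset ?R (hecke_ideal Q q d) a"
    using h by (auto simp: hecke_B_def FactRing_def A_RCOSETS_def RCOSETS_def a_r_coset_def)
  have "hecke_act Q q x h = free_act Q q x a" if "x \<in> tensor_space n d" for n x
    using hecke_act_coset[OF assms(1,2) that h] a_rcos_self[OF a(1)] a(2) by blast
  then show ?thesis using a(1) by blast
qed

lemma module_endo_free_act:
  assumes f: "module_endo Q q n d f" and a: "a \<in> carrier (free_algebra d)" and x: "x \<in> tensor_space n d"
  shows "f (free_act Q q x a) = free_act Q q (f x) a"
proof -
  have "free_act Q q x a \<in> tensor_space n d \<and> f (free_act Q q x a) = free_act Q q (f x) a"
  proof (induction a rule: poly_mapping_span_induct)
    case zero
    have "f 0 = 0" using module_endoD(3)[OF f x, of 0] by simp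
    then show ?case by (simp add: free_act_def[of _ _ _ 0] tensor_space_zero)
  next
    case (single w c)
    then have w: "set (letters w) \<subseteq> {..<d}" using a by (auto simp: free_algebra_def)
    have "foldl (gen_act Q q) y ts \<in> tensor_space n d \<and>
      f (foldl (gen_act Q q) y ts) = foldl (gen_act Q q) (f y) ts"
      if "set ts \<subseteq> {..<d}" "y \<in> tensor_space n d" for ts y
      using that by (induction ts arbitrary: y) (auto simp: gen_act_closed module_endoD(4)[OF f])
    from this[OF w x] show ?case
      by (simp add: free_act_single word_act_def module_endoD(3)[OF f] tensor_space_scale)
  next
    case (add y z)
    then show ?case by (simp add: free_act_plus module_endoD(2)[OF f] tensor_space_add)
  qed
  then show ?thesis by blast
qed

lemma schur_B_carrier:
  fixes q Q :: "'k::field"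
  assumes "q \<noteq> 0" "Q \<noteq> 0"
  shows "f \<in> carrier (schur_B Q q n d) \<longleftrightarrow> f \<in> extensional (tensor_space n d) \<and> module_endo Q q n d f"
proof
  assume f: "f \<in> carrier (schur_B Q q n d)"
  then have act: "f (free_act Q q x a) = free_act Q q (f x) a"
    if a: "a \<in> carrier (free_algebra d)" and "x \<in> tensor_space n d" for a x
  proof -
    obtain h where "h \<in> carrier (hecke_B Q q d)"
      "\<forall>n. \<forall>x \<in> tensor_space n d. hecke_act Q q x h = free_act Q q x a"
      using hecke_act_representative[OF assms a] by blast
    moreover have "f x \<in> tensor_space n d" using f that by (auto simp: schur_B_def Let_def)
    ultimately show ?thesis using f that(2) by (auto simp: schur_B_def Let_def)
  qed
  have "(gen t :: word \<Rightarrow>\<^sub>0 'k) \<in> carrier (free_algebra d)" if "t < d" for t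
    using that by (simp add: free_algebra_def gen_def)
  moreover have "scalar c \<in> carrier (free_algebra d)" for c :: 'k
    by (simp add: free_algebra_def scalar_def zero_word_def)
  ultimately have "module_endo Q q n d f"
    using f act[of "gen _"] act[of "scalar _"]
    by (auto simp: tensor_hom_def free_act_gen free_act_scalar schur_B_def Let_def)
  then show "f \<in> extensional (tensor_space n d) \<and> module_endo Q q n d f"
    using f by (auto simp: schur_B_def Let_def PiE_def)
next
  assume f: "f \<in> extensional (tensor_space n d) \<and> module_endo Q q n d f"
  have "f (hecke_act Q q x h) = hecke_act Q q (f x) h"
    if "h \<in> carrier (hecke_B Q q d)" "x \<in> tensor_space n d" for h x
    using hecke_act_cases[OF assms that(1)] module_endo_free_act[of Q q n d f] f that(2) module_endoD(1)[of Q q n d f x]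
    by metis
  then show "f \<in> carrier (schur_B Q q n d)"
    using f by (auto simp: schur_B_def Let_def PiE_def tensor_hom_def)
qed

lemma schur_B_mult:
  "mult (schur_B Q q n d) = compose (tensor_space n d)"
  by (simp add: schur_B_def Let_def)

lemma module_endo_restrict: "module_endo Q q n d (restrict f (tensor_space n d)) \<longleftrightarrow> module_endo Q q n d f"
  unfolding tensor_hom_def
  by (auto simp: tensor_space_add tensor_space_scale gen_act_closed)

lemma regular_schur_B_iff:
  assumes "q \<noteq> 0" "Q \<noteq> 0"
  shows "regular_ring (schur_B Q q n d) \<longleftrightarrow>
    (\<forall>f. module_endo Q q n d f \<longrightarrow>
       (\<exists>g. module_endo Q q n d g \<and> (\<forall>x \<in> tensor_space n d. f (g (f x)) = f x)))"
proof
  assume reg: "regular_ring (schur_B Q q n d)"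
  show "\<forall>f. module_endo Q q n d f \<longrightarrow>
       (\<exists>g. module_endo Q q n d g \<and> (\<forall>x \<in> tensor_space n d. f (g (f x)) = f x))"
  proof (intro allI impI)
    fix f assume f: "module_endo Q q n d f"
    let ?f = "restrict f (tensor_space n d)"
    have "?f \<in> carrier (schur_B Q q n d)" using f by (simp add: schur_B_carrier[OF assms] module_endo_restrict)
    then obtain g where g: "g \<in> carrier (schur_B Q q n d)"
      "?f = compose (tensor_space n d) (compose (tensor_space n d) ?f g) ?f"
      using reg unfolding regular_ring_def schur_B_mult by blast
    then have ge: "module_endo Q q n d g" by (simp add: schur_B_carrier[OF assms])
    have "f (g (f x)) = f x" if x: "x \<in> tensor_space n d" for x
      using fun_cong[OF g(2), of x] x module_endoD(1)[OF f x] module_endoD(1)[OF ge]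
      by (simp add: compose_def)
    then show "\<exists>g. module_endo Q q n d g \<and> (\<forall>x \<in> tensor_space n d. f (g (f x)) = f x)" using ge by blast
  qed
next
  assume reg: "\<forall>f. module_endo Q q n d f \<longrightarrow>
       (\<exists>g. module_endo Q q n d g \<and> (\<forall>x \<in> tensor_space n d. f (g (f x)) = f x))"
  show "regular_ring (schur_B Q q n d)"
    unfolding regular_ring_def schur_B_mult
  proof
    fix f assume "f \<in> carrier (schur_B Q q n d)"
    then have f: "f \<in> extensional (tensor_space n d)" "module_endo Q q n d f"
      by (auto simp: schur_B_carrier[OF assms])
    then obtain g where g: "module_endo Q q n d g" "\<And>x. x \<in> tensor_space n d \<Longrightarrow> f (g (f x)) = f x"
      using reg by blast
    let ?g = "restrict g (tensor_space n d)"
    have "?g \<in> carrier (schur_B Q q n d)" using g by (simp add: schur_B_carrier[OF assms] module_endo_restrict)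
    moreover have "f = compose (tensor_space n d) (compose (tensor_space n d) f ?g) f"
    proof
      fix x show "f x = compose (tensor_space n d) (compose (tensor_space n d) f ?g) f x"
      proof (cases "x \<in> tensor_space n d")
        case True
        then show ?thesis using g(2) module_endoD(1)[OF f(2)] by (simp add: compose_def)
      next
        case False
        then show ?thesis using f(1) by (simp add: compose_def extensional_def)
      qed
    qed
    ultimately show "\<exists>g \<in> carrier (schur_B Q q n d).
      f = compose (tensor_space n d) (compose (tensor_space n d) f g) f" by blast
  qed
qed

text \<open>
  The kernels live in a space of finite dimension, and for regular rings a strictly smaller principal
  left ideal belongs to a strictly larger kernel: if \<open>x\<close> and \<open>y\<close> have the same kernel and \<open>x = x g x\<close>,
  then \<open>v - g x v\<close> is in this kernel for all \<open>v\<close>, whence \<open>y = y g x\<close>.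
\<close>

theorem semisimple_schur_B_iff:
  fixes q Q :: "'k::field"
  assumes "q \<noteq> 0" "Q \<noteq> 0"
  shows "semisimple_ring (schur_B Q q n d) \<longleftrightarrow>
    (\<forall>f. module_endo Q q n d f \<longrightarrow>
       (\<exists>g. module_endo Q q n d g \<and> (\<forall>x \<in> tensor_space n d. f (g (f x)) = f x)))"
proof -
  let ?S = "schur_B Q q n d" and ?V = "tensor_space n d :: (int list \<Rightarrow>\<^sub>0 'k) set"
  interpret ring ?S by (rule schur_B_ring)
  have "semisimple_ring ?S" if reg: "regular_ring ?S"
  proof (rule regular_imp_semisimple[OF reg])
    let ?ker = "\<lambda>f. {v \<in> ?V. f v = 0}" and ?B = "basis_vec ` multi_indices n d :: (int list \<Rightarrow>\<^sub>0 'k) set"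
    fix x y assume x: "x \<in> carrier ?S" and y: "y \<in> carrier ?S" and xy: "principal x \<subset> principal y"
    have ext: "x \<in> extensional ?V" "module_endo Q q n d x" "y \<in> extensional ?V" "module_endo Q q n d y"
      using x y by (auto simp: schur_B_carrier[OF assms])
    have sub: "scale.subspace (?ker f)" if f: "module_endo Q q n d f" for f
    proof (rule scale.subspaceI)
      have "f 0 = 0" using module_endoD(3)[OF f tensor_space_zero, of 0] by simp
      then show "0 \<in> ?ker f" by (simp add: tensor_space_zero)
    qed (use module_endoD[OF f] in \<open>auto simp: tensor_space_add tensor_space_scale\<close>)
    have le: "scale.dim (?ker f) \<le> card ?B" for f
      using scale.dim_le_card[of "?ker f" ?B] tensor_space_span finite_multi_indices by blast
    have "x \<in> principal y" using xy principal_self[OF x] by blast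
    then obtain h where h: "h \<in> carrier ?S" "x = h \<otimes>\<^bsub>?S\<^esub> y"
      by (rule principalE)
    then have hy: "x = compose ?V h y" by (simp add: schur_B_mult)
    have he: "module_endo Q q n d h" using h(1) by (simp add: schur_B_carrier[OF assms])
    have "h 0 = 0" using module_endoD(3)[OF he tensor_space_zero, of 0] by simp
    then have kk: "?ker y \<subseteq> ?ker x" by (auto simp: hy compose_def)
    have "?ker y \<noteq> ?ker x"
    proof
      assume eq: "?ker y = ?ker x"
      obtain g where g: "g \<in> carrier ?S" "x = compose ?V (compose ?V x g) x"
        using reg x unfolding regular_ring_def schur_B_mult by blast
      then have ge: "module_endo Q q n d g" by (simp add: schur_B_carrier[OF assms])
      have "y = compose ?V (compose ?V y g) x"
      proof
        fix v show "y v = compose ?V (compose ?V y g) x v"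
        proof (cases "v \<in> ?V")
          case True
          define w where "w = g (x v)"
          have w: "w \<in> ?V" unfolding w_def using module_endoD(1)[OF ge] module_endoD(1)[OF ext(2) True] by simp
          have dw: "v - w \<in> ?V" using scale.subspace_diff[OF subspace_tensor_space True w] .
          have xw: "x w = x v" unfolding w_def
            using fun_cong[OF g(2), of v] True module_endoD(1)[OF ext(2) True] by (simp add: compose_def)
          have "x ((v - w) + w) = x (v - w) + x w" using module_endoD(2)[OF ext(2) dw w] .
          then have "x (v - w) = 0" using xw by simp
          then have "v - w \<in> ?ker y" using eq dw by blast
          moreover have "y ((v - w) + w) = y (v - w) + y w" using module_endoD(2)[OF ext(4) dw w] .
          ultimately show ?thesis
            using True module_endoD(1)[OF ext(2) True] by (simp add: compose_def w_def)
        next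
          case False
          then show ?thesis using ext(3) by (simp add: compose_def extensional_def)
        qed
      qed
      moreover have "compose ?V y g \<in> carrier ?S"
        using m_closed[OF y g(1)] by (simp add: schur_B_mult)
      ultimately have "y \<in> principal x" by (intro principalI[of "compose ?V y g"]) (simp_all add: schur_B_mult)
      then show False using principal_subset[OF left_ideal_principal[OF x]] xy by blast
    qed
    then have "scale.dim (?ker y) < scale.dim (?ker x)"
      using kk tensor_space_span finite_multi_indices
      by (intro vec.dim_strict_mono[OF sub[OF ext(4)], of _ ?B]) auto
    then show "card ?B - scale.dim (?ker x) < card ?B - scale.dim (?ker y)"
      using le[of x] by simp
  qed
  then show ?thesis
    using semisimple_imp_regular regular_schur_B_iff[OF assms] by blast
qed

definition submodule :: "'k::field \<Rightarrow> 'k \<Rightarrow> nat \<Rightarrow> nat \<Rightarrow> (int list \<Rightarrow>\<^sub>0 'k) set \<Rightarrow> bool" where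
  "submodule Q q n d N \<longleftrightarrow> N \<subseteq> tensor_space n d \<and> scale.subspace N \<and> (\<forall>t<d. \<forall>x\<in>N. gen_act Q q x t \<in> N)"

lemma gen_act_zero: "gen_act Q q 0 t = 0"
  by (simp add: gen_act_def)

lemma submodule_kernel:
  assumes f: "module_endo Q q n d f"
  shows "submodule Q q n d {x \<in> tensor_space n d. f x = 0}"
proof -
  have "f 0 = 0" using module_endoD(3)[OF f tensor_space_zero, of 0] by simp
  then show ?thesis
    unfolding submodule_def
    by (auto intro!: scale.subspaceI tensor_space_zero tensor_space_add tensor_space_scale gen_act_closed
        simp: module_endoD[OF f] gen_act_zero)
qed

lemma submodule_image:
  assumes f: "module_endo Q q n d f"
  shows "submodule Q q n d (f ` tensor_space n d)"
  unfolding submodule_def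
proof (intro conjI allI impI ballI)
  show "f ` tensor_space n d \<subseteq> tensor_space n d" using module_endoD(1)[OF f] by blast
  have f0: "f 0 = 0" using module_endoD(3)[OF f tensor_space_zero, of 0] by simp
  show "scale.subspace (f ` tensor_space n d)"
  proof (rule scale.subspaceI)
    show "0 \<in> f ` tensor_space n d" using f0 tensor_space_zero by (metis image_eqI)
  next
    fix x y assume "x \<in> f ` tensor_space n d" "y \<in> f ` tensor_space n d"
    then obtain u v where "u \<in> tensor_space n d" "x = f u" "v \<in> tensor_space n d" "y = f v" by blast
    then show "x + y \<in> f ` tensor_space n d"
      using module_endoD(2)[OF f, of u v] tensor_space_add[of u n d v] by (metis image_eqI)
  next
    fix c x assume "x \<in> f ` tensor_space n d"
    then obtain u where "u \<in> tensor_space n d" "x = f u" by blast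
    then show "scale c x \<in> f ` tensor_space n d"
      using module_endoD(3)[OF f, of u c] tensor_space_scale[of u n d c] by (metis image_eqI)
  qed
  fix t x assume t: "t < d" and "x \<in> f ` tensor_space n d"
  then obtain u where "u \<in> tensor_space n d" "x = f u" by blast
  then show "gen_act Q q x t \<in> f ` tensor_space n d"
    using module_endoD(4)[OF f, of u t] gen_act_closed[of u n d t Q q] t by (metis image_eqI)
qed

text \<open>
  The complement \<open>C\<close> of the kernel is mapped bijectively onto the image of \<open>f\<close>.  The generalized
  inverse projects along \<open>D\<close> onto the image and takes the preimage in \<open>C\<close>.
\<close>

lemma generalized_inverse:
  fixes q Q :: "'k::field"
  assumes f: "module_endo Q q n d f"
    and C: "submodule Q q n d C" "\<And>x. x \<in> C \<Longrightarrow> f x = 0 \<Longrightarrow> x = 0"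
      "\<And>x. x \<in> tensor_space n d \<Longrightarrow> \<exists>c \<in> C. f x = f c"
    and D: "submodule Q q n d D" "\<And>x. x \<in> tensor_space n d \<Longrightarrow> f x \<in> D \<Longrightarrow> f x = 0"
      "\<And>x. x \<in> tensor_space n d \<Longrightarrow> \<exists>u \<in> tensor_space n d. x - f u \<in> D"
  shows "\<exists>g. module_endo Q q n d g \<and> (\<forall>x \<in> tensor_space n d. f (g (f x)) = f x)"
proof -
  let ?V = "tensor_space n d :: (int list \<Rightarrow>\<^sub>0 'k) set"
  have CV: "C \<subseteq> ?V" and sC: "scale.subspace C" and tC: "\<And>t x. t < d \<Longrightarrow> x \<in> C \<Longrightarrow> gen_act Q q x t \<in> C"
    and sD: "scale.subspace D" and tD: "\<And>t x. t < d \<Longrightarrow> x \<in> D \<Longrightarrow> gen_act Q q x t \<in> D"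
    using C(1) D(1) by (auto simp: submodule_def)
  have ex: "\<exists>c. c \<in> C \<and> x - f c \<in> D" if "x \<in> ?V" for x
    using D(3)[OF that] C(3) by metis
  have diff: "f (x - y) = f x - f y" if x: "x \<in> ?V" and y: "y \<in> ?V" for x y
    using module_endoD(2)[OF f scale.subspace_diff[OF subspace_tensor_space x y] y] by (simp add: algebra_simps)
  have un: "c = c'" if "c \<in> C" "x - f c \<in> D" "c' \<in> C" "x - f c' \<in> D" for c c' x
  proof -
    have V: "c \<in> ?V" "c' \<in> ?V" using that CV by auto
    have "f (c - c') = (x - f c') - (x - f c)" using diff[OF V] by simp
    also have "\<dots> \<in> D" by (rule scale.subspace_diff[OF sD that(4,2)])
    finally have "f (c - c') = 0"
      using D(2)[of "c - c'"] scale.subspace_diff[OF subspace_tensor_space V] by blast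
    then have "c - c' = 0" using C(2) scale.subspace_diff[OF sC that(1,3)] by blast
    then show ?thesis by simp
  qed
  define g where "g x = (SOME c. c \<in> C \<and> x - f c \<in> D)" for x
  have g: "g x \<in> C" "x - f (g x) \<in> D" if "x \<in> ?V" for x
    using someI_ex[OF ex[OF that]] by (auto simp: g_def)
  have geq: "g x = c" if "x \<in> ?V" "c \<in> C" "x - f c \<in> D" for x c
    using un[OF g[OF that(1)] that(2,3)] .
  have "module_endo Q q n d g"
    unfolding tensor_hom_def
  proof (intro conjI allI impI ballI)
    fix x assume x: "x \<in> ?V"
    then show gV: "g x \<in> ?V" using g CV by blast
    show "g (scale c x) = scale c (g x)" for c
    proof (rule geq)
      have "scale c x - f (scale c (g x)) = scale c (x - f (g x))"
        using module_endoD(3)[OF f gV] by (simp add: scale.scale_right_diff_distrib)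
      then show "scale c x - f (scale c (g x)) \<in> D" using scale.subspace_scale[OF sD g(2)[OF x]] by simp
    qed (use x g sC in \<open>auto intro: tensor_space_scale scale.subspace_scale\<close>)
    show "g (gen_act Q q x t) = gen_act Q q (g x) t" if t: "t < d" for t
    proof (rule geq)
      have "gen_act Q q x t - f (gen_act Q q (g x) t) = gen_act Q q (x - f (g x)) t"
        using module_endoD(4)[OF f gV t] by (simp add: gen_act_def lin_ext_diff)
      then show "gen_act Q q x t - f (gen_act Q q (g x) t) \<in> D" using tD[OF t g(2)[OF x]] by simp
    qed (use x g tC t in \<open>auto intro: gen_act_closed\<close>)
    fix y assume y: "y \<in> ?V"
    have gyV: "g y \<in> ?V" using y g CV by blast
    show "g (x + y) = g x + g y"
    proof (rule geq)
      have "x + y - f (g x + g y) = (x - f (g x)) + (y - f (g y))"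
        using module_endoD(2)[OF f gV gyV] by simp
      then show "x + y - f (g x + g y) \<in> D"
        by (simp only: scale.subspace_add[OF sD g(2)[OF x] g(2)[OF y]])
    qed (use x y g sC in \<open>auto intro: tensor_space_add scale.subspace_add\<close>)
  qed
  moreover have "f (g (f x)) = f x" if x: "x \<in> ?V" for x
  proof -
    have fx: "f x \<in> ?V" by (rule module_endoD(1)[OF f x])
    have gV: "g (f x) \<in> ?V" using g(1)[OF fx] CV by blast
    have "f (x - g (f x)) \<in> D" using g(2)[OF fx] diff[OF x gV] by simp
    then have "f (x - g (f x)) = 0"
      using D(2) scale.subspace_diff[OF subspace_tensor_space x gV] by blast
    then show ?thesis using diff[OF x gV] by simp
  qed
  ultimately show ?thesis by blast
qed

text \<open>
  On words of another length the generators act by the trivial character, so that the relations hold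
  on the whole space of words.
\<close>

definition hecke_op :: "'k::field \<Rightarrow> 'k \<Rightarrow> nat \<Rightarrow> nat \<Rightarrow> (int list \<Rightarrow>\<^sub>0 'k) \<Rightarrow> (int list \<Rightarrow>\<^sub>0 'k)" where
  "hecke_op Q q d t =
     lin_ext (\<lambda>\<mu>. if length \<mu> = d then basis_act Q q t \<mu>
                  else scale (inverse (if t = 0 then Q else q)) (basis_vec \<mu>))"

lemma lin_hecke_op: "vec.lin (hecke_op Q q d t)"
  by (rule vec.linI) (simp_all add: hecke_op_def lin_ext_add lin_ext_scale)

definition length_space :: "nat \<Rightarrow> (int list \<Rightarrow>\<^sub>0 'k::field) set" where
  "length_space d = {x. \<forall>\<mu> \<in> Poly_Mapping.keys x. length \<mu> = d}"

lemma hecke_op_gen_act: "x \<in> length_space d \<Longrightarrow> hecke_op Q q d t x = gen_act Q q x t"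
  unfolding hecke_op_def gen_act_def lin_ext_def length_space_def by (intro sum.cong) auto

lemma length_space_zero: "0 \<in> length_space d"
  by (simp add: length_space_def)

lemma length_space_add: "x \<in> length_space d \<Longrightarrow> y \<in> length_space d \<Longrightarrow> x + y \<in> length_space d"
  using Poly_Mapping.keys_add[of x y] by (auto simp: length_space_def)

lemma length_space_scale: "x \<in> length_space d \<Longrightarrow> scale c x \<in> length_space d"
  using keys_scale[of c x] by (auto simp: length_space_def)

lemma length_space_basis_vec: "length \<mu> = d \<Longrightarrow> basis_vec \<mu> \<in> length_space d"
  by (simp add: length_space_def basis_vec_def)

lemma gen_act_length_space:
  assumes "x \<in> length_space d"
  shows "gen_act Q q x t \<in> length_space d"
proof -
  have "length (reflect \<mu> t) = length \<mu>" for \<mu> t by (simp add: reflect_def)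
  then have b: "basis_act Q q t \<mu> \<in> length_space d" if "length \<mu> = d" for \<mu>
    using that by (simp add: basis_act_def length_space_basis_vec length_space_add length_space_scale)
  have sum: "(\<Sum>\<mu>\<in>A. scale (Poly_Mapping.lookup x \<mu>) (basis_act Q q t \<mu>)) \<in> length_space d"
    if "finite A" "\<And>\<mu>. \<mu> \<in> A \<Longrightarrow> length \<mu> = d" for A
    using that by (induction A rule: finite_induct)
      (auto intro!: length_space_add length_space_scale length_space_zero b)
  show ?thesis
    unfolding gen_act_def lin_ext_def
    by (rule sum) (use assms in \<open>auto simp: length_space_def\<close>)
qed

lemma tensor_space_length_space: "tensor_space n d \<subseteq> length_space d"
  by (auto simp: tensor_space_def length_space_def multi_indices_def)

lemma lin_eqI:
  fixes F G :: "(int list \<Rightarrow>\<^sub>0 'k::field) \<Rightarrow> (int list \<Rightarrow>\<^sub>0 'k)"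
  assumes "vec.lin F" "vec.lin G" "\<And>\<mu>. F (basis_vec \<mu>) = G (basis_vec \<mu>)"
  shows "F x = G x"
proof (induction x rule: poly_mapping_span_induct)
  case zero
  show ?case using module_hom.zero[OF assms(1)] module_hom.zero[OF assms(2)] by simp
next
  case (single \<mu> c)
  have "Poly_Mapping.single \<mu> c = scale c (basis_vec \<mu>)" by (simp add: basis_vec_def)
  then show ?case using assms by (simp add: module_hom.scale)
next
  case (add y z)
  then show ?case using assms by (simp add: module_hom.add)
qed

lemma hecke_module_hecke_op:
  fixes q Q :: "'k::field"
  assumes q: "q \<noteq> 0" and Q: "Q \<noteq> 0"
  shows "hecke_module scale (hecke_op Q q d) q Q d"
proof
  let ?T = "hecke_op Q q d"
  note L = lin_hecke_op[of Q q d]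
  have lin2: "vec.lin (\<lambda>x. ?T i (?T j x))" for i j by (rule vec.lin_comp[OF L L])
  have lin3: "vec.lin (\<lambda>x. ?T i (?T j (?T k x)))" for i j k by (rule vec.lin_comp[OF L lin2])
  have lin4: "vec.lin (\<lambda>x. ?T i (?T j (?T k (?T l x))))" for i j k l by (rule vec.lin_comp[OF L lin3])
  have linq: "vec.lin (\<lambda>x. scale c (?T i x) + x)" for c i
    by (rule vec.linI) (simp_all add: module_hom.add[OF L] module_hom.scale[OF L] algebra_simps
        scale.scale_right_distrib scale.scale_left_commute)
  have on: "?T t x = gen_act Q q x t" "gen_act Q q x t \<in> length_space d" if "x \<in> length_space d" for t x
    using hecke_op_gen_act[OF that] gen_act_length_space[OF that] by auto
  have off: "?T t (basis_vec \<mu>) = scale (inverse (if t = 0 then Q else q)) (basis_vec \<mu>)" if "length \<mu> \<noteq> d" for t \<mu>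
    using that by (simp add: hecke_op_def basis_vec_def)
  note Ts = module_hom.scale[OF L]
  note b = length_space_basis_vec
  fix x :: "int list \<Rightarrow>\<^sub>0 'k"
  show "?T 0 (?T 0 x) = scale (inverse Q - Q) (?T 0 x) + x" if "1 \<le> d"
  proof (rule lin_eqI[OF lin2 linq])
    fix \<mu> :: "int list"
    show "?T 0 (?T 0 (basis_vec \<mu>)) = scale (inverse Q - Q) (?T 0 (basis_vec \<mu>)) + basis_vec \<mu>"
    proof (cases "length \<mu> = d")
      case True
      then show ?thesis using quadratic_0[OF Q, of \<mu> q] that by (simp add: on b)
    next
      case False
      then show ?thesis using Q by (simp add: off Ts) (simp add: vec_eq_simps field_simps)
    qed
  qed
  show "?T i (?T i x) = scale (inverse q - q) (?T i x) + x" if "1 \<le> i" "i < d" for i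
  proof (rule lin_eqI[OF lin2 linq])
    fix \<mu> :: "int list"
    show "?T i (?T i (basis_vec \<mu>)) = scale (inverse q - q) (?T i (basis_vec \<mu>)) + basis_vec \<mu>"
    proof (cases "length \<mu> = d")
      case True
      then show ?thesis using quadratic_Suc[OF q, of i \<mu> Q] that by (simp add: on b)
    next
      case False
      then show ?thesis using q that by (simp add: off Ts) (simp add: vec_eq_simps field_simps)
    qed
  qed
  show "?T i (?T (Suc i) (?T i x)) = ?T (Suc i) (?T i (?T (Suc i) x))" if "1 \<le> i" "Suc i < d" for i
  proof (rule lin_eqI[OF lin3 lin3])
    fix \<mu> :: "int list"
    show "?T i (?T (Suc i) (?T i (basis_vec \<mu>))) = ?T (Suc i) (?T i (?T (Suc i) (basis_vec \<mu>)))"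
      using braid_3[OF q, of i \<mu> Q] that by (cases "length \<mu> = d") (simp_all add: on b off Ts)
  qed
  show "?T 0 (?T (Suc 0) (?T 0 (?T (Suc 0) x))) = ?T (Suc 0) (?T 0 (?T (Suc 0) (?T 0 x)))" if "2 \<le> d"
  proof (rule lin_eqI[OF lin4 lin4])
    fix \<mu> :: "int list"
    show "?T 0 (?T (Suc 0) (?T 0 (?T (Suc 0) (basis_vec \<mu>)))) = ?T (Suc 0) (?T 0 (?T (Suc 0) (?T 0 (basis_vec \<mu>))))"
      using braid_4[OF q Q, of \<mu>] that by (cases "length \<mu> = d") (simp_all add: on b off Ts mult_ac)
  qed
  show "?T i (?T j x) = ?T j (?T i x)" if "Suc i < j" "j < d" for i j
  proof (rule lin_eqI[OF lin2 lin2])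
    fix \<mu> :: "int list"
    show "?T i (?T j (basis_vec \<mu>)) = ?T j (?T i (basis_vec \<mu>))"
      using commute_far[of i j \<mu> Q q] that
      by (cases "length \<mu> = d") (simp_all add: on b off Ts scale.scale_left_commute)
  qed
qed (auto simp: q Q module_hom.add[OF lin_hecke_op] module_hom.scale[OF lin_hecke_op])

text \<open>
  Complete reducibility provides complements of the kernel and of the image of \<open>f\<close>.
\<close>

theorem regular_if_separated:
  fixes q Q :: "'k::field"
  assumes "q \<noteq> 0" "Q \<noteq> 0"
    and "\<And>j. 0 < j \<Longrightarrow> j \<le> d \<Longrightarrow> q ^ (2 * j) \<noteq> 1"
    and "\<And>i. \<bar>i\<bar> < int d \<Longrightarrow> Q powi (-2) + q powi (2 * i) \<noteq> 0"
    and f: "module_endo Q q n d f"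
  shows "\<exists>g. module_endo Q q n d g \<and> (\<forall>x \<in> tensor_space n d. f (g (f x)) = f x)"
proof -
  interpret H: separated_hecke_module scale "hecke_op Q q d" q Q d
    using hecke_module_hecke_op[OF assms(1,2)] assms(3,4)
    by (intro separated_hecke_module.intro separated_hecke_module_axioms.intro) auto
  let ?V = "tensor_space n d :: (int list \<Rightarrow>\<^sub>0 'k) set" and ?B = "basis_vec ` multi_indices n d :: (int list \<Rightarrow>\<^sub>0 'k) set"
  have sub: "submodule Q q n d N \<longleftrightarrow> H.stab d N" if "N \<subseteq> ?V" for N
    using that tensor_space_length_space hecke_op_gen_act
    unfolding submodule_def H.stab_def by (metis (no_types, lifting) subsetD)
  have V: "H.stab d ?V"
    using sub[of ?V] gen_act_closed by (auto simp: submodule_def subspace_tensor_space)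
  have compl: "\<exists>C. submodule Q q n d C \<and> N \<inter> C = {0} \<and> (\<forall>x\<in>?V. \<exists>u\<in>N. \<exists>c\<in>C. x = u + c)"
    if N: "submodule Q q n d N" for N
  proof -
    have sN: "H.stab d N" using sub N by (auto simp: submodule_def)
    have B: "finite ?B" "?B \<subseteq> ?V" using finite_multi_indices basis_vec_tensor_space by auto
    from H.complement[OF V tensor_space_span B sN]
    obtain C where C: "H.stab d C" "C \<subseteq> ?V" "N \<inter> C = {0}" "\<forall>x\<in>?V. \<exists>u\<in>N. \<exists>c\<in>C. x = u + c"
      by (elim exE conjE)
    then show ?thesis using sub[OF C(2)] by (intro exI[of _ C]) simp
  qed
  obtain C where C: "submodule Q q n d C" "{x \<in> ?V. f x = 0} \<inter> C = {0}"
    "\<forall>x\<in>?V. \<exists>u\<in>{x \<in> ?V. f x = 0}. \<exists>c\<in>C. x = u + c"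
    using compl[OF submodule_kernel[OF f]] by blast
  obtain D where D: "submodule Q q n d D" "f ` ?V \<inter> D = {0}" "\<forall>x\<in>?V. \<exists>u\<in>f ` ?V. \<exists>c\<in>D. x = u + c"
    using compl[OF submodule_image[OF f]] by blast
  have CV: "C \<subseteq> ?V" using C(1) by (simp add: submodule_def)
  show ?thesis
  proof (rule generalized_inverse[OF f C(1) _ _ D(1)])
    show "x = 0" if "x \<in> C" "f x = 0" for x using that C(2) CV by blast
    show "\<exists>c\<in>C. f x = f c" if x: "x \<in> ?V" for x
    proof -
      obtain u c where "u \<in> ?V" "f u = 0" "c \<in> C" "x = u + c" using C(3) x by blast
      then show ?thesis using module_endoD(2)[OF f, of u c] CV by (intro bexI[of _ c]) auto
    qed
    show "f x = 0" if "x \<in> ?V" "f x \<in> D" for x using that D(2) by blast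
    show "\<exists>u\<in>?V. x - f u \<in> D" if x: "x \<in> ?V" for x
    proof -
      obtain u c where "u \<in> ?V" "c \<in> D" "x = f u + c" using D(3) x by blast
      then show ?thesis by (intro bexI[of _ u]) auto
    qed
  qed
qed

text \<open>
  The tensor space is the direct sum of the image and the kernel of \<open>f\<close>: the image is spanned by
  eigenvectors for nonzero eigenvalues.
\<close>

lemma regular_if_diagonalizable:
  fixes q Q :: "'k::field" and B :: "(int list \<Rightarrow>\<^sub>0 'k) set"
  assumes f: "module_endo Q q n d f" and B: "B \<subseteq> tensor_space n d" "tensor_space n d \<subseteq> scale.span B"
    and eig: "\<And>b. b \<in> B \<Longrightarrow> \<exists>c. f b = scale c b"
  shows "\<exists>g. module_endo Q q n d g \<and> (\<forall>x \<in> tensor_space n d. f (g (f x)) = f x)"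
proof -
  let ?V = "tensor_space n d :: (int list \<Rightarrow>\<^sub>0 'k) set"
  note Vsub = subspace_tensor_space
  have f0: "f 0 = 0" using module_endoD(3)[OF f tensor_space_zero, of 0] by simp
  have diff: "f (x - y) = f x - f y" if x: "x \<in> ?V" and y: "y \<in> ?V" for x y
    using module_endoD(2)[OF f scale.subspace_diff[OF Vsub x y] y] by (simp add: algebra_simps)
  \<comment> \<open>\<open>\<pi>\<close> extends \<open>f\<close> to a linear map on all words, where the facts on annihilated vectors apply.\<close>
  define \<pi> :: "(int list \<Rightarrow>\<^sub>0 'k) \<Rightarrow> _" where
    "\<pi> = lin_ext (\<lambda>\<mu>. if \<mu> \<in> multi_indices n d then basis_vec \<mu> else 0)"
  have \<pi>V: "\<pi> x \<in> ?V" for x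
    unfolding \<pi>_def by (rule tensor_space_lin_ext) (simp add: basis_vec_tensor_space tensor_space_zero)
  have \<pi>_id: "\<pi> x = x" if "x \<in> ?V" for x
  proof -
    have "\<pi> x = (\<Sum>\<mu>\<in>Poly_Mapping.keys x. Poly_Mapping.single \<mu> (Poly_Mapping.lookup x \<mu>))"
      using that unfolding \<pi>_def lin_ext_def tensor_space_def
      by (intro sum.cong) (auto simp: basis_vec_def)
    then show ?thesis using poly_mapping_expand[of x] by simp
  qed
  define F where "F x = f (\<pi> x)" for x
  have lF: "vec.lin F"
  proof (rule vec.linI)
    have "\<pi> (x + y) = \<pi> x + \<pi> y" "\<pi> (scale c x) = scale c (\<pi> x)" for x y c
      by (simp_all add: \<pi>_def lin_ext_add lin_ext_scale)
    then show "F (x + y) = F x + F y" "F (scale c x) = scale c (F x)" for x y c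
      using module_endoD(2)[OF f \<pi>V \<pi>V, of x y] module_endoD(3)[OF f \<pi>V, of c x] by (simp_all add: F_def)
  qed
  have FV: "F x = f x" if "x \<in> ?V" for x using that by (simp add: F_def \<pi>_id)
  have eigF: "\<exists>c. F b = scale c b" if "b \<in> B" for b using eig[OF that] FV that B(1) by auto
  define K where "K = vec.killed {(F, r) | r. r \<noteq> 0}"
  have sK: "scale.subspace K"
    unfolding K_def by (rule vec.subspace_killed[of "{F}"]) (auto simp: vec.commuting_ops_def lF)
  have "?V \<subseteq> {x. F x \<in> K}"
  proof (rule order.trans[OF B(2)], rule scale.span_minimal)
    show "B \<subseteq> {x. F x \<in> K}"
    proof
      fix b assume "b \<in> B"
      then obtain c where c: "F b = scale c b" using eigF by blast
      have "scale c b \<in> K"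
      proof (cases "c = 0")
        case True
        then show ?thesis using scale.subspace_0[OF sK] by simp
      next
        case False
        then have "b \<in> K" unfolding K_def using c by (intro vec.killed_eigenvector[of F c]) auto
        then show ?thesis using sK by (rule scale.subspace_scale[rotated])
      qed
      then show "b \<in> {x. F x \<in> K}" using c by simp
    qed
    show "scale.subspace {x. F x \<in> K}" by (rule module_hom.subspace_linear_preimage[OF lF sK])
  qed
  then have inj: "f x = 0" if "x \<in> ?V" "f (f x) = 0" for x
    using that FV module_endoD(1)[OF f that(1)] unfolding K_def
    by (intro vec.killed_eq_0[of "f x" "{(F, r) | r. r \<noteq> 0}"]) (auto simp: lF intro!: exI[of _ 0])
  let ?S = "{x. \<exists>u \<in> ?V. F (x - F u) = 0}"
  have "?V \<subseteq> ?S"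
  proof (rule order.trans[OF B(2)], rule scale.span_minimal)
    show "B \<subseteq> ?S"
    proof
      fix b assume b: "b \<in> B"
      then obtain c where c: "F b = scale c b" using eigF by blast
      have "F (b - F (scale (inverse c) b)) = 0"
        using c by (cases "c = 0") (simp_all add: module_hom.scale[OF lF] module_hom.diff[OF lF] module_hom.zero[OF lF])
      then show "b \<in> ?S" using tensor_space_scale[of b n d] b B(1) by blast
    qed
    show "scale.subspace ?S"
    proof (rule scale.subspaceI)
      show "0 \<in> ?S" using tensor_space_zero by (auto simp: module_hom.zero[OF lF] intro!: bexI[of _ 0])
    next
      fix x y assume "x \<in> ?S" "y \<in> ?S"
      then obtain u v where "u \<in> ?V" "v \<in> ?V" "F (x - F u) = 0" "F (y - F v) = 0" by blast
      then show "x + y \<in> ?S"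
        by (auto intro!: bexI[of _ "u + v"] tensor_space_add simp: module_hom.add[OF lF] module_hom.diff[OF lF] algebra_simps)
    next
      fix c x assume "x \<in> ?S"
      then obtain u where u: "u \<in> ?V" "F (x - F u) = 0" by blast
      have "F (scale c x - F (scale c u)) = scale c (F (x - F u))"
        by (simp add: module_hom.scale[OF lF] module_hom.diff[OF lF] scale.scale_right_diff_distrib)
      then show "scale c x \<in> ?S" using u tensor_space_scale by (intro CollectI bexI[of _ "scale c u"]) auto
    qed
  qed
  then have split: "\<exists>u\<in>?V. f (x - f u) = 0" if x: "x \<in> ?V" for x
  proof -
    obtain u where u: "u \<in> ?V" "F (x - F u) = 0" using \<open>?V \<subseteq> ?S\<close> x by blast
    moreover have "x - f u \<in> ?V" using scale.subspace_diff[OF Vsub x module_endoD(1)[OF f u(1)]] .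
    ultimately show ?thesis using FV by auto
  qed
  show ?thesis
  proof (rule generalized_inverse[OF f submodule_image[OF f] _ _ submodule_kernel[OF f]])
    show "x = 0" if "x \<in> f ` ?V" "f x = 0" for x using that inj by auto
    show "\<exists>c\<in>f ` ?V. f x = f c" if x: "x \<in> ?V" for x
    proof -
      obtain u where u: "u \<in> ?V" "f (x - f u) = 0" using split[OF x] by blast
      then have "f x = f (f u)" using diff[OF x module_endoD(1)[OF f u(1)]] by simp
      then show ?thesis using u(1) by blast
    qed
    show "f x = 0" if "x \<in> ?V" "f x \<in> {x \<in> ?V. f x = 0}" for x using that inj by auto
    show "\<exists>u\<in>?V. x - f u \<in> {x \<in> ?V. f x = 0}" if x: "x \<in> ?V" for x
    proof -
      obtain u where u: "u \<in> ?V" "f (x - f u) = 0" using split[OF x] by blast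
      then show ?thesis using scale.subspace_diff[OF Vsub x module_endoD(1)[OF f u(1)]] by blast
    qed
  qed
qed

section \<open>One and two letters\<close>

text \<open>
  Words are built from the left: \<open>pre c\<close> is the tensor product of \<open>v\<^sub>c\<close> with its argument, and \<open>mix x\<close>
  that of \<open>v\<^sub>1 + x v\<^sub>-\<^sub>1\<close>.
\<close>

definition pre :: "int \<Rightarrow> (int list \<Rightarrow>\<^sub>0 'k::field) \<Rightarrow> (int list \<Rightarrow>\<^sub>0 'k)" where
  "pre c = lin_ext (\<lambda>\<mu>. basis_vec (c # \<mu>))"

lemma lin_lin_ext: "vec.lin (lin_ext g)" for g :: "int list \<Rightarrow> (int list \<Rightarrow>\<^sub>0 'k::field)"
  by (rule vec.linI) (simp_all add: lin_ext_add lin_ext_scale)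

lemma lin_gen_act: "vec.lin (\<lambda>x. gen_act Q q x t)"
  by (rule vec.linI) (simp_all add: gen_act_add gen_act_scale)

lemma lin_pre: "vec.lin (pre c)"
  unfolding pre_def by (rule lin_lin_ext)

lemmas pre_simps = module_hom.add[OF lin_pre] module_hom.scale[OF lin_pre] module_hom.zero[OF lin_pre]

lemma pre_basis_vec [simp]: "pre c (basis_vec \<mu>) = basis_vec (c # \<mu>)"
  by (simp add: pre_def basis_vec_def)

lemma lin_ext_basis_vec [simp]: "lin_ext g (basis_vec \<mu>) = g \<mu>"
  by (simp add: basis_vec_def)

lemma gen_act_pre:
  assumes "1 \<le> t"
  shows "gen_act Q q (pre c y) (Suc t) = pre c (gen_act Q q y t)"
proof (rule lin_eqI[OF vec.lin_comp[OF lin_gen_act lin_pre] vec.lin_comp[OF lin_pre lin_gen_act]])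
  obtain s where "t = Suc s" using assms by (cases t) auto
  then show "gen_act Q q (pre c (basis_vec \<mu>)) (Suc t) = pre c (gen_act Q q (basis_vec \<mu>) t)" for \<mu>
    by (simp add: gen_act_basis_vec basis_act_def reflect_def pre_simps)
qed

lemma gen_act_pre_0:
  "gen_act Q q (pre a y) 0 =
     (if a > 0 then pre (- a) y
      else if a = 0 then scale (inverse Q) (pre a y)
      else pre (- a) y + scale (inverse Q - Q) (pre a y))"
proof -
  have lr: "vec.lin (\<lambda>y. if a > 0 then pre (- a) y else if a = 0 then scale (inverse Q) (pre a y)
      else pre (- a) y + scale (inverse Q - Q) (pre a y))"
    by (rule vec.linI) (simp_all add: pre_simps scale.scale_right_distrib scale.scale_left_commute)
  show ?thesis
    by (rule lin_eqI[OF vec.lin_comp[OF lin_gen_act lin_pre] lr]) (simp add: gen_act_0_Cons)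
qed

lemma gen_act_pre_1:
  "gen_act Q q (pre a (pre b y)) (Suc 0) =
     (if a < b then pre b (pre a y)
      else if a = b then scale (inverse q) (pre b (pre a y))
      else pre b (pre a y) + scale (inverse q - q) (pre a (pre b y)))"
proof -
  have lr: "vec.lin (\<lambda>y. if a < b then pre b (pre a y) else if a = b then scale (inverse q) (pre b (pre a y))
      else pre b (pre a y) + scale (inverse q - q) (pre a (pre b y)))"
    by (rule vec.linI) (simp_all add: pre_simps scale.scale_right_distrib scale.scale_left_commute)
  show ?thesis
    by (rule lin_eqI[OF vec.lin_comp[OF lin_gen_act vec.lin_comp[OF lin_pre lin_pre]] lr])
       (simp add: gen_act_1)
qed

definition mix :: "'k::field \<Rightarrow> (int list \<Rightarrow>\<^sub>0 'k) \<Rightarrow> (int list \<Rightarrow>\<^sub>0 'k)" where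
  "mix x y = pre 1 y + scale x (pre (-1) y)"

lemma lin_mix: "vec.lin (mix x)"
  by (rule vec.linI) (simp_all add: mix_def pre_simps scale.scale_right_distrib algebra_simps scale.scale_left_commute)

lemmas mix_simps = module_hom.add[OF lin_mix] module_hom.scale[OF lin_mix]

lemma gen_act_mix: "1 \<le> t \<Longrightarrow> gen_act Q q (mix x y) (Suc t) = mix x (gen_act Q q y t)"
  by (simp add: mix_def gen_act_add gen_act_scale gen_act_pre)

lemma gen_act_mix_0:
  assumes "Q \<noteq> 0" "x = inverse Q \<or> x = - Q"
  shows "gen_act Q q (mix x y) 0 = scale x (mix x y)"
proof -
  have x: "1 + x * (inverse Q - Q) = x * x" using assms by (auto simp: field_simps)
  have "gen_act Q q (mix x y) 0 = scale x (pre 1 y) + scale (1 + x * (inverse Q - Q)) (pre (-1) y)"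
    by (simp add: mix_def gen_act_add gen_act_scale gen_act_pre_0 scale.scale_right_distrib scale.scale_left_distrib)
  then show ?thesis unfolding x by (simp add: mix_def scale.scale_right_distrib)
qed

lemma mix_mix:
  "mix x (mix z y) = pre 1 (pre 1 y) + scale z (pre 1 (pre (-1) y)) + scale x (pre (-1) (pre 1 y))
     + scale (x * z) (pre (-1) (pre (-1) y))"
  by (simp add: mix_def pre_simps scale.scale_right_distrib)

lemma gen_act_mix_mix:
  "gen_act Q q (mix x (mix z y)) (Suc 0) =
     scale (inverse q) (pre 1 (pre 1 y)) + scale ((inverse q - q) * z + x) (pre 1 (pre (-1) y))
     + scale z (pre (-1) (pre 1 y)) + scale (inverse q * (x * z)) (pre (-1) (pre (-1) y))"
  by (simp add: mix_mix gen_act_add gen_act_scale gen_act_pre_1 scale.scale_right_distrib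
      scale.scale_left_distrib mult_ac)

lemma gen_act_mix_same:
  assumes "q \<noteq> 0"
  shows "gen_act Q q (mix x (mix (x / q) y)) (Suc 0) = scale (inverse q) (mix x (mix (x / q) y))"
proof -
  have "(inverse q - q) * (x / q) + x = inverse q * (x / q)" "x / q = inverse q * x"
    using assms by (simp_all add: field_simps)
  then show ?thesis
    unfolding gen_act_mix_mix by (simp add: mix_mix scale.scale_right_distrib mult_ac)
qed

text \<open>
  The pure tensors with parameters \<open>x, q z\<close> and \<open>z, q x\<close> span a plane stable under \<open>T\<^sub>1\<close>; this is why
  eigenvectors of the Jucys--Murphy elements can be pure tensors.
\<close>

lemma gen_act_mix_exchange:
  assumes q: "q \<noteq> 0" and ne: "z \<noteq> x"
  defines "a \<equiv> (inverse q - q) * z / (z - x)"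
  shows "gen_act Q q (mix x (mix (q * z) y)) (Suc 0) =
    scale a (mix x (mix (q * z) y)) + scale (inverse q - a) (mix z (mix (q * x) y))"
proof -
  have a: "a * (z - x) = (inverse q - q) * z" using ne by (simp add: a_def)
  have "(inverse q - q) * (q * z) = q * (a * (z - x))" unfolding a by simp
  moreover have "(inverse q - a) * (q * x) = x - a * (q * x)" using q by (simp add: left_diff_distrib)
  ultimately have 1: "(inverse q - q) * (q * z) + x = a * (q * z) + (inverse q - a) * (q * x)"
    by (simp add: algebra_simps)
  have 2: "q * z = a * x + (inverse q - a) * z" using a by (simp add: algebra_simps)
  have 3: "inverse q * (x * (q * z)) = a * (x * (q * z)) + (inverse q - a) * (z * (q * x))"
    by (simp add: algebra_simps)
  have 4: "inverse q = a + (inverse q - a)" by simp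
  have "gen_act Q q (mix x (mix (q * z) y)) (Suc 0) =
    scale (a + (inverse q - a)) (pre 1 (pre 1 y))
    + scale (a * (q * z) + (inverse q - a) * (q * x)) (pre 1 (pre (-1) y))
    + scale (a * x + (inverse q - a) * z) (pre (-1) (pre 1 y))
    + scale (a * (x * (q * z)) + (inverse q - a) * (z * (q * x))) (pre (-1) (pre (-1) y))"
    unfolding gen_act_mix_mix 1 3 using 2 4 by simp
  also have "\<dots> = scale a (mix x (mix (q * z) y)) + scale (inverse q - a) (mix z (mix (q * x) y))"
    unfolding mix_mix
    by (simp only: scale.scale_left_distrib scale.scale_right_distrib scale.scale_scale add_ac)
  finally show ?thesis .
qed

text \<open>
  For two letters the tensor space has a basis of eigenvectors of the Jucys--Murphy elements which
  are pure tensors, indexed by the sequences of signs of the eigenvalues.  The coefficient of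
  \<open>v\<^sub>-\<^sub>1\<close> in a factor depends on the numbers \<open>i\<close> and \<open>j\<close> of positive and negative signs before it.
\<close>

definition ratio :: "'k::field \<Rightarrow> 'k \<Rightarrow> bool \<Rightarrow> nat \<Rightarrow> nat \<Rightarrow> 'k" where
  "ratio Q q s i j = (if s then inverse Q * q powi (int j - int i) else - Q * q powi (int i - int j))"

fun sign_vec :: "'k::field \<Rightarrow> 'k \<Rightarrow> nat \<Rightarrow> nat \<Rightarrow> bool list \<Rightarrow> (int list \<Rightarrow>\<^sub>0 'k)" where
  "sign_vec Q q i j [] = basis_vec []"
| "sign_vec Q q i j (s # \<sigma>) =
     mix (ratio Q q s i j) (sign_vec Q q (if s then Suc i else i) (if s then j else Suc j) \<sigma>)"

lemma ratio_step:
  assumes "q \<noteq> 0"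
  shows "ratio Q q True (Suc i) j = ratio Q q True i j / q" "ratio Q q True i (Suc j) = q * ratio Q q True i j"
    "ratio Q q False (Suc i) j = q * ratio Q q False i j" "ratio Q q False i (Suc j) = ratio Q q False i j / q"
proof -
  have *: "q powi (k + 1) = q * q powi k" "q powi (k - 1) = q powi k / q" for k
    using assms by (simp_all add: power_int_add power_int_diff)
  show "ratio Q q True (Suc i) j = ratio Q q True i j / q"
    using *(2)[of "int j - int i"] by (simp add: ratio_def algebra_simps)
  show "ratio Q q True i (Suc j) = q * ratio Q q True i j"
    using *(1)[of "int j - int i"] by (simp add: ratio_def algebra_simps)
  show "ratio Q q False (Suc i) j = q * ratio Q q False i j"
    using *(1)[of "int i - int j"] by (simp add: ratio_def algebra_simps)
  show "ratio Q q False i (Suc j) = ratio Q q False i j / q"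
    using *(2)[of "int i - int j"] by (simp add: ratio_def algebra_simps)
qed

lemma ratio_neq:
  assumes "q \<noteq> 0" "Q \<noteq> 0" "Q powi (-2) + q powi (2 * (int i - int j)) \<noteq> 0"
  shows "ratio Q q True i j \<noteq> ratio Q q False i j"
proof
  let ?k = "int i - int j"
  assume "ratio Q q True i j = ratio Q q False i j"
  then have eq: "inverse Q * q powi (- ?k) = - Q * q powi ?k" by (simp add: ratio_def)
  have "q powi k * q powi (- k) = 1" for k using assms(1) by (simp add: power_int_minus)
  from this[of ?k] have "q powi ?k * q powi (- ?k) = 1" .
  then have "inverse Q = inverse Q * q powi (- ?k) * q powi ?k" by (simp add: mult_ac)
  also have "\<dots> = - Q * (q powi ?k * q powi ?k)" unfolding eq by simp
  also have "q powi ?k * q powi ?k = q powi (2 * ?k)"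
    unfolding mult_2 by (rule power_int_add[symmetric]) (simp add: assms(1))
  finally have "inverse Q * inverse Q = - Q * q powi (2 * ?k) * inverse Q" by simp
  then have "Q powi (-2) + q powi (2 * ?k) = 0"
    using assms(2) by (simp add: power_int_minus power2_eq_square)
  then show False using assms(3) by blast
qed

lemma sign_vec_same:
  assumes q: "q \<noteq> 0"
  shows "gen_act Q q (sign_vec Q q i j (\<tau> @ s # s # \<rho>)) (Suc (length \<tau>))
    = scale (inverse q) (sign_vec Q q i j (\<tau> @ s # s # \<rho>))"
proof (induction \<tau> arbitrary: i j)
  case Nil
  then show ?case using gen_act_mix_same[OF q] ratio_step[OF q] by (cases s) auto
next
  case (Cons a \<tau>)
  then show ?case by (simp add: gen_act_mix mix_simps)
qed

lemma sign_vec_exchange: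
  assumes q: "q \<noteq> 0" and "s' = (\<not> s)" "i' = i + count_list \<tau> True" "j' = j + count_list \<tau> False"
    and ne: "ratio Q q s' i' j' \<noteq> ratio Q q s i' j'"
    and a: "a = (inverse q - q) * ratio Q q s' i' j' / (ratio Q q s' i' j' - ratio Q q s i' j')"
  shows "gen_act Q q (sign_vec Q q i j (\<tau> @ s # s' # \<rho>)) (Suc (length \<tau>))
    = scale a (sign_vec Q q i j (\<tau> @ s # s' # \<rho>)) + scale (inverse q - a) (sign_vec Q q i j (\<tau> @ s' # s # \<rho>))"
  using assms(3,4)
proof (induction \<tau> arbitrary: i j)
  case Nil
  have "sign_vec Q q i j (s # s' # \<rho>) = mix (ratio Q q s i j) (mix (q * ratio Q q s' i j) (sign_vec Q q (Suc i) (Suc j) \<rho>))"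
    "sign_vec Q q i j (s' # s # \<rho>) = mix (ratio Q q s' i j) (mix (q * ratio Q q s i j) (sign_vec Q q (Suc i) (Suc j) \<rho>))"
    using assms(2) ratio_step[OF q] by (cases s; simp)+
  then show ?case using gen_act_mix_exchange[OF q ne] a Nil by simp
next
  case (Cons b \<tau>)
  show ?case
    using Cons.IH[of "if b then Suc i else i" "if b then j else Suc j"] Cons.prems
    by (cases b) (simp_all add: gen_act_mix mix_simps)
qed

lemma sign_vec_span:
  assumes q: "q \<noteq> 0" and Q: "Q \<noteq> 0"
    and sep: "\<And>i. \<bar>i\<bar> < int d \<Longrightarrow> Q powi (-2) + q powi (2 * i) \<noteq> 0"
    and "\<bar>int i - int j\<bar> + int m \<le> int d" "length \<mu> = m" "set \<mu> \<subseteq> {1, -1}"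
  shows "basis_vec \<mu> \<in> scale.span (sign_vec Q q i j ` {\<sigma>. length \<sigma> = m})"
  using assms(4-6)
proof (induction m arbitrary: i j \<mu>)
  case 0
  then show ?case by (auto intro!: scale.span_base)
next
  case (Suc m)
  obtain c \<nu> where \<mu>: "\<mu> = c # \<nu>" using Suc.prems(2) by (cases \<mu>) auto
  let ?S = "scale.span (sign_vec Q q i j ` {\<sigma>. length \<sigma> = Suc m})"
  have mixS: "mix (ratio Q q s i j) (basis_vec \<nu>) \<in> ?S" for s
  proof -
    let ?i = "if s then Suc i else i" and ?j = "if s then j else Suc j"
    have "basis_vec \<nu> \<in> scale.span (sign_vec Q q ?i ?j ` {\<sigma>. length \<sigma> = m})"
      using Suc.prems \<mu> by (intro Suc.IH) auto
    also have "\<dots> \<subseteq> {y. mix (ratio Q q s i j) y \<in> ?S}"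
    proof (rule scale.span_minimal)
      show "scale.subspace {y. mix (ratio Q q s i j) y \<in> ?S}"
        by (rule module_hom.subspace_linear_preimage[OF lin_mix]) simp
      show "sign_vec Q q ?i ?j ` {\<sigma>. length \<sigma> = m} \<subseteq> {y. mix (ratio Q q s i j) y \<in> ?S}"
      proof (intro subsetI, elim imageE)
        fix y \<sigma> assume "y = sign_vec Q q ?i ?j \<sigma>" "\<sigma> \<in> {\<sigma>. length \<sigma> = m}"
        then have "mix (ratio Q q s i j) y = sign_vec Q q i j (s # \<sigma>)" "s # \<sigma> \<in> {\<sigma>. length \<sigma> = Suc m}"
          by auto
        then show "y \<in> {y. mix (ratio Q q s i j) y \<in> ?S}"
          by (metis (no_types, lifting) image_eqI mem_Collect_eq scale.span_base)
      qed
    qed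
    finally show ?thesis by simp
  qed
  have ne: "ratio Q q True i j \<noteq> ratio Q q False i j"
    using Suc.prems(1) by (intro ratio_neq[OF q Q] sep) auto
  let ?r = "ratio Q q True i j - ratio Q q False i j"
  have "mix (ratio Q q True i j) (basis_vec \<nu>) - mix (ratio Q q False i j) (basis_vec \<nu>)
    = scale ?r (basis_vec ((-1) # \<nu>))"
    by (simp add: mix_def scale.scale_left_diff_distrib)
  then have "scale ?r (basis_vec ((-1) # \<nu>)) \<in> ?S"
    using scale.span_diff[OF mixS[of True] mixS[of False]] by simp
  then have "scale (inverse ?r) (scale ?r (basis_vec ((-1) # \<nu>))) \<in> ?S" by (rule scale.span_scale)
  then have m1: "basis_vec ((-1) # \<nu>) \<in> ?S" using ne by simp
  have "basis_vec (1 # \<nu>) = mix (ratio Q q True i j) (basis_vec \<nu>) - scale (ratio Q q True i j) (basis_vec ((-1) # \<nu>))"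
    by (simp add: mix_def)
  then have "basis_vec (1 # \<nu>) \<in> ?S" using scale.span_diff[OF mixS scale.span_scale[OF m1]] by metis
  then show ?case using m1 Suc.prems(3) \<mu> by auto
qed

definition word_space :: "int set \<Rightarrow> nat \<Rightarrow> (int list \<Rightarrow>\<^sub>0 'k::field) set" where
  "word_space A m = {x. \<forall>\<mu> \<in> Poly_Mapping.keys x. length \<mu> = m \<and> set \<mu> \<subseteq> A}"

lemma tensor_space_eq: "tensor_space n d = word_space (index_set n) d"
  by (auto simp: tensor_space_def word_space_def multi_indices_def)

lemma word_space_basis_vec: "length \<mu> = m \<Longrightarrow> set \<mu> \<subseteq> A \<Longrightarrow> basis_vec \<mu> \<in> word_space A m"
  by (simp add: word_space_def basis_vec_def)

lemma word_space_add: "x \<in> word_space A m \<Longrightarrow> y \<in> word_space A m \<Longrightarrow> x + y \<in> word_space A m"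
  using Poly_Mapping.keys_add[of x y] by (fastforce simp: word_space_def)

lemma word_space_scale: "x \<in> word_space A m \<Longrightarrow> scale c x \<in> word_space A m"
  using keys_scale[of c x] by (fastforce simp: word_space_def)

lemma word_space_zero: "0 \<in> word_space A m"
  by (simp add: word_space_def)

lemma word_space_lin_ext:
  assumes "x \<in> word_space A m" "\<And>\<mu>. length \<mu> = m \<Longrightarrow> set \<mu> \<subseteq> A \<Longrightarrow> g \<mu> \<in> word_space B k"
  shows "lin_ext g x \<in> word_space B k"
proof -
  have sum: "(\<Sum>\<mu>\<in>F. scale (Poly_Mapping.lookup x \<mu>) (g \<mu>)) \<in> word_space B k"
    if "finite F" "\<And>\<mu>. \<mu> \<in> F \<Longrightarrow> length \<mu> = m \<and> set \<mu> \<subseteq> A" for F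
    using that by (induction F rule: finite_induct)
      (auto intro!: word_space_add word_space_scale word_space_zero assms(2))
  show ?thesis unfolding lin_ext_def by (rule sum) (use assms(1) in \<open>auto simp: word_space_def\<close>)
qed

lemma word_space_pre: "x \<in> word_space A m \<Longrightarrow> c \<in> A \<Longrightarrow> pre c x \<in> word_space A (Suc m)"
  unfolding pre_def by (rule word_space_lin_ext) (auto intro!: word_space_basis_vec)

lemma word_space_mix: "x \<in> word_space A m \<Longrightarrow> {1, -1} \<subseteq> A \<Longrightarrow> mix r x \<in> word_space A (Suc m)"
  unfolding mix_def by (intro word_space_add word_space_scale word_space_pre) auto

lemma sign_vec_word_space: "sign_vec Q q i j \<sigma> \<in> word_space {1, -1} (length \<sigma>)"
  by (induction \<sigma> arbitrary: i j) (auto intro: word_space_basis_vec word_space_mix)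

lemma index_set_1: "index_set 1 = {0}" and index_set_2: "index_set 2 = {1, -1}"
  and index_set_3: "index_set 3 = {-1, 0, 1}"
  by (auto simp: index_set_def Let_def)

text \<open>
  The eigenvalues of the Jucys--Murphy elements tell the vectors \<open>sign_vec\<close> apart, so that every
  endomorphism acts diagonally on them.
\<close>

lemma sign_vec_endo:
  fixes q Q :: "'k::field"
  assumes q: "q \<noteq> 0" and Q: "Q \<noteq> 0"
    and sep: "\<And>i. \<bar>i\<bar> < int d \<Longrightarrow> Q powi (-2) + q powi (2 * i) \<noteq> 0"
    and f: "module_endo Q q 2 d f" and \<sigma>: "length \<sigma> = d"
  shows "\<exists>c. f (sign_vec Q q 0 0 \<sigma>) = scale c (sign_vec Q q 0 0 \<sigma>)"
proof -
  interpret H: hecke_module scale "hecke_op Q q d" q Q d by (rule hecke_module_hecke_op[OF q Q])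
  let ?V = "tensor_space 2 d :: (int list \<Rightarrow>\<^sub>0 'k) set"
  define b where "b \<sigma> = sign_vec Q q 0 0 \<sigma>" for \<sigma>
  define lam where "lam \<sigma> k = H.res (\<sigma> ! k, int (count_list (take k \<sigma>) (\<sigma> ! k)))" for \<sigma> k
  have bV: "b \<sigma> \<in> ?V" if "length \<sigma> = d" for \<sigma>
    using sign_vec_word_space[of Q q 0 0 \<sigma>] that unfolding b_def tensor_space_eq index_set_2 by simp
  have T: "hecke_op Q q d t x = gen_act Q q x t" if "x \<in> ?V" for t x
    using hecke_op_gen_act tensor_space_length_space that by blast
  have ratio_res: "ratio Q q s i j = H.res (s, int (if s then i else j)) * q powi (int (i + j))" for s i j
  proof -
    have "q powi (int j - int i) = q powi (-2 * int i + int (i + j))" by simp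
    moreover have "q powi (int i - int j) = q powi (-2 * int j + int (i + j))" by simp
    ultimately show ?thesis
      using q by (simp only: ratio_def H.res_def power_int_add simp_thms) (simp add: mult_ac)
  qed
  have res_ne: "H.res (True, int i) \<noteq> H.res (False, int j)" if "i + j < d" for i j
  proof -
    have "ratio Q q True i j \<noteq> ratio Q q False i j"
      using that by (intro ratio_neq[OF q Q] sep) auto
    then show ?thesis unfolding ratio_res by auto
  qed
  have L: "H.L k (b \<sigma>) = scale (lam \<sigma> k) (b \<sigma>)" if "length \<sigma> = d" "k < d" for \<sigma> k
    using that
  proof (induction k arbitrary: \<sigma>)
    case 0
    then obtain s \<rho> where s: "\<sigma> = s # \<rho>" by (cases \<sigma>) auto
    have "ratio Q q s 0 0 = lam \<sigma> 0" using s unfolding ratio_res lam_def by simp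
    moreover have "ratio Q q s 0 0 = inverse Q \<or> ratio Q q s 0 0 = - Q" by (simp add: ratio_def)
    ultimately show ?case
      using gen_act_mix_0[OF Q, of "ratio Q q s 0 0" q] T[OF bV[OF 0(1)]] s by (simp add: b_def)
  next
    case (Suc k)
    define \<tau> where "\<tau> = take k \<sigma>"
    define \<rho> where "\<rho> = drop (Suc (Suc k)) \<sigma>"
    define s where "s = \<sigma> ! k"
    define s' where "s' = \<sigma> ! Suc k"
    have \<sigma>_eq: "\<sigma> = \<tau> @ s # s' # \<rho>"
      using Suc.prems id_take_nth_drop[of k \<sigma>] Cons_nth_drop_Suc[of "Suc k" \<sigma>]
      by (simp add: \<tau>_def \<rho>_def s_def s'_def)
    have len: "length \<tau> = k" using Suc.prems by (simp add: \<tau>_def)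
    let ?b = "b \<sigma>" and ?T = "hecke_op Q q d (Suc k)"
    have IH: "H.L k ?b = scale (lam \<sigma> k) ?b" using Suc by simp
    have lamk: "lam \<sigma> k = H.res (s, int (count_list \<tau> s))"
      by (simp add: lam_def s_def \<tau>_def)
    have lamS: "lam \<sigma> (Suc k) = H.res (s', int (count_list (\<tau> @ [s]) s'))"
      using Suc.prems unfolding lam_def s'_def \<tau>_def s_def by (simp add: take_Suc_conv_app_nth)
    show ?case
    proof (cases "s' = s")
      case True
      have "?T ?b = scale (inverse q) ?b"
        using sign_vec_same[OF q, of Q 0 0 \<tau> s \<rho>] T[OF bV[OF Suc.prems(1)]] \<sigma>_eq True len by (simp add: b_def)
      then have "H.L (Suc k) ?b = scale (inverse q * lam \<sigma> k * inverse q) ?b"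
        using IH by (simp add: H.T_simps H.L_simps mult_ac)
      also have "inverse q * lam \<sigma> k * inverse q = lam \<sigma> (Suc k)"
      proof -
        have "lam \<sigma> (Suc k) = H.res (up (s, int (count_list \<tau> s)))"
          unfolding lamS True up_def by (simp add: add.commute)
        then show ?thesis unfolding lamk H.res_up by (simp add: power2_eq_square mult_ac)
      qed
      finally show ?thesis .
    next
      case False
      define i' where "i' = count_list \<tau> True"
      define j' where "j' = count_list \<tau> False"
      have cnt: "i' + j' = k"
      proof -
        have "count_list \<tau> True + count_list \<tau> False = length \<tau>" by (induction \<tau>) auto
        then show ?thesis using len by (simp add: i'_def j'_def)
      qed
      define \<sigma>' where "\<sigma>' = \<tau> @ s' # s # \<rho>"
      have \<sigma>'d: "length \<sigma>' = d" using Suc.prems(1) \<sigma>_eq by (simp add: \<sigma>'_def)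
      have s': "s' = (\<not> s)" using False by auto
      have l: "lam \<sigma> k = H.res (s, int (if s then i' else j'))" "lam \<sigma> (Suc k) = H.res (s', int (if s' then i' else j'))"
        "lam \<sigma>' k = lam \<sigma> (Suc k)"
        unfolding lamk lamS using s' len by (cases s; simp add: i'_def j'_def lam_def \<sigma>'_def nth_append)+
      have lne: "lam \<sigma> (Suc k) \<noteq> lam \<sigma> k"
        using res_ne[of i' j'] cnt Suc.prems(2) s' unfolding l by (cases s) auto
      define p where "p = q powi (int (i' + j'))"
      have p0: "p \<noteq> 0" using q by (simp add: p_def)
      have r: "ratio Q q s i' j' = lam \<sigma> k * p" "ratio Q q s' i' j' = lam \<sigma> (Suc k) * p"
        unfolding ratio_res l p_def by simp_all
      define a where "a = H.\<kappa> * lam \<sigma> (Suc k) / (lam \<sigma> (Suc k) - lam \<sigma> k)"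
      have a: "a * (lam \<sigma> (Suc k) - lam \<sigma> k) = H.\<kappa> * lam \<sigma> (Suc k)" using lne by (simp add: a_def)
      have "a = H.\<kappa> * ratio Q q s' i' j' / (ratio Q q s' i' j' - ratio Q q s i' j')"
        unfolding r a_def using p0 by (simp flip: left_diff_distrib)
      moreover have "ratio Q q s' i' j' \<noteq> ratio Q q s i' j'" unfolding r using lne p0 by simp
      ultimately have Tb: "?T ?b = scale a ?b + scale (inverse q - a) (b \<sigma>')"
        using sign_vec_exchange[OF q s', of i' 0 \<tau> j' 0 Q a \<rho>] T[OF bV[OF Suc.prems(1)]] \<sigma>_eq len
        by (simp add: b_def \<sigma>'_def i'_def j'_def)
      have IH': "H.L k (b \<sigma>') = scale (lam \<sigma> (Suc k)) (b \<sigma>')" using Suc.IH[OF \<sigma>'d] Suc.prems(2) l(3) by simp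
      \<comment> \<open>In \<open>T L\<^sub>k T b\<close> the two contributions to \<open>T b\<close> cancel by the choice of \<open>a\<close>.\<close>
      define c where "c = scale (inverse q - a) (b \<sigma>')"
      have Tb': "?T ?b = scale a ?b + c" using Tb by (simp add: c_def)
      have "?T (?T ?b) = scale a (?T ?b) + ?T c" by (subst Tb') (simp add: H.T_simps)
      moreover have "?T (?T ?b) = scale H.\<kappa> (?T ?b) + ?b"
        using H.quad[of "Suc k" ?b] Suc.prems(2) by simp
      ultimately have Tc: "?T c = scale (H.\<kappa> - a) (?T ?b) + ?b"
        by (simp add: scale.scale_left_diff_distrib algebra_simps)
      have "H.L k (?T ?b) = scale (a * lam \<sigma> k) ?b + scale (lam \<sigma> (Suc k)) c"
        unfolding Tb' using IH IH' by (simp add: H.L_simps c_def mult_ac)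
      then have "H.L (Suc k) ?b = scale (a * lam \<sigma> k) (?T ?b) + scale (lam \<sigma> (Suc k)) (?T c)"
        by (simp add: H.T_simps)
      also have "\<dots> = scale (a * lam \<sigma> k + lam \<sigma> (Suc k) * (H.\<kappa> - a)) (?T ?b) + scale (lam \<sigma> (Suc k)) ?b"
        unfolding Tc by (simp add: scale.scale_right_distrib scale.scale_left_distrib)
      also have "a * lam \<sigma> k + lam \<sigma> (Suc k) * (H.\<kappa> - a) = 0" using a by (simp add: algebra_simps)
      finally show ?thesis by simp
    qed
  qed
  have LV: "H.L k x \<in> ?V" if "x \<in> ?V" "k < d" for k x
    using that by (induction k arbitrary: x) (auto simp: T gen_act_closed)
  have Lf: "f (H.L k x) = H.L k (f x)" if "x \<in> ?V" "k < d" for k x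
    using that
  proof (induction k arbitrary: x)
    case 0
    then show ?case using module_endoD(1,4)[OF f] by (simp add: T)
  next
    case (Suc k)
    then have Tx: "gen_act Q q x (Suc k) \<in> ?V" by (simp add: gen_act_closed)
    have "gen_act Q q (f x) (Suc k) \<in> ?V"
      using Suc.prems module_endoD(1)[OF f] by (simp add: gen_act_closed)
    then have "H.L k (gen_act Q q x (Suc k)) \<in> ?V" "H.L k (gen_act Q q (f x) (Suc k)) \<in> ?V"
      using LV Tx Suc.prems by simp_all
    then show ?case
      using Suc Tx module_endoD(1,4)[OF f] by (simp add: T)
  qed
  define P where "P = {(H.L k, r) | k r. k < d \<and> r \<noteq> lam \<sigma> k}"
  have sP: "scale.subspace (vec.killed P)"
    unfolding P_def by (rule vec.subspace_killed[of "H.L ` {..<d}"])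
      (auto simp: vec.commuting_ops_def H.L_lin H.LL_commute)
  let ?S = "{x + e | x e. x \<in> scale.span {b \<sigma>} \<and> e \<in> vec.killed P}"
  have sS: "scale.subspace ?S" by (rule vec.subspace_sum2[OF _ sP]) simp
  have "b ` {\<sigma>. length \<sigma> = d} \<subseteq> ?S"
  proof (intro subsetI, elim imageE)
    fix x \<sigma>' assume x: "x = b \<sigma>'" and "\<sigma>' \<in> {\<sigma>. length \<sigma> = d}"
    then have \<sigma>': "length \<sigma>' = d" by simp
    show "x \<in> ?S"
    proof (cases "\<sigma>' = \<sigma>")
      case True
      have "x = x + 0" "x \<in> scale.span {b \<sigma>}" using x True by (auto intro: scale.span_base)
      then show ?thesis using scale.subspace_0[OF sP] by blast
    next
      case False
      obtain \<pi> u xs v ys where uv: "u \<noteq> v" "\<sigma>' = \<pi> @ [u] @ xs" "\<sigma> = \<pi> @ [v] @ ys"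
        using same_length_different[OF False] \<sigma> \<sigma>' by auto
      have len: "length \<pi> < d" using uv \<sigma>' by simp
      have "count_list \<pi> True + count_list \<pi> False = length \<pi>" by (induction \<pi>) auto
      then have "lam \<sigma>' (length \<pi>) \<noteq> lam \<sigma> (length \<pi>)"
        using res_ne[of "count_list \<pi> True" "count_list \<pi> False"] uv len
        by (cases u; cases v) (auto simp: lam_def)
      then have "x \<in> vec.killed P"
        using L[OF \<sigma>' len] x len unfolding P_def by (intro vec.killed_eigenvector[of "H.L (length \<pi>)" "lam \<sigma>' (length \<pi>)"]) auto
      moreover have "x = 0 + x" "0 \<in> scale.span {b \<sigma>}" by (auto intro: scale.span_zero)
      ultimately show ?thesis by blast
    qed
  qed
  then have "scale.span (b ` {\<sigma>. length \<sigma> = d}) \<subseteq> ?S" using sS by (rule scale.span_minimal)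
  moreover have "?V \<subseteq> scale.span (b ` {\<sigma>. length \<sigma> = d})"
  proof (rule order.trans[OF tensor_space_span scale.span_minimal])
    show "basis_vec ` multi_indices 2 d \<subseteq> scale.span (b ` {\<sigma>. length \<sigma> = d})"
      using sign_vec_span[OF q Q sep, where i = 0 and j = 0 and m = d] unfolding b_def
      by (auto simp: multi_indices_def index_set_2)
  qed simp
  ultimately have "f (b \<sigma>) \<in> ?S" using module_endoD(1)[OF f bV[OF \<sigma>]] by blast
  then obtain c e where ce: "f (b \<sigma>) = scale c (b \<sigma>) + e" "e \<in> vec.killed P"
    by (auto simp: scale.span_singleton)
  have "H.L k e = scale (lam \<sigma> k) e" if k: "k < d" for k
  proof -
    have "H.L k (f (b \<sigma>)) = scale (lam \<sigma> k) (f (b \<sigma>))"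
      using Lf[OF bV[OF \<sigma>] k] L[OF \<sigma> k] module_endoD(3)[OF f bV[OF \<sigma>]] by simp
    then show ?thesis
      unfolding ce(1) by (simp add: H.L_simps L[OF \<sigma> k] scale.scale_right_distrib mult.commute)
  qed
  then have "e = 0"
    using ce(2) by (elim vec.killed_eq_0) (auto simp: P_def H.L_lin)
  then show ?thesis using ce(1) by (auto simp: b_def)
qed

theorem regular_two_letters:
  fixes q Q :: "'k::field"
  assumes q: "q \<noteq> 0" and Q: "Q \<noteq> 0"
    and sep: "\<And>i. \<bar>i\<bar> < int d \<Longrightarrow> Q powi (-2) + q powi (2 * i) \<noteq> 0"
    and f: "module_endo Q q 2 d f"
  shows "\<exists>g. module_endo Q q 2 d g \<and> (\<forall>x \<in> tensor_space 2 d. f (g (f x)) = f x)"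
proof (rule regular_if_diagonalizable[OF f])
  let ?B = "sign_vec Q q 0 0 ` {\<sigma>. length \<sigma> = d}"
  show "?B \<subseteq> tensor_space 2 d"
    using sign_vec_word_space[of Q q 0 0] unfolding tensor_space_eq index_set_2 by auto
  show "tensor_space 2 d \<subseteq> scale.span ?B"
  proof (rule order.trans[OF tensor_space_span scale.span_minimal])
    show "basis_vec ` multi_indices 2 d \<subseteq> scale.span ?B"
      using sign_vec_span[OF q Q sep, where i = 0 and j = 0 and m = d] by (auto simp: multi_indices_def index_set_2)
  qed simp
  show "\<exists>c. f b = scale c b" if "b \<in> ?B" for b
    using sign_vec_endo[OF q Q sep f] that by blast
qed

theorem regular_one_letter:
  fixes q Q :: "'k::field"
  assumes f: "module_endo Q q 1 d f"
  shows "\<exists>g. module_endo Q q 1 d g \<and> (\<forall>x \<in> tensor_space 1 d. f (g (f x)) = f x)"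
proof (rule regular_if_diagonalizable[OF f])
  let ?b = "basis_vec (replicate d 0) :: int list \<Rightarrow>\<^sub>0 'k"
  have m: "multi_indices 1 d = {replicate d 0}"
    unfolding multi_indices_def index_set_1 by (auto simp: replicate_length_same)
      (metis replicate_length_same singletonD subsetD)
  show b: "{?b} \<subseteq> tensor_space 1 d" using basis_vec_tensor_space m by auto
  show s: "tensor_space 1 d \<subseteq> scale.span {?b}" using tensor_space_span[of 1 d] unfolding m by simp
  show "\<exists>c. f b = scale c b" if "b \<in> {?b}" for b
    using that module_endoD(1)[OF f, of ?b] b s by (auto simp: scale.span_singleton)
qed

section \<open>Three letters\<close>

lemma lookup_basis_vec: "Poly_Mapping.lookup (basis_vec \<mu>) \<nu> = (if \<mu> = \<nu> then 1 else 0)"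
  by (simp add: basis_vec_def lookup_single when_def)

lemma lookup_lin_ext:
  assumes "x \<in> length_space d" "\<And>\<mu>. length \<mu> = d \<Longrightarrow> Poly_Mapping.lookup (g \<mu>) \<nu> = c * Poly_Mapping.lookup (basis_vec \<mu>) \<nu>'"
  shows "Poly_Mapping.lookup (lin_ext g x) \<nu> = c * Poly_Mapping.lookup x \<nu>'"
proof -
  have "Poly_Mapping.lookup (lin_ext g x) \<nu>
    = (\<Sum>\<mu>\<in>Poly_Mapping.keys x. Poly_Mapping.lookup x \<mu> * (c * (if \<mu> = \<nu>' then 1 else 0)))"
    unfolding lin_ext_def lookup_sum lookup_scale
    using assms by (intro sum.cong) (auto simp: length_space_def lookup_basis_vec)
  also have "\<dots> = (\<Sum>\<mu>\<in>Poly_Mapping.keys x. if \<mu> = \<nu>' then c * Poly_Mapping.lookup x \<mu> else 0)"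
    by (intro sum.cong) auto
  also have "\<dots> = c * Poly_Mapping.lookup x \<nu>'"
    by (simp add: sum.delta' in_keys_iff)
  finally show ?thesis .
qed

text \<open>Coefficients of \<open>x T\<^sub>t\<close> at words on which the coefficient depends on a single one of \<open>x\<close>.\<close>

lemma lookup_gen_act_Suc:
  assumes "x \<in> length_space d" "length (xs @ a # b # ys) = d" "a \<le> b"
  shows "Poly_Mapping.lookup (gen_act Q q x (Suc (length xs))) (xs @ a # b # ys)
    = (if a = b then inverse q else 1) * Poly_Mapping.lookup x (xs @ b # a # ys)"
  unfolding gen_act_def
proof (rule lookup_lin_ext[OF assms(1)])
  fix \<mu> :: "int list" assume "length \<mu> = d"
  then obtain us c e zs where \<mu>: "\<mu> = us @ c # e # zs" "length us = length xs"
    using split_at2[of "length xs" \<mu> thesis] assms(2) by auto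
  have "basis_act Q q (Suc (length xs)) \<mu> = gen_act Q q (basis_vec \<mu>) (Suc (length xs))"
    by (simp add: gen_act_basis_vec)
  then show "Poly_Mapping.lookup (basis_act Q q (Suc (length xs)) \<mu>) (xs @ a # b # ys) =
      (if a = b then inverse q else 1) * Poly_Mapping.lookup (basis_vec \<mu>) (xs @ b # a # ys)"
    using \<mu> assms(3) by (auto simp: gen_act_Suc_append lookup_basis_vec lookup_add)
qed

lemma lookup_gen_act_0:
  assumes "x \<in> length_space d" "length (a # ys) = d" "a \<ge> 0"
  shows "Poly_Mapping.lookup (gen_act Q q x 0) (a # ys)
    = (if a = 0 then inverse Q else 1) * Poly_Mapping.lookup x ((- a) # ys)"
  unfolding gen_act_def
proof (rule lookup_lin_ext[OF assms(1)])
  fix \<mu> :: "int list" assume "length \<mu> = d"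
  then obtain c zs where \<mu>: "\<mu> = c # zs" using assms(2) by (cases \<mu>) auto
  have "basis_act Q q 0 \<mu> = gen_act Q q (basis_vec \<mu>) 0"
    by (simp add: gen_act_basis_vec)
  then show "Poly_Mapping.lookup (basis_act Q q 0 \<mu>) (a # ys) =
      (if a = 0 then inverse Q else 1) * Poly_Mapping.lookup (basis_vec \<mu>) (- a # ys)"
    using \<mu> assms(3) by (auto simp: gen_act_0_Cons lookup_basis_vec lookup_add)
qed

text \<open>
  A vector on which the first \<open>b\<close> positions carry the character \<open>T\<^sub>0 \<mapsto> -Q\<close>, \<open>T\<^sub>i \<mapsto> q\<^sup>-\<^sup>1\<close> has no
  letter \<open>0\<close> at these positions, and its coefficients at words with letters \<open>1\<close> and \<open>-1\<close> there are
  determined by those at words with only \<open>1\<close>.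
\<close>

lemma minus_character_vanishing:
  fixes q Q :: "'k::field"
  assumes q: "q \<noteq> 0" and Q: "Q \<noteq> 0" and QQ: "inverse Q \<noteq> - Q"
    and x: "x \<in> length_space d" and b: "b \<le> d"
    and x0: "1 \<le> b \<Longrightarrow> gen_act Q q x 0 = scale (- Q) x"
    and xi: "\<And>i. 1 \<le> i \<Longrightarrow> i < b \<Longrightarrow> gen_act Q q x i = scale (inverse q) x"
    and p: "length p = b" "length (p @ s) = d" "set p \<subseteq> {-1, 0, 1}"
    and zero: "0 \<in> set p \<or> Poly_Mapping.lookup x (replicate b 1 @ s) = 0"
  shows "Poly_Mapping.lookup x (p @ s) = 0"
proof -
  define N where "N = {p. length p = b \<longrightarrow> Poly_Mapping.lookup x (p @ s) = 0}"
  have swap: "u @ a # c # v \<in> N \<longleftrightarrow> u @ c # a # v \<in> N" for u v a c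
  proof -
    have *: "u @ a # c # v \<in> N \<longleftrightarrow> u @ c # a # v \<in> N" if "a < c" for a c
    proof (cases "length (u @ a # c # v) = b")
      case True
      then have "gen_act Q q x (Suc (length u)) = scale (inverse q) x" by (intro xi) auto
      moreover have "length ((u @ a # c # v) @ s) = d" using True p by simp
      ultimately have "inverse q * Poly_Mapping.lookup x ((u @ a # c # v) @ s) = Poly_Mapping.lookup x ((u @ c # a # v) @ s)"
        using lookup_gen_act_Suc[OF x, of u a c "v @ s" Q q] that by simp
      then show ?thesis using q True unfolding N_def by auto
    qed (simp add: N_def)
    show ?thesis using *[of a c] *[of c a] by (cases a c rule: linorder_cases) auto
  qed
  have front: "u @ a # v \<in> N \<longleftrightarrow> a # u @ v \<in> N" for u v a
  proof (induction u arbitrary: v rule: rev_induct)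
    case (snoc c u)
    then show ?case using swap[of u c a v] snoc[of "c # v"] by simp
  qed simp
  have flip: "1 # v \<in> N \<Longrightarrow> (-1) # v \<in> N" "0 # v \<in> N" for v
  proof -
    have "length (a # v @ s) = d" "gen_act Q q x 0 = scale (- Q) x" if "length (a # v) = b" for a
      using that p x0 by auto
    note * = this
    show "1 # v \<in> N \<Longrightarrow> (-1) # v \<in> N"
      using lookup_gen_act_0[OF x, of 1 "v @ s" Q q] *[of 1] by (auto simp: N_def)
    have "inverse Q * c \<noteq> - Q * c" if "c \<noteq> 0" for c using that QQ by (metis mult_right_cancel)
    then show "0 # v \<in> N"
      using lookup_gen_act_0[OF x, of 0 "v @ s" Q q] *[of 0] by (fastforce simp: N_def)
  qed
  have "p \<in> N"
  proof (cases "0 \<in> set p")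
    case True
    then obtain u v where "p = u @ 0 # v" by (meson split_list)
    then show ?thesis using front flip(2) by simp
  next
    case False
    then have "Poly_Mapping.lookup x (replicate b 1 @ s) = 0" using zero by blast
    then have base: "replicate (length p) 1 \<in> N" for p :: "int list" by (auto simp: N_def)
    have "set p \<subseteq> {-1, 1}" using False p(3) by auto
    then show ?thesis
    proof (induction "count_list p (-1)" arbitrary: p)
      case 0
      then have "set p \<subseteq> {1}" by (auto simp: count_list_0_iff)
      then have "p = replicate (length p) 1" by (metis replicate_length_same singletonD subsetD)
      then show ?case using base[of p] by simp
    next
      case (Suc k)
      then have "-1 \<in> set p" by (metis count_notin nat.simps(3))
      then obtain u v where uv: "p = u @ (-1) # v" by (meson split_list)
      then have "1 # u @ v \<in> N" using Suc.hyps(1)[of "1 # u @ v"] Suc by auto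
      then show ?case using flip(1) front uv by blast
    qed
  qed
  then show ?thesis using p(1) by (simp add: N_def)
qed

text \<open>The pure tensor spanning this character on words of letters \<open>1\<close> and \<open>-1\<close>, followed by \<open>y\<close>.\<close>

fun minus_vec :: "'k::field \<Rightarrow> 'k \<Rightarrow> nat \<Rightarrow> nat \<Rightarrow> (int list \<Rightarrow>\<^sub>0 'k) \<Rightarrow> (int list \<Rightarrow>\<^sub>0 'k)" where
  "minus_vec Q q j 0 y = y"
| "minus_vec Q q j (Suc b) y = mix (- Q / q ^ j) (minus_vec Q q (Suc j) b y)"

lemma lin_minus_vec: "vec.lin (minus_vec Q q j b)"
proof (induction b arbitrary: j)
  case 0
  show ?case by (rule vec.linI) simp_all
next
  case (Suc b)
  have "minus_vec Q q j (Suc b) = (\<lambda>y. mix (- Q / q ^ j) (minus_vec Q q (Suc j) b y))" by (rule ext) simp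
  then show ?case using vec.lin_comp[OF lin_mix Suc] by simp
qed

lemma minus_vec_0: "Q \<noteq> 0 \<Longrightarrow> 1 \<le> b \<Longrightarrow> gen_act Q q (minus_vec Q q 0 b y) 0 = scale (- Q) (minus_vec Q q 0 b y)"
  using gen_act_mix_0[of Q "- Q" q] by (cases b) auto

lemma minus_vec_inside:
  assumes "q \<noteq> 0" "1 \<le> i" "i < b"
  shows "gen_act Q q (minus_vec Q q j b y) i = scale (inverse q) (minus_vec Q q j b y)"
  using assms(2,3)
proof (induction b arbitrary: i j)
  case (Suc b)
  obtain c where b: "b = Suc c" using Suc.prems by (cases b) auto
  show ?case
  proof (cases "i = 1")
    case True
    have "- Q / q ^ Suc j = - Q / q ^ j / q" by simp
    then show ?thesis using gen_act_mix_same[OF assms(1), of Q "- Q / q ^ j"] b True by (simp add: mult.commute)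
  next
    case False
    then obtain i' where i: "i = Suc i'" "1 \<le> i'" using Suc.prems by (cases i) auto
    then show ?thesis using Suc.IH[of i' "Suc j"] Suc.prems by (simp add: gen_act_mix mix_simps)
  qed
qed simp

lemma minus_vec_behind: "1 \<le> i \<Longrightarrow> gen_act Q q (minus_vec Q q j b y) (b + i) = minus_vec Q q j b (gen_act Q q y i)"
  by (induction b arbitrary: j) (simp_all add: gen_act_mix)

lemma lookup_pre: "Poly_Mapping.lookup (pre c y) (a # \<nu>) = (if a = c then Poly_Mapping.lookup y \<nu> else 0)"
proof (induction y rule: poly_mapping_span_induct)
  case zero
  show ?case by (simp add: pre_simps)
next
  case (single \<mu> r)
  have "Poly_Mapping.single \<mu> r = scale r (basis_vec \<mu>)" by (simp add: basis_vec_def)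
  then show ?case by (simp add: pre_simps lookup_basis_vec)
next
  case (add y z)
  then show ?case by (simp add: pre_simps lookup_add)
qed

lemma lookup_minus_vec: "Poly_Mapping.lookup (minus_vec Q q j b y) (replicate b 1 @ \<nu>) = Poly_Mapping.lookup y \<nu>"
  by (induction b arbitrary: j) (simp_all add: mix_def lookup_add lookup_pre lookup_minus)

lemma word_space_minus_vec:
  "y \<in> word_space A m \<Longrightarrow> {1, -1} \<subseteq> A \<Longrightarrow> minus_vec Q q j b y \<in> word_space A (b + m)"
  by (induction b arbitrary: j) (simp_all add: word_space_mix)

text \<open>
  Replacing one letter \<open>0\<close> by \<open>e\<close>, in all possible ways, with weights: \<open>w c\<close> for every letter \<open>c\<close> to
  the left and \<open>q\<^sup>-\<^sup>1\<close> for every letter \<open>0\<close> or \<open>-1\<close> to the right.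
\<close>

definition right_weight :: "'k::field \<Rightarrow> int list \<Rightarrow> 'k" where
  "right_weight q \<mu> = inverse q ^ (count_list \<mu> 0 + count_list \<mu> (-1))"

fun replace_zero :: "'k::field \<Rightarrow> int \<Rightarrow> (int \<Rightarrow> 'k) \<Rightarrow> int list \<Rightarrow> (int list \<Rightarrow>\<^sub>0 'k)" where
  "replace_zero q e w [] = 0"
| "replace_zero q e w (c # \<mu>) =
     (if c = 0 then scale (right_weight q \<mu>) (basis_vec (e # \<mu>)) else 0)
     + scale (w c) (pre c (replace_zero q e w \<mu>))"

definition weight_op :: "'k::field \<Rightarrow> (int list \<Rightarrow>\<^sub>0 'k) \<Rightarrow> (int list \<Rightarrow>\<^sub>0 'k)" where
  "weight_op q = lin_ext (\<lambda>\<mu>. scale (right_weight q \<mu>) (basis_vec \<mu>))"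

lemma lin_weight_op: "vec.lin (weight_op q)"
  unfolding weight_op_def by (rule lin_lin_ext)

lemma weight_op_basis_vec: "weight_op q (basis_vec \<mu>) = scale (right_weight q \<mu>) (basis_vec \<mu>)"
  by (simp add: weight_op_def)

lemma right_weight_Cons: "right_weight q (c # \<mu>) = (if c = 0 \<or> c = -1 then inverse q else 1) * right_weight q \<mu>"
  by (simp add: right_weight_def)

lemma weight_op_pre:
  "weight_op q (pre c y) = scale (if c = 0 \<or> c = -1 then inverse q else 1) (pre c (weight_op q y))"
proof -
  have "vec.lin (\<lambda>y. scale (if c = 0 \<or> c = -1 then inverse q else 1) (pre c (weight_op q y)))"
    by (rule vec.linI)
       (simp_all add: module_hom.add[OF lin_weight_op] module_hom.scale[OF lin_weight_op] pre_simps
         scale.scale_right_distrib scale.scale_left_commute)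
  from lin_eqI[OF vec.lin_comp[OF lin_weight_op lin_pre] this]
  show ?thesis by (simp add: weight_op_basis_vec right_weight_Cons pre_simps)
qed

lemma replace_zero_pre:
  "lin_ext (replace_zero q e w) (pre c y) =
     (if c = 0 then pre e (weight_op q y) else 0)
     + scale (w c) (pre c (lin_ext (replace_zero q e w) y))"
proof -
  have "vec.lin (\<lambda>y. (if c = 0 then pre e (weight_op q y) else 0) + scale (w c) (pre c (lin_ext (replace_zero q e w) y)))"
    by (rule vec.linI)
       (simp_all add: lin_ext_add lin_ext_scale module_hom.add[OF lin_weight_op] module_hom.scale[OF lin_weight_op]
         pre_simps scale.scale_right_distrib scale.scale_left_commute)
  from lin_eqI[OF vec.lin_comp[OF lin_lin_ext lin_pre] this]
  show ?thesis by (simp add: weight_op_basis_vec pre_simps)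
qed

lemma right_weight_gen_act:
  assumes "1 \<le> t" "t < length \<mu>"
  shows "weight_op q (gen_act Q q (basis_vec \<mu>) t)
    = scale (right_weight q \<mu>) (gen_act Q q (basis_vec \<mu>) t)"
proof -
  obtain xs a b ys where \<mu>: "\<mu> = xs @ a # b # ys" "length xs = t - 1"
    using split_at2[of "t - 1" \<mu> thesis] assms by simp
  have "right_weight q (xs @ b # a # ys) = right_weight q \<mu>"
    unfolding \<mu> right_weight_def by (simp add: count_list_append)
  then show ?thesis using \<mu> assms(1)
    by (simp add: gen_act_Suc_append weight_op_basis_vec module_hom.add[OF lin_weight_op]
        module_hom.scale[OF lin_weight_op] scale.scale_right_distrib mult_ac)
qed

lemma replace_zero_commute:
  assumes base: "\<And>a b ys. {a, b} \<subseteq> {-1, 0, 1} \<Longrightarrow> lin_ext (replace_zero q e w) (gen_act Q q (basis_vec (a # b # ys)) 1)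
      = gen_act Q q (replace_zero q e w (a # b # ys)) 1"
    and "1 \<le> t" "t < length \<mu>" "set \<mu> \<subseteq> {-1, 0, 1}"
  shows "lin_ext (replace_zero q e w) (gen_act Q q (basis_vec \<mu>) t) = gen_act Q q (replace_zero q e w \<mu>) t"
  using assms(2-)
proof (induction \<mu> arbitrary: t)
  case (Cons c \<mu>)
  show ?case
  proof (cases "t = 1")
    case True
    then obtain b ys where "\<mu> = b # ys" using Cons.prems by (cases \<mu>) auto
    then show ?thesis using base[of c b ys] True Cons.prems by simp
  next
    case False
    then obtain t' where t: "t = Suc t'" "1 \<le> t'" "t' < length \<mu>" using Cons.prems by (cases t) auto
    have IH: "lin_ext (replace_zero q e w) (gen_act Q q (basis_vec \<mu>) t') = gen_act Q q (replace_zero q e w \<mu>) t'"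
      using Cons t by simp
    have "gen_act Q q (basis_vec (c # \<mu>)) t = pre c (gen_act Q q (basis_vec \<mu>) t')"
      using gen_act_pre[OF t(2), of Q q c "basis_vec \<mu>"] t(1) by simp
    moreover have "gen_act Q q (basis_vec (e # \<mu>)) t = pre e (gen_act Q q (basis_vec \<mu>) t')"
      using gen_act_pre[OF t(2), of Q q e "basis_vec \<mu>"] t(1) by simp
    ultimately show ?thesis
      using right_weight_gen_act[OF t(2,3), of q Q] gen_act_pre[OF t(2), of Q q c]
      by (simp add: replace_zero_pre IH gen_act_add gen_act_scale t(1) pre_simps gen_act_zero)
  qed
qed simp

abbreviation plus_weight :: "'k::field \<Rightarrow> int \<Rightarrow> 'k" where
  "plus_weight q c \<equiv> (if c = 0 then 1 else inverse q)"

abbreviation minus_weight :: "'k::field \<Rightarrow> int \<Rightarrow> 'k" where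
  "minus_weight q c \<equiv> (if c = 0 then inverse q * inverse q else 1)"

text \<open>
  Either sum of replacements commutes with \<open>T\<^sub>i\<close> for \<open>i \<ge> 1\<close>.  Their combination replaces a letter \<open>0\<close> by
  \<open>v\<^sub>1 + Q\<^sup>-\<^sup>1 v\<^sub>-\<^sub>1\<close> at the first position, and this vector is multiplied by \<open>Q\<^sup>-\<^sup>1\<close> under \<open>T\<^sub>0\<close> just like \<open>v\<^sub>0\<close>; so it
  commutes with \<open>T\<^sub>0\<close> as well.
\<close>

definition raise_op :: "'k::field \<Rightarrow> 'k \<Rightarrow> int list \<Rightarrow> (int list \<Rightarrow>\<^sub>0 'k)" where
  "raise_op Q q \<mu> = replace_zero q 1 (plus_weight q) \<mu> + scale (inverse Q) (replace_zero q (-1) (minus_weight q) \<mu>)"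

lemma raise_op_base:
  fixes q Q :: "'k::field"
  assumes "q \<noteq> 0" "{a, b} \<subseteq> {-1, 0, 1 :: int}"
  shows "lin_ext (replace_zero q 1 (plus_weight q)) (gen_act Q q (basis_vec (a # b # ys)) 1)
      = gen_act Q q (replace_zero q 1 (plus_weight q) (a # b # ys)) 1"
    "lin_ext (replace_zero q (-1) (minus_weight q)) (gen_act Q q (basis_vec (a # b # ys)) 1)
      = gen_act Q q (replace_zero q (-1) (minus_weight q) (a # b # ys)) 1"
proof -
  define Y :: "int list \<Rightarrow>\<^sub>0 'k" where "Y = basis_vec ys"
  define r where "r = right_weight q ys"
  define EA where "EA = lin_ext (replace_zero q 1 (plus_weight q))"
  define EB where "EB = lin_ext (replace_zero q (-1) (minus_weight q))"
  have ab: "a = -1 \<or> a = 0 \<or> a = 1" "b = -1 \<or> b = 0 \<or> b = 1" using assms(2) by auto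
  have Y: "basis_vec (a # b # ys) = pre a (pre b Y)" "weight_op q Y = scale r Y"
    by (simp_all add: Y_def r_def weight_op_basis_vec)
  have E: "EA (pre c y) = (if c = 0 then pre 1 (weight_op q y) else 0) + scale (plus_weight q c) (pre c (EA y))"
    "EB (pre c y) = (if c = 0 then pre (-1) (weight_op q y) else 0) + scale (minus_weight q c) (pre c (EB y))" for c y
    unfolding EA_def EB_def by (rule replace_zero_pre)+
  have Elin: "EA (x + y) = EA x + EA y" "EA (scale c x) = scale c (EA x)"
    "EB (x + y) = EB x + EB y" "EB (scale c x) = scale c (EB x)" for x y c
    by (simp_all add: EA_def EB_def lin_ext_add lin_ext_scale)
  have "EA (gen_act Q q (pre a (pre b Y)) (Suc 0)) = gen_act Q q (EA (pre a (pre b Y))) (Suc 0)"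
    using ab assms(1)
    by (elim disjE; simp add: E Elin Y(2) weight_op_pre gen_act_add gen_act_scale gen_act_pre_1 gen_act_zero pre_simps;
        simp add: vec_eq_simps field_simps)
  moreover have "EB (gen_act Q q (pre a (pre b Y)) (Suc 0)) = gen_act Q q (EB (pre a (pre b Y))) (Suc 0)"
    using ab assms(1)
    by (elim disjE; simp add: E Elin Y(2) weight_op_pre gen_act_add gen_act_scale gen_act_pre_1 gen_act_zero pre_simps;
        simp add: vec_eq_simps field_simps)
  moreover have "EA (pre a (pre b Y)) = replace_zero q 1 (plus_weight q) (a # b # ys)"
    "EB (pre a (pre b Y)) = replace_zero q (-1) (minus_weight q) (a # b # ys)"
    unfolding Y(1)[symmetric] EA_def EB_def by (rule lin_ext_basis_vec)+
  ultimately show "lin_ext (replace_zero q 1 (plus_weight q)) (gen_act Q q (basis_vec (a # b # ys)) 1)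
      = gen_act Q q (replace_zero q 1 (plus_weight q) (a # b # ys)) 1"
    "lin_ext (replace_zero q (-1) (minus_weight q)) (gen_act Q q (basis_vec (a # b # ys)) 1)
      = gen_act Q q (replace_zero q (-1) (minus_weight q) (a # b # ys)) 1"
    unfolding Y(1) EA_def EB_def by simp_all
qed

lemma count_list_replicate: "count_list (replicate m a) b = (if a = b then m else 0)"
  by (induction m) auto

lemma raise_op_lin_ext:
  "lin_ext (raise_op Q q) y = lin_ext (replace_zero q 1 (plus_weight q)) y
     + scale (inverse Q) (lin_ext (replace_zero q (-1) (minus_weight q)) y)"
proof -
  have "vec.lin (\<lambda>y. lin_ext (replace_zero q 1 (plus_weight q)) y
     + scale (inverse Q) (lin_ext (replace_zero q (-1) (minus_weight q)) y))"
    by (rule vec.linI) (simp_all add: lin_ext_add lin_ext_scale scale.scale_right_distrib mult_ac)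
  from lin_eqI[OF lin_lin_ext this] show ?thesis by (simp add: raise_op_def)
qed

lemma raise_op_commute:
  fixes q Q :: "'k::field"
  assumes q: "q \<noteq> 0" and Q: "Q \<noteq> 0" and t: "t < length \<mu>" and \<mu>: "set \<mu> \<subseteq> {-1, 0, 1}"
  shows "lin_ext (raise_op Q q) (gen_act Q q (basis_vec \<mu>) t) = gen_act Q q (raise_op Q q \<mu>) t"
proof (cases t)
  case (Suc s)
  then have "1 \<le> t" by simp
  note c = replace_zero_commute[OF _ this t \<mu>]
  show ?thesis
    unfolding raise_op_lin_ext
    using c[OF raise_op_base(1)[OF q]] c[OF raise_op_base(2)[OF q]]
    by (simp add: raise_op_def gen_act_add gen_act_scale)
next
  case 0
  obtain c \<nu> where c: "\<mu> = c # \<nu>" using t by (cases \<mu>) auto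
  then have "c = -1 \<or> c = 0 \<or> c = 1" using \<mu> by auto
  define Y :: "int list \<Rightarrow>\<^sub>0 'k" where "Y = basis_vec \<nu>"
  define E where "E = lin_ext (raise_op Q q)"
  define F where "F c = lin_ext (\<lambda>\<mu>. scale (plus_weight q c) (replace_zero q 1 (plus_weight q) \<mu>)
    + scale (inverse Q * minus_weight q c) (replace_zero q (-1) (minus_weight q) \<mu>)) Y" for c
  have E: "E (pre c Y) = (if c = 0 then mix (inverse Q) (weight_op q Y) else 0) + pre c (F c)" for c
    unfolding E_def raise_op_lin_ext replace_zero_pre F_def Y_def
    by (simp add: mix_def scale.scale_right_distrib pre_simps)
  have F: "F (-1) = F 1" by (simp add: F_def)
  have Elin: "E (x + y) = E x + E y" "E (scale a x) = scale a (E x)" for x y a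
    by (simp_all add: E_def lin_ext_add lin_ext_scale)
  have "E (gen_act Q q (pre c Y) 0) = gen_act Q q (E (pre c Y)) 0"
    using \<open>c = -1 \<or> c = 0 \<or> c = 1\<close>
  proof (elim disjE)
    assume "c = 0"
    then show ?thesis
      using gen_act_mix_0[OF Q, of "inverse Q" q "weight_op q Y"]
      by (simp add: gen_act_pre_0 Elin E gen_act_add scale.scale_right_distrib)
  qed (simp_all add: gen_act_pre_0 Elin E F)
  moreover have "E (pre c Y) = raise_op Q q \<mu>" "pre c Y = basis_vec \<mu>"
    unfolding E_def Y_def c by (simp_all only: pre_basis_vec lin_ext_basis_vec)
  ultimately show ?thesis using 0 by (simp add: E_def)
qed

text \<open>
  The generators preserve the number of letters \<open>0\<close>, which allows to cut \<open>raise_op\<close> down to the words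
  with \<open>l\<close> of them.
\<close>

definition raise_zeros :: "'k::field \<Rightarrow> 'k \<Rightarrow> nat \<Rightarrow> (int list \<Rightarrow>\<^sub>0 'k) \<Rightarrow> (int list \<Rightarrow>\<^sub>0 'k)" where
  "raise_zeros Q q l = lin_ext (\<lambda>\<mu>. if count_list \<mu> 0 = l then raise_op Q q \<mu> else 0)"

lemma tensor_hom_comp:
  assumes "tensor_hom Q q n n' d f" "tensor_hom Q q n' n'' d g"
  shows "tensor_hom Q q n n'' d (\<lambda>x. g (f x))"
  using assms unfolding tensor_hom_def by simp

lemma tensor_hom_lin_ext:
  assumes g: "\<And>\<mu>. \<mu> \<in> multi_indices n d \<Longrightarrow> g \<mu> \<in> tensor_space n' d"
    and c: "\<And>\<mu> t. \<mu> \<in> multi_indices n d \<Longrightarrow> t < d \<Longrightarrow>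
      lin_ext g (gen_act Q q (basis_vec \<mu>) t) = gen_act Q q (g \<mu>) t"
  shows "tensor_hom Q q n n' d (lin_ext g)"
proof -
  have "lin_ext g (gen_act Q q x t) = gen_act Q q (lin_ext g x) t" if x: "x \<in> tensor_space n d" and t: "t < d" for x t
  proof -
    have "scale.subspace {x. lin_ext g (gen_act Q q x t) = gen_act Q q (lin_ext g x) t}"
      by (rule scale.subspaceI) (simp_all add: gen_act_zero gen_act_add gen_act_scale lin_ext_add lin_ext_scale)
    then have "scale.span (basis_vec ` multi_indices n d) \<subseteq> {x. lin_ext g (gen_act Q q x t) = gen_act Q q (lin_ext g x) t}"
      using c[OF _ t] by (intro scale.span_minimal) auto
    then show ?thesis using x tensor_space_span by blast
  qed
  moreover have "lin_ext g x \<in> tensor_space n' d" if "x \<in> tensor_space n d" for x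
    using that g unfolding tensor_space_eq
    by (elim word_space_lin_ext) (auto simp: multi_indices_def tensor_space_eq)
  ultimately show ?thesis by (simp add: tensor_hom_def lin_ext_add lin_ext_scale)
qed

lemma word_space_replace_zero:
  "set \<mu> \<subseteq> {-1, 0, 1} \<Longrightarrow> e \<in> {-1, 1} \<Longrightarrow> replace_zero q e w \<mu> \<in> word_space {-1, 0, 1} (length \<mu>)"
proof (induction \<mu>)
  case (Cons c \<mu>)
  then have "basis_vec (e # \<mu>) \<in> word_space {-1, 0, 1} (length (c # \<mu>))"
    by (intro word_space_basis_vec) auto
  moreover have "pre c (replace_zero q e w \<mu>) \<in> word_space {-1, 0, 1} (length (c # \<mu>))"
    using Cons by (auto intro!: word_space_pre)
  ultimately show ?case by (auto intro!: word_space_add word_space_scale word_space_zero)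
qed (simp add: word_space_zero)

lemma raise_op_tensor_space: "set \<mu> \<subseteq> {-1, 0, 1} \<Longrightarrow> raise_op Q q \<mu> \<in> tensor_space 3 (length \<mu>)"
  unfolding raise_op_def tensor_space_eq index_set_3
  by (intro word_space_add word_space_scale word_space_replace_zero) auto

lemma multi_indices_3: "\<mu> \<in> multi_indices 3 d \<longleftrightarrow> length \<mu> = d \<and> set \<mu> \<subseteq> {-1, 0, 1}"
  by (simp add: multi_indices_def index_set_3)

lemma gen_act_cases:
  assumes "t < length \<mu>"
  obtains (zero) a ys where "t = 0" "\<mu> = a # ys"
  | (Suc) xs a b ys where "t = Suc (length xs)" "\<mu> = xs @ a # b # ys"
proof (cases t)
  case 0
  then show ?thesis using assms zero by (cases \<mu>) auto
next
  case (Suc s)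
  then obtain xs a b ys where "\<mu> = xs @ a # b # ys" "length xs = s"
    using split_at2[of s \<mu> thesis] assms by simp
  then show ?thesis using Suc by (intro that(2)[of xs a b ys]) auto
qed

lemma raise_zeros_hom:
  fixes q Q :: "'k::field"
  assumes q: "q \<noteq> 0" and Q: "Q \<noteq> 0"
  shows "tensor_hom Q q 3 3 d (raise_zeros Q q l)"
  unfolding raise_zeros_def
proof (rule tensor_hom_lin_ext)
  let ?g = "\<lambda>\<mu>. if count_list \<mu> 0 = l then raise_op Q q \<mu> else 0"
  fix \<mu> assume \<mu>: "\<mu> \<in> multi_indices 3 d"
  then show "?g \<mu> \<in> tensor_space 3 d"
    using raise_op_tensor_space[of \<mu> Q q] by (auto simp: multi_indices_3 tensor_space_zero)
  fix t assume t: "t < d"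
  have m: "length \<mu> = d" "set \<mu> \<subseteq> {-1, 0, 1}" using \<mu> by (auto simp: multi_indices_3)
  have "lin_ext ?g (gen_act Q q (basis_vec \<mu>) t)
    = (if count_list \<mu> 0 = l then lin_ext (raise_op Q q) (gen_act Q q (basis_vec \<mu>) t) else 0)"
  proof -
    have "t < length \<mu>" using t m(1) by simp
    then show ?thesis
      by (cases rule: gen_act_cases)
         (auto simp: gen_act_0_Cons gen_act_Suc_append lin_ext_add lin_ext_scale count_list_append)
  qed
  also have "\<dots> = gen_act Q q (?g \<mu>) t"
    using raise_op_commute[OF q Q, of t \<mu>] m t by (simp add: gen_act_zero)
  finally show "lin_ext ?g (gen_act Q q (basis_vec \<mu>) t) = gen_act Q q (?g \<mu>) t" .
qed

lemma raise_zeros_lin: "vec.lin (raise_zeros Q q l)"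
  unfolding raise_zeros_def by (rule lin_lin_ext)

lemma replace_zero_minus_vec:
  assumes "w 1 = w (-1)"
  shows "lin_ext (replace_zero q e w) (minus_vec Q q j b y)
    = scale (w 1 ^ b) (minus_vec Q q j b (lin_ext (replace_zero q e w) y))"
proof (induction b arbitrary: j)
  case (Suc b)
  have "lin_ext (replace_zero q e w) (mix x y) = scale (w 1) (mix x (lin_ext (replace_zero q e w) y))" for x y
    using assms by (simp add: mix_def lin_ext_add lin_ext_scale replace_zero_pre scale.scale_right_distrib mult_ac)
  then show ?case using Suc by (simp add: mix_simps)
qed simp

text \<open>
  The test vector carries the character \<open>T\<^sub>0 \<mapsto> -Q\<close> on the first \<open>b\<close> positions and the letter \<open>0\<close> at the
  last \<open>l\<close> ones.  As its first factors contain no \<open>0\<close>, raising it only affects these \<open>l\<close> letters, and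
  \<open>raised_tail\<close> is what they become.
\<close>

definition test_vec :: "'k::field \<Rightarrow> 'k \<Rightarrow> nat \<Rightarrow> nat \<Rightarrow> (int list \<Rightarrow>\<^sub>0 'k)" where
  "test_vec Q q b l = minus_vec Q q 0 b (basis_vec (replicate l 0))"

definition raised_tail :: "'k::field \<Rightarrow> 'k \<Rightarrow> nat \<Rightarrow> nat \<Rightarrow> (int list \<Rightarrow>\<^sub>0 'k)" where
  "raised_tail Q q b l = scale (inverse q ^ b) (replace_zero q 1 (plus_weight q) (replicate l 0))
     + scale (inverse Q) (replace_zero q (-1) (minus_weight q) (replicate l 0))"

lemma raise_zeros_test_vec:
  "raise_zeros Q q l (test_vec Q q b l) = minus_vec Q q 0 b (raised_tail Q q b l)"
proof -
  let ?g = "\<lambda>\<mu>. if count_list \<mu> 0 = l then raise_op Q q \<mu> else 0"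
  let ?s = "\<lambda>\<mu>. if count_list \<mu> 0 = l then basis_vec \<mu> else 0 :: int list \<Rightarrow>\<^sub>0 'a"
  have sel: "lin_ext ?g y = lin_ext (raise_op Q q) (lin_ext ?s y)" for y
    by (rule lin_eqI[OF lin_lin_ext vec.lin_comp[OF lin_lin_ext lin_lin_ext]]) simp
  have s_pre: "lin_ext ?s (pre c y) = pre c (lin_ext ?s y)" if "c \<noteq> 0" for c y
    by (rule lin_eqI[OF vec.lin_comp[OF lin_lin_ext lin_pre] vec.lin_comp[OF lin_pre lin_lin_ext]])
       (use that in \<open>simp add: pre_simps\<close>)
  have "lin_ext ?s (minus_vec Q q j b y) = minus_vec Q q j b (lin_ext ?s y)" for j y
    by (induction b arbitrary: j) (simp_all add: mix_def lin_ext_add lin_ext_scale lin_ext_diff s_pre)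
  then have "raise_zeros Q q l (test_vec Q q b l) = lin_ext (raise_op Q q) (minus_vec Q q 0 b (basis_vec (replicate l 0)))"
    unfolding raise_zeros_def sel test_vec_def by (simp add: count_list_replicate)
  also have "\<dots> = minus_vec Q q 0 b (raised_tail Q q b l)"
    unfolding raise_op_lin_ext raised_tail_def
    by (simp add: replace_zero_minus_vec module_hom.add[OF lin_minus_vec] module_hom.scale[OF lin_minus_vec])
  finally show ?thesis .
qed

lemma raised_test_vec_nonzero:
  assumes "q \<noteq> 0" "1 \<le> l"
  shows "raise_zeros Q q l (test_vec Q q b l) \<noteq> 0"
proof
  assume z: "raise_zeros Q q l (test_vec Q q b l) = 0"
  obtain m where m: "l = Suc m" using assms(2) by (cases l) auto
  have "Poly_Mapping.lookup (raised_tail Q q b l) (1 # replicate m 0) = 0"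
    using z unfolding raise_zeros_test_vec
    by (metis lookup_minus_vec lookup_zero)
  then show False
    using assms(1) m by (simp add: raised_tail_def lookup_add lookup_pre lookup_basis_vec right_weight_def)
qed

text \<open>
  Let \<open>\<Phi>\<close> be a linear form on words of length \<open>l\<close> under which every \<open>T\<^sub>i\<close> acts as \<open>q\<^sup>-\<^sup>1\<close>.  On a word with
  a single letter different from \<open>0\<close> it depends on the position of that letter by a power of \<open>q\<close>, so
  that its value at the raised word is a multiple of the geometric sum of the \<open>q\<^sup>-\<^sup>2\<^sup>i\<close>, \<open>i < l\<close>.
\<close>

lemma symmetric_form_vanishing:
  fixes q Q :: "'k::field" and \<Phi> :: "(int list \<Rightarrow>\<^sub>0 'k) \<Rightarrow> 'k"
  assumes q: "q \<noteq> 0" "q\<^sup>2 \<noteq> 1" "q ^ (2 * l) = 1" and l: "1 \<le> l"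
    and add: "\<And>x y. x \<in> word_space {-1, 0, 1} l \<Longrightarrow> y \<in> word_space {-1, 0, 1} l \<Longrightarrow> \<Phi> (x + y) = \<Phi> x + \<Phi> y"
    and scale: "\<And>c x. x \<in> word_space {-1, 0, 1} l \<Longrightarrow> \<Phi> (scale c x) = c * \<Phi> x"
    and T: "\<And>i x. x \<in> word_space {-1, 0, 1} l \<Longrightarrow> 1 \<le> i \<Longrightarrow> i < l \<Longrightarrow> \<Phi> (gen_act Q q x i) = inverse q * \<Phi> x"
  shows "\<Phi> (raised_tail Q q b l) = 0"
proof -
  let ?W = "word_space {-1, 0, 1} l :: (int list \<Rightarrow>\<^sub>0 'k) set"
  define p where "p = inverse q"
  define z where "z j y = (pre 0 ^^ j) y" for j and y :: "int list \<Rightarrow>\<^sub>0 'k"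
  have z_basis: "z j (basis_vec \<mu>) = basis_vec (replicate j 0 @ \<mu>)" for j \<mu>
    by (induction j) (simp_all add: z_def)
  have z_lin: "z j (x + y) = z j x + z j y" "z j (scale c x) = scale c (z j x)" for j x y c
    by (induction j) (simp_all add: z_def pre_simps)
  have z_pre: "z j (pre 0 y) = z (Suc j) y" for j y
    by (simp add: z_def funpow_swap1)
  have z_W: "z j y \<in> word_space {-1, 0, 1} (j + m)" if "y \<in> word_space {-1, 0, 1} m" for j m y
    using that by (induction j) (auto simp: z_def intro!: word_space_pre)
  have bW: "basis_vec \<mu> \<in> ?W" if "length \<mu> = l" "set \<mu> \<subseteq> {-1, 0, 1}" for \<mu>
    using that by (rule word_space_basis_vec)
  have rW: "z (l - m) (replace_zero q e w (replicate m 0)) \<in> ?W" if "m \<le> l" "e \<in> {-1, 1}" for m e w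
  proof -
    have "set (replicate m 0) \<subseteq> {-1, 0, 1 :: int}" by (simp add: set_replicate_conv_if)
    then show ?thesis using z_W[OF word_space_replace_zero[of "replicate m 0" e q w], of "l - m"] that by auto
  qed
  have rwt: "right_weight q (replicate m 0) = p ^ m" for m
    by (simp add: right_weight_def p_def count_list_replicate)
  have geo: "(\<Sum>i<l. (p\<^sup>2) ^ i) = 0"
  proof -
    have p2: "p\<^sup>2 = inverse (q\<^sup>2)" unfolding p_def by (rule power_inverse)
    have "(p\<^sup>2) ^ l = inverse (q ^ (2 * l))" by (simp add: p_def power_inverse flip: power_mult)
    then have "(p\<^sup>2) ^ l = 1" using q(3) by simp
    then have "(1 - p\<^sup>2) * (\<Sum>i<l. (p\<^sup>2) ^ i) = 0"
      using one_diff_power_eq[of "p\<^sup>2" l] by simp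
    moreover have "p\<^sup>2 \<noteq> 1" using q(2) unfolding p2 by (metis inverse_eq_1_iff)
    ultimately show ?thesis by simp
  qed
  define C where "C = \<Phi> (basis_vec (replicate (l - 1) 0 @ [1]))"
  have plus_word: "\<Phi> (basis_vec (replicate (l - 1 - m) 0 @ 1 # replicate m 0)) = p ^ m * C" if "m < l" for m
    using that
  proof (induction m)
    case 0
    show ?case by (simp add: C_def)
  next
    case (Suc m)
    define j where "j = l - 2 - m"
    have j: "l - 1 - m = Suc j" "l - 1 - Suc m = j" "Suc j < l" "j + Suc (Suc m) = l"
      using Suc.prems by (auto simp: j_def)
    have "gen_act Q q (basis_vec (replicate j 0 @ 0 # 1 # replicate m 0)) (Suc j)
      = basis_vec (replicate j 0 @ 1 # 0 # replicate m 0)"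
      by (simp add: gen_act_Suc_append)
    moreover have "basis_vec (replicate j 0 @ 0 # 1 # replicate m 0) \<in> ?W"
      by (rule bW) (use j in auto)
    ultimately have "\<Phi> (basis_vec (replicate j 0 @ 1 # 0 # replicate m 0))
      = p * \<Phi> (basis_vec (replicate j 0 @ 0 # 1 # replicate m 0))"
      using T[of _ "Suc j"] j(3) unfolding p_def by fastforce
    moreover have "replicate j 0 @ 0 # 1 # replicate m 0 = replicate (Suc j) 0 @ (1 :: int) # replicate m 0"
      by (simp add: replicate_app_Cons_same)
    ultimately show ?case using Suc j by simp
  qed
  have plus: "\<Phi> (z (l - m) (replace_zero q 1 (plus_weight q) (replicate m 0))) = (\<Sum>i<m. (p\<^sup>2) ^ i) * C"
    if "m \<le> l" for m
    using that
  proof (induction m)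
    case 0
    have "\<Phi> (scale 0 (0 :: int list \<Rightarrow>\<^sub>0 'k)) = 0" by (subst scale) (auto simp: word_space_zero)
    moreover have "z (l - 0) 0 = 0" using z_lin(2)[of l 0 0] by simp
    ultimately show ?case by simp
  next
    case (Suc m)
    define k where "k = l - Suc m"
    have k: "l - Suc m = k" "l - 1 - m = k" "l - m = Suc k" "m < l" "k + Suc m = l"
      using Suc.prems by (auto simp: k_def)
    let ?r = "replace_zero q 1 (plus_weight q) (replicate m 0)"
    have e: "z k (replace_zero q 1 (plus_weight q) (replicate (Suc m) 0))
      = scale (p ^ m) (basis_vec (replicate k 0 @ 1 # replicate m 0)) + z (Suc k) ?r"
      by (simp add: rwt z_lin z_pre z_basis)
    have bw: "basis_vec (replicate k 0 @ 1 # replicate m 0) \<in> ?W"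
      by (rule bW) (use k in auto)
    have zw: "z (Suc k) ?r \<in> ?W" using rW[of m 1] k by simp
    have \<Phi>1: "\<Phi> (basis_vec (replicate k 0 @ 1 # replicate m 0)) = p ^ m * C"
      using plus_word[OF k(4)] unfolding k(2) .
    have \<Phi>2: "\<Phi> (z (Suc k) ?r) = (\<Sum>i<m. (p\<^sup>2) ^ i) * C"
      using Suc.IH Suc.prems unfolding k(3) by simp
    have "\<Phi> (z (l - Suc m) (replace_zero q 1 (plus_weight q) (replicate (Suc m) 0)))
      = p ^ m * (p ^ m * C) + (\<Sum>i<m. (p\<^sup>2) ^ i) * C"
      unfolding k(1) e add[OF word_space_scale[OF bw] zw] scale[OF bw] \<Phi>1 \<Phi>2 ..
    also have "\<dots> = (\<Sum>i<Suc m. (p\<^sup>2) ^ i) * C"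
      by (simp add: algebra_simps power2_eq_square power_mult_distrib)
    finally show ?case .
  qed
  define C' where "C' = \<Phi> (basis_vec ((-1) # replicate (l - 1) 0))"
  have minus_word: "\<Phi> (basis_vec (replicate j 0 @ (-1) # replicate (l - 1 - j) 0)) = p ^ j * C'" if "j < l" for j
    using that
  proof (induction j)
    case 0
    show ?case by (simp add: C'_def)
  next
    case (Suc j)
    define m where "m = l - 2 - j"
    have m: "l - 1 - j = Suc m" "l - 1 - Suc j = m" "Suc j < l" "j + Suc (Suc m) = l"
      using Suc.prems by (auto simp: m_def)
    have "gen_act Q q (basis_vec (replicate j 0 @ (-1) # 0 # replicate m 0)) (Suc j)
      = basis_vec (replicate j 0 @ 0 # (-1) # replicate m 0)"
      by (simp add: gen_act_Suc_append)
    moreover have "basis_vec (replicate j 0 @ (-1) # 0 # replicate m 0) \<in> ?W"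
      by (rule bW) (use m in auto)
    ultimately have "\<Phi> (basis_vec (replicate j 0 @ 0 # (-1) # replicate m 0))
      = p * \<Phi> (basis_vec (replicate j 0 @ (-1) # 0 # replicate m 0))"
      using T[of _ "Suc j"] m(3) unfolding p_def by fastforce
    moreover have "replicate j 0 @ 0 # (-1) # replicate m 0 = replicate (Suc j) 0 @ (-1 :: int) # replicate m 0"
      by (simp add: replicate_app_Cons_same)
    ultimately show ?case using Suc m by simp
  qed
  have minus: "\<Phi> (z (l - m) (replace_zero q (-1) (minus_weight q) (replicate m 0)))
      = p ^ (l - 1) * (\<Sum>i<m. (p\<^sup>2) ^ i) * C'"
    if "m \<le> l" for m
    using that
  proof (induction m)
    case 0
    have "\<Phi> (scale 0 (0 :: int list \<Rightarrow>\<^sub>0 'k)) = 0" by (subst scale) (auto simp: word_space_zero)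
    moreover have "z (l - 0) 0 = 0" using z_lin(2)[of l 0 0] by simp
    ultimately show ?case by simp
  next
    case (Suc m)
    define k where "k = l - Suc m"
    have k: "l - Suc m = k" "l - 1 - k = m" "l - m = Suc k" "k < l" "k + Suc m = l" "m + k = l - 1"
      using Suc.prems by (auto simp: k_def)
    let ?r = "replace_zero q (-1) (minus_weight q) (replicate m 0)"
    have e: "z k (replace_zero q (-1) (minus_weight q) (replicate (Suc m) 0))
      = scale (p ^ m) (basis_vec (replicate k 0 @ (-1) # replicate m 0)) + scale (p\<^sup>2) (z (Suc k) ?r)"
      by (simp add: rwt z_lin z_pre z_basis) (simp add: p_def power2_eq_square)
    have bw: "basis_vec (replicate k 0 @ (-1) # replicate m 0) \<in> ?W"
      by (rule bW) (use k in auto)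
    have zw: "z (Suc k) ?r \<in> ?W" using rW[of m "-1"] k by simp
    have \<Phi>1: "\<Phi> (basis_vec (replicate k 0 @ (-1) # replicate m 0)) = p ^ k * C'"
      using minus_word[OF k(4)] unfolding k(2) .
    have \<Phi>2: "\<Phi> (z (Suc k) ?r) = p ^ (l - 1) * (\<Sum>i<m. (p\<^sup>2) ^ i) * C'"
      using Suc.IH Suc.prems unfolding k(3) by simp
    have "\<Phi> (z (l - Suc m) (replace_zero q (-1) (minus_weight q) (replicate (Suc m) 0)))
      = p ^ m * (p ^ k * C') + p\<^sup>2 * (p ^ (l - 1) * (\<Sum>i<m. (p\<^sup>2) ^ i) * C')"
      unfolding k(1) e add[OF word_space_scale[OF bw] word_space_scale[OF zw]] scale[OF bw] scale[OF zw] \<Phi>1 \<Phi>2 ..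
    also have "p ^ m * (p ^ k * C') = p ^ (l - 1) * C'"
      unfolding k(6)[symmetric] power_add by simp
    also have "p ^ (l - 1) * C' + p\<^sup>2 * (p ^ (l - 1) * (\<Sum>i<m. (p\<^sup>2) ^ i) * C')
      = p ^ (l - 1) * (\<Sum>i<Suc m. (p\<^sup>2) ^ i) * C'"
      by (simp only: sum.lessThan_Suc_shift power_0 power_Suc sum_distrib_left[symmetric]) (simp add: algebra_simps)
    finally show ?case .
  qed
  have "z 0 y = y" for y by (simp add: z_def)
  then have 0: "\<Phi> (replace_zero q 1 (plus_weight q) (replicate l 0)) = 0"
    "\<Phi> (replace_zero q (-1) (minus_weight q) (replicate l 0)) = 0"
    using plus[OF order_refl] minus[OF order_refl] geo by auto
  have W: "replace_zero q 1 (plus_weight q) (replicate l 0) \<in> ?W"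
    "replace_zero q (-1) (minus_weight q) (replicate l 0) \<in> ?W"
    using rW[of l 1] rW[of l "-1"] by (simp_all add: z_def)
  show ?thesis
    unfolding raised_tail_def add[OF word_space_scale[OF W(1)] word_space_scale[OF W(2)]] scale[OF W(1)] scale[OF W(2)] 0
    by simp
qed

lemma raised_tail_word_space: "raised_tail Q q b l \<in> word_space {-1, 0, 1} l"
proof -
  have "set (replicate l 0) \<subseteq> {-1, 0, 1 :: int}" by (simp add: set_replicate_conv_if)
  then show ?thesis
    using word_space_replace_zero[of "replicate l 0"] unfolding raised_tail_def
    by (intro word_space_add word_space_scale) auto
qed

text \<open>
  On its first \<open>d - l\<close> positions the raised vector still carries the character \<open>T\<^sub>0 \<mapsto> -Q\<close>, and so does its
  image \<open>m\<close> under \<open>G\<close>.  Hence the coefficients of \<open>m\<close> at words with \<open>l\<close> letters \<open>0\<close> are determined by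
  the one at \<open>1\<dots>1 0\<dots>0\<close>.  As a function of the last \<open>l\<close> positions before applying \<open>G\<close>, this coefficient
  is a linear form on which every \<open>T\<^sub>i\<close> acts as \<open>q\<^sup>-\<^sup>1\<close>, so it vanishes, and \<open>m\<close> has no word with \<open>l\<close>
  letters \<open>0\<close>.
\<close>

theorem raise_zeros_not_regular:
  fixes q Q :: "'k::field"
  assumes q: "q \<noteq> 0" "q\<^sup>2 \<noteq> 1" "q ^ (2 * l) = 1" and Q: "Q \<noteq> 0" "inverse Q \<noteq> - Q"
    and l: "1 \<le> l" "l \<le> d" and G: "module_endo Q q 3 d G"
  shows "raise_zeros Q q l (G (raise_zeros Q q l (test_vec Q q (d - l) l))) = 0"
proof -
  let ?W = "word_space {-1, 0, 1} l :: (int list \<Rightarrow>\<^sub>0 'k) set" and ?V = "tensor_space 3 d :: (int list \<Rightarrow>\<^sub>0 'k) set"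
  define b where "b = d - l"
  have bl: "b + l = d" using l by (simp add: b_def)
  define M where "M y = minus_vec Q q 0 b y" for y
  have MV: "M y \<in> ?V" if "y \<in> ?W" for y
    using word_space_minus_vec[OF that, of Q q 0 b] unfolding tensor_space_eq index_set_3 M_def bl by auto
  have Mlin: "M (x + y) = M x + M y" "M (scale c x) = scale c (M x)" for x y c
    by (simp_all add: M_def module_hom.add[OF lin_minus_vec] module_hom.scale[OF lin_minus_vec])
  define \<nu> :: "int list" where "\<nu> = replicate b 1 @ replicate l 0"
  define \<Phi> where "\<Phi> y = Poly_Mapping.lookup (G (M y)) \<nu>" for y
  have GV: "G (M y) \<in> length_space d" if "y \<in> ?W" for y
    using module_endoD(1)[OF G MV[OF that]] tensor_space_length_space by blast
  have \<Phi>T: "\<Phi> (gen_act Q q x i) = inverse q * \<Phi> x" if x: "x \<in> ?W" and i: "1 \<le> i" "i < l" for i x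
  proof -
    let ?xs = "replicate b 1 @ replicate (i - 1) 0 :: int list" and ?ys = "replicate (l - i - 1) 0 :: int list"
    have "l = (i - 1) + Suc (Suc (l - i - 1))" using i by arith
    from arg_cong[where f="\<lambda>l. replicate l (0 :: int)", OF this] have \<nu>: "\<nu> = ?xs @ 0 # 0 # ?ys"
      by (simp only: \<nu>_def replicate_add replicate_Suc append_assoc)
    have len: "length (?xs @ 0 # 0 # ?ys) = d" "b + i = Suc (length ?xs)" using i bl by auto
    have "M (gen_act Q q x i) = gen_act Q q (M x) (b + i)"
      unfolding M_def using minus_vec_behind[OF i(1)] by metis
    then have "G (M (gen_act Q q x i)) = gen_act Q q (G (M x)) (b + i)"
      using module_endoD(4)[OF G MV[OF x], of "b + i"] i bl by simp
    then show ?thesis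
      unfolding \<Phi>_def \<nu> len(2) using lookup_gen_act_Suc[OF GV[OF x] len(1), of Q q] by simp
  qed
  let ?Y = "raised_tail Q q b l"
  note YW = raised_tail_word_space[of Q q b l]
  have "\<Phi> ?Y = 0"
  proof (rule symmetric_form_vanishing[OF q l(1) _ _ \<Phi>T])
    show "\<Phi> (x + y) = \<Phi> x + \<Phi> y" if "x \<in> ?W" "y \<in> ?W" for x y
      using module_endoD(2)[OF G MV[OF that(1)] MV[OF that(2)]] by (simp add: \<Phi>_def Mlin lookup_add)
    show "\<Phi> (scale c x) = c * \<Phi> x" if "x \<in> ?W" for c x
      using module_endoD(3)[OF G MV[OF that]] by (simp add: \<Phi>_def Mlin)
  qed
  then have m0: "Poly_Mapping.lookup (G (M ?Y)) (replicate b 1 @ replicate l 0) = 0"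
    by (simp add: \<Phi>_def \<nu>_def)
  define m where "m = G (M ?Y)"
  have mV: "m \<in> ?V" unfolding m_def by (rule module_endoD(1)[OF G MV[OF YW]])
  have m_0: "gen_act Q q m 0 = scale (- Q) m" if "1 \<le> b"
    using minus_vec_0[OF Q(1) that, of q ?Y] module_endoD(4)[OF G MV[OF YW], of 0]
      module_endoD(3)[OF G MV[OF YW], of "- Q"] that bl by (simp add: m_def M_def)
  have m_i: "gen_act Q q m i = scale (inverse q) m" if "1 \<le> i" "i < b" for i
    using minus_vec_inside[OF q(1) that, of Q 0 ?Y] module_endoD(4)[OF G MV[OF YW], of i]
      module_endoD(3)[OF G MV[OF YW]] that bl by (simp add: m_def M_def)
  have "Poly_Mapping.lookup m \<mu> = 0" if \<mu>: "\<mu> \<in> Poly_Mapping.keys m" "count_list \<mu> 0 = l" for \<mu>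
  proof -
    have \<mu>': "length \<mu> = d" "set \<mu> \<subseteq> {-1, 0, 1}"
      using mV \<mu>(1) by (auto simp: tensor_space_def multi_indices_def index_set_3)
    define p where "p = take b \<mu>"
    define s where "s = drop b \<mu>"
    have ps: "\<mu> = p @ s" "length p = b" "length s = l" using \<mu>'(1) bl by (auto simp: p_def s_def)
    have z: "0 \<in> set p \<or> Poly_Mapping.lookup m (replicate b 1 @ s) = 0"
    proof (cases "0 \<in> set p")
      case False
      then have "count_list p 0 = 0" by simp
      then have "count_list s 0 = length s" using \<mu>(2) ps by (simp add: count_list_append)
      moreover have "s = replicate (length s) 0" if "count_list s 0 = length s" for s :: "int list"
        using that
      proof (induction s)
        case (Cons a s)
        then show ?case using count_le_length[of s 0] by (auto split: if_splits)
      qed simp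
      ultimately have "s = replicate l 0" using ps(3) by metis
      then show ?thesis using m0 by (simp add: m_def)
    qed simp
    have "m \<in> length_space d" "b \<le> d" "length (p @ s) = d" "set p \<subseteq> {-1, 0, 1}"
      using mV tensor_space_length_space bl ps \<mu>' by auto
    then show ?thesis
      using minus_character_vanishing[OF q(1) Q _ _ m_0 m_i ps(2) _ _ z] ps(1) by simp
  qed
  then have "raise_zeros Q q l m = 0"
    unfolding raise_zeros_def lin_ext_def by (intro sum.neutral) auto
  then show ?thesis
    using raise_zeros_test_vec[of Q q l b] by (simp add: m_def M_def b_def)
qed

section \<open>More than three letters\<close>

text \<open>
  A three-letter module inside a larger one: non-regularity is inherited along homomorphisms whose
  composite multiplies the test vector by a nonzero scalar.
\<close>

lemma not_regular_transfer:
  fixes q Q :: "'k::field"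
  assumes q: "q \<noteq> 0" "q\<^sup>2 \<noteq> 1" "q ^ (2 * l) = 1" and Q: "Q \<noteq> 0" "inverse Q \<noteq> - Q"
    and l: "1 \<le> l" "l \<le> d"
    and \<theta>: "tensor_hom Q q 3 n d \<theta>" and \<pi>: "tensor_hom Q q n 3 d \<pi>"
    and inj: "\<And>x. x \<in> tensor_space 3 d \<Longrightarrow> \<theta> x = 0 \<Longrightarrow> x = 0"
    and \<gamma>: "\<gamma> \<noteq> 0" "\<pi> (\<theta> (test_vec Q q (d - l) l)) = scale \<gamma> (test_vec Q q (d - l) l)"
  shows "\<not> (\<forall>f. module_endo Q q n d f \<longrightarrow>
    (\<exists>g. module_endo Q q n d g \<and> (\<forall>x \<in> tensor_space n d. f (g (f x)) = f x)))"
proof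
  assume reg: "\<forall>f. module_endo Q q n d f \<longrightarrow>
    (\<exists>g. module_endo Q q n d g \<and> (\<forall>x \<in> tensor_space n d. f (g (f x)) = f x))"
  let ?E = "raise_zeros Q q l" and ?y = "test_vec Q q (d - l) l"
  note E = raise_zeros_hom[OF q(1) Q(1), of d l]
  have "module_endo Q q n d (\<lambda>x. \<theta> (?E (\<pi> x)))"
    by (intro tensor_hom_comp[OF tensor_hom_comp[OF \<pi> E] \<theta>])
  then obtain g where g: "module_endo Q q n d g"
    "\<And>x. x \<in> tensor_space n d \<Longrightarrow> \<theta> (?E (\<pi> (g (\<theta> (?E (\<pi> x)))))) = \<theta> (?E (\<pi> x))"
    using reg by blast
  define G where "G x = \<pi> (g (\<theta> x))" for x
  have G: "module_endo Q q 3 d G"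
    using tensor_hom_comp[OF tensor_hom_comp[OF \<theta> g(1)] \<pi>]
    unfolding G_def .
  have "basis_vec (replicate l 0) \<in> (word_space {-1, 0, 1} l :: (int list \<Rightarrow>\<^sub>0 'k) set)"
    by (intro word_space_basis_vec) (auto simp: set_replicate_conv_if)
  from word_space_minus_vec[OF this, of Q q 0 "d - l"] have y: "?y \<in> tensor_space 3 d"
    using l unfolding tensor_space_eq index_set_3 test_vec_def by simp
  then have Ey: "?E ?y \<in> tensor_space 3 d" using E by (simp add: tensor_hom_def)
  have GE: "?E (G (?E ?y)) = 0" by (rule raise_zeros_not_regular[OF q Q l G])
  have sc: "?E (scale \<gamma> x) = scale \<gamma> (?E x)" for x by (rule module_hom.scale[OF raise_zeros_lin])
  have "\<theta> (?E (\<pi> (g (\<theta> (scale \<gamma> (?E ?y)))))) = \<theta> (scale \<gamma> (?E ?y))"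
    using g(2)[of "\<theta> ?y"] y \<theta> unfolding \<gamma>(2) sc by (simp add: tensor_hom_def)
  then have "\<theta> (?E (G (scale \<gamma> (?E ?y)))) = \<theta> (scale \<gamma> (?E ?y))" by (simp add: G_def)
  moreover have "G (scale \<gamma> (?E ?y)) = scale \<gamma> (G (?E ?y))" using module_endoD(3)[OF G Ey] .
  moreover have "\<theta> 0 = 0"
  proof -
    have "\<theta> (scale 0 0) = scale 0 (\<theta> 0)"
      using \<theta> tensor_space_zero[of 3 d] unfolding tensor_hom_def by blast
    then show ?thesis by simp
  qed
  ultimately have "\<theta> (scale \<gamma> (?E ?y)) = 0" by (simp add: sc GE)
  then have "scale \<gamma> (?E ?y) = 0" using inj tensor_space_scale[OF Ey] by blast
  then show False using \<gamma>(1) raised_test_vec_nonzero[OF q(1) l(1), of Q "d - l"] by simp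
qed

lemma odd_transfer:
  fixes q Q :: "'k::field" and x :: "int list \<Rightarrow>\<^sub>0 'k"
  assumes "{-1, 0, 1} \<subseteq> index_set n"
  shows "tensor_hom Q q 3 n d (\<lambda>x. x)"
    "tensor_hom Q q n 3 d (lin_ext (\<lambda>\<mu>. if set \<mu> \<subseteq> {-1, 0, 1} then basis_vec \<mu> else 0))"
    "x \<in> tensor_space 3 d \<Longrightarrow> lin_ext (\<lambda>\<mu>. if set \<mu> \<subseteq> {-1, 0, 1} then basis_vec \<mu> else 0) x = x"
proof -
  let ?g = "\<lambda>\<mu>. if set \<mu> \<subseteq> {-1, 0, 1} then basis_vec \<mu> else 0 :: int list \<Rightarrow>\<^sub>0 'k"
  have "tensor_space 3 d \<subseteq> tensor_space n d"
    using assms by (auto simp: tensor_space_eq index_set_3 word_space_def)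
  then show "tensor_hom Q q 3 n d (\<lambda>x. x)" by (auto simp: tensor_hom_def)
  show "tensor_hom Q q n 3 d (lin_ext ?g)"
  proof (rule tensor_hom_lin_ext)
    fix \<mu> t assume \<mu>: "\<mu> \<in> multi_indices n d"
    then show "?g \<mu> \<in> tensor_space 3 d"
      by (auto simp: multi_indices_def index_set_3 tensor_space_zero intro!: basis_vec_tensor_space)
    assume "t < d"
    then have "t < length \<mu>" using \<mu> by (simp add: multi_indices_def)
    then show "lin_ext ?g (gen_act Q q (basis_vec \<mu>) t) = gen_act Q q (?g \<mu>) t"
      by (cases rule: gen_act_cases)
         (auto simp: gen_act_0_Cons gen_act_Suc_append lin_ext_add lin_ext_scale gen_act_zero)
  qed
  assume x: "x \<in> tensor_space 3 d"
  have "scale.subspace {x. lin_ext ?g x = x}"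
    by (rule scale.subspaceI) (simp_all add: lin_ext_add lin_ext_scale)
  then have "scale.span (basis_vec ` multi_indices 3 d) \<subseteq> {x. lin_ext ?g x = x}"
    by (intro scale.span_minimal) (auto simp: multi_indices_3)
  then show "lin_ext ?g x = x" using x tensor_space_span by blast
qed

text \<open>
  If the letter \<open>0\<close> is missing, the letters \<open>1\<close> and \<open>-1\<close> take its place: \<open>split_zeros\<close> replaces the
  zeros of a word by the vector of letters \<open>1\<close> and \<open>-1\<close> spanning the trivial character, and
  \<open>merge_ones\<close> is its transpose.  The argument \<open>k\<close> counts the letters \<open>0\<close>,
  or \<open>1\<close> and \<open>-1\<close>, already treated.
\<close>

fun split_zeros :: "'k::field \<Rightarrow> 'k \<Rightarrow> nat \<Rightarrow> int list \<Rightarrow> (int list \<Rightarrow>\<^sub>0 'k)" where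
  "split_zeros Q q k [] = basis_vec []"
| "split_zeros Q q k (c # \<mu>) =
     (if c = 0 then mix (inverse Q / q ^ k) (split_zeros Q q (Suc k) \<mu>) else pre (2 * c) (split_zeros Q q k \<mu>))"

fun merge_ones :: "'k::field \<Rightarrow> 'k \<Rightarrow> nat \<Rightarrow> int list \<Rightarrow> (int list \<Rightarrow>\<^sub>0 'k)" where
  "merge_ones Q q k [] = basis_vec []"
| "merge_ones Q q k (c # \<mu>) =
     (if c = 1 then pre 0 (merge_ones Q q (Suc k) \<mu>)
      else if c = -1 then scale (inverse Q / q ^ k) (pre 0 (merge_ones Q q (Suc k) \<mu>))
      else if c = 2 \<or> c = -2 then pre (c div 2) (merge_ones Q q k \<mu>)
      else 0)"

lemma split_zeros_pre:
  "lin_ext (split_zeros Q q k) (pre c y) =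
     (if c = 0 then mix (inverse Q / q ^ k) (lin_ext (split_zeros Q q (Suc k)) y)
      else pre (2 * c) (lin_ext (split_zeros Q q k) y))"
proof -
  have "vec.lin (\<lambda>y. if c = 0 then mix (inverse Q / q ^ k) (lin_ext (split_zeros Q q (Suc k)) y)
      else pre (2 * c) (lin_ext (split_zeros Q q k) y))"
    by (rule vec.linI) (simp_all add: lin_ext_add lin_ext_scale pre_simps mix_simps)
  from lin_eqI[OF vec.lin_comp[OF lin_lin_ext lin_pre] this] show ?thesis by simp
qed

lemma merge_ones_pre:
  "lin_ext (merge_ones Q q k) (pre c y) =
     (if c = 1 then pre 0 (lin_ext (merge_ones Q q (Suc k)) y)
      else if c = -1 then scale (inverse Q / q ^ k) (pre 0 (lin_ext (merge_ones Q q (Suc k)) y))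
      else if c = 2 \<or> c = -2 then pre (c div 2) (lin_ext (merge_ones Q q k) y)
      else 0)"
proof -
  have "vec.lin (\<lambda>y. if c = 1 then pre 0 (lin_ext (merge_ones Q q (Suc k)) y)
      else if c = -1 then scale (inverse Q / q ^ k) (pre 0 (lin_ext (merge_ones Q q (Suc k)) y))
      else if c = 2 \<or> c = -2 then pre (c div 2) (lin_ext (merge_ones Q q k) y)
      else 0)"
    by (rule vec.linI) (simp_all add: lin_ext_add lin_ext_scale pre_simps scale.scale_right_distrib scale.scale_left_commute)
  from lin_eqI[OF vec.lin_comp[OF lin_lin_ext lin_pre] this] show ?thesis by simp
qed

lemma split_zeros_commute:
  fixes q Q :: "'k::field"
  assumes q: "q \<noteq> 0" and "1 \<le> t" "t < length \<mu>" "set \<mu> \<subseteq> {-1, 0, 1}"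
  shows "lin_ext (split_zeros Q q k) (gen_act Q q (basis_vec \<mu>) t) = gen_act Q q (split_zeros Q q k \<mu>) t"
  using assms(2-)
proof (induction \<mu> arbitrary: t k)
  case (Cons a \<mu>)
  show ?case
  proof (cases "t = 1")
    case True
    then obtain b ys where b: "\<mu> = b # ys" using Cons.prems by (cases \<mu>) auto
    define Y :: "int list \<Rightarrow>\<^sub>0 'k" where "Y = basis_vec ys"
    define E where "E k = lin_ext (split_zeros Q q k)" for k
    have Y: "basis_vec (a # \<mu>) = pre a (pre b Y)" by (simp add: Y_def b)
    have ab: "a = -1 \<or> a = 0 \<or> a = 1" "b = -1 \<or> b = 0 \<or> b = 1" using Cons.prems b by auto
    have E: "E k (pre c y) = (if c = 0 then mix (inverse Q / q ^ k) (E (Suc k) y) else pre (2 * c) (E k y))"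
      "E k (x + y) = E k x + E k y" "E k (scale r x) = scale r (E k x)" for k c x y r
      by (simp_all add: E_def split_zeros_pre lin_ext_add lin_ext_scale)
    have "inverse Q / q ^ Suc k = inverse Q / q ^ k / q" by simp
    then have same: "gen_act Q q (mix (inverse Q / q ^ k) (mix (inverse Q / q ^ Suc k) y)) (Suc 0)
      = scale (inverse q) (mix (inverse Q / q ^ k) (mix (inverse Q / q ^ Suc k) y))" for y
      using gen_act_mix_same[OF q] by metis
    have "E k (gen_act Q q (pre a (pre b Y)) (Suc 0)) = gen_act Q q (E k (pre a (pre b Y))) (Suc 0)"
    proof (cases "a = 0 \<and> b = 0")
      case True
      then show ?thesis using same by (simp add: E gen_act_pre_1 del: power_Suc)
    next
      case False
      then show ?thesis
        using ab
        by (elim disjE; simp add: E gen_act_pre_1 mix_def pre_simps gen_act_add gen_act_scale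
            scale.scale_right_distrib scale.scale_left_commute add_ac)
    qed
    moreover have "E k (pre a (pre b Y)) = split_zeros Q q k (a # \<mu>)"
      unfolding Y[symmetric] E_def by (rule lin_ext_basis_vec)
    ultimately show ?thesis unfolding Y True E_def by simp
  next
    case False
    then obtain t' where t: "t = Suc t'" "1 \<le> t'" "t' < length \<mu>" using Cons.prems by (cases t) auto
    have "gen_act Q q (basis_vec (a # \<mu>)) t = pre a (gen_act Q q (basis_vec \<mu>) t')"
      using gen_act_pre[OF t(2), of Q q a "basis_vec \<mu>"] t(1) by simp
    then show ?thesis
      using Cons.IH[OF t(2,3)] Cons.prems t
      by (simp add: split_zeros_pre gen_act_pre gen_act_mix)
  qed
qed simp

lemma merge_ones_commute:
  fixes q Q :: "'k::field"
  assumes q: "q \<noteq> 0" and "1 \<le> t" "t < length \<mu>"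
  shows "lin_ext (merge_ones Q q k) (gen_act Q q (basis_vec \<mu>) t) = gen_act Q q (merge_ones Q q k \<mu>) t"
  using assms(2-)
proof (induction \<mu> arbitrary: t k)
  case (Cons a \<mu>)
  show ?case
  proof (cases "t = 1")
    case True
    then obtain b ys where b: "\<mu> = b # ys" using Cons.prems by (cases \<mu>) auto
    define Y :: "int list \<Rightarrow>\<^sub>0 'k" where "Y = basis_vec ys"
    define E where "E k = lin_ext (merge_ones Q q k)" for k
    define w where "w k = inverse Q / q ^ k" for k
    have w: "w (Suc k) = w k / q" for k by (simp add: w_def)
    have Y: "basis_vec (a # \<mu>) = pre a (pre b Y)" by (simp add: Y_def b)
    have E: "E k (pre c y) = (if c = 1 then pre 0 (E (Suc k) y)
        else if c = -1 then scale (w k) (pre 0 (E (Suc k) y))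
        else if c = 2 \<or> c = -2 then pre (c div 2) (E k y) else 0)"
      "E k (x + y) = E k x + E k y" "E k (scale r x) = scale r (E k x)" for k c x y r
      by (simp_all add: E_def w_def merge_ones_pre lin_ext_add lin_ext_scale)
    have other: "E k (pre c y) = 0" if "c \<notin> {1, -1, 2, -2}" for k c y
      using that by (simp add: E(1))
    have E0: "E k 0 = 0" for k by (simp add: E_def)
    consider "a \<notin> {1, -1, 2, -2}" | "b \<notin> {1, -1, 2, -2}" | "a \<in> {1, -1, 2, -2}" "b \<in> {1, -1, 2, -2}"
      by blast
    then have "E k (gen_act Q q (pre a (pre b Y)) (Suc 0)) = gen_act Q q (E k (pre a (pre b Y))) (Suc 0)"
    proof cases
      case 1
      then have "E k (pre a y) = 0" "E k (pre b (pre a y)) = 0" for k y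
        using other[OF 1] by (auto simp: E(1) pre_simps)
      then show ?thesis by (cases "a = b") (simp_all add: gen_act_pre_1 E(2,3) gen_act_zero)
    next
      case 2
      then have "E k (pre b y) = 0" "E k (pre a (pre b y)) = 0" for k y
        using other[OF 2] by (auto simp: E(1) pre_simps)
      then show ?thesis by (cases "a = b") (simp_all add: gen_act_pre_1 E(2,3) gen_act_zero)
    next
      case 3
      then have ab: "a = 1 \<or> a = -1 \<or> a = 2 \<or> a = -2" "b = 1 \<or> b = -1 \<or> b = 2 \<or> b = -2" by auto
      show ?thesis
        using ab q
        by (elim disjE; simp add: E w gen_act_pre_1 pre_simps gen_act_add gen_act_scale;
            simp add: vec_eq_simps field_simps)
    qed
    moreover have "E k (pre a (pre b Y)) = merge_ones Q q k (a # \<mu>)"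
      unfolding Y[symmetric] E_def by (rule lin_ext_basis_vec)
    ultimately show ?thesis unfolding Y True E_def by simp
  next
    case False
    then obtain t' where t: "t = Suc t'" "1 \<le> t'" "t' < length \<mu>" using Cons.prems by (cases t) auto
    have "gen_act Q q (basis_vec (a # \<mu>)) t = pre a (gen_act Q q (basis_vec \<mu>) t')"
      using gen_act_pre[OF t(2), of Q q a "basis_vec \<mu>"] t(1) by simp
    then show ?thesis
      using Cons.IH[OF t(2,3)] t
      by (simp add: merge_ones_pre gen_act_pre gen_act_scale gen_act_zero)
  qed
qed simp

lemma split_zeros_word_space:
  "set \<mu> \<subseteq> {-1, 0, 1} \<Longrightarrow> split_zeros Q q k \<mu> \<in> word_space {1, -1, 2, -2} (length \<mu>)"
  by (induction \<mu> arbitrary: k) (auto intro!: word_space_basis_vec word_space_mix word_space_pre)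

lemma merge_ones_word_space: "merge_ones Q q k \<mu> \<in> word_space {-1, 0, 1} (length \<mu>)"
  by (induction \<mu> arbitrary: k)
     (auto intro!: word_space_basis_vec word_space_pre word_space_scale word_space_zero)

lemma split_zeros_hom:
  fixes q Q :: "'k::field"
  assumes q: "q \<noteq> 0" and Q: "Q \<noteq> 0" and n: "{1, -1, 2, -2} \<subseteq> index_set n"
  shows "tensor_hom Q q 3 n d (lin_ext (split_zeros Q q 0))"
proof (rule tensor_hom_lin_ext)
  fix \<mu> t assume "\<mu> \<in> multi_indices 3 d"
  then have \<mu>: "length \<mu> = d" "set \<mu> \<subseteq> {-1, 0, 1}" by (auto simp: multi_indices_3)
  show "split_zeros Q q 0 \<mu> \<in> tensor_space n d"
    using split_zeros_word_space[OF \<mu>(2), of Q q 0] n \<mu>(1)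
    unfolding tensor_space_eq word_space_def by blast
  assume t: "t < d"
  show "lin_ext (split_zeros Q q 0) (gen_act Q q (basis_vec \<mu>) t) = gen_act Q q (split_zeros Q q 0 \<mu>) t"
  proof (cases "t = 0")
    case True
    then obtain c \<nu> where c: "\<mu> = c # \<nu>" using \<mu> t by (cases \<mu>) auto
    then have "c = -1 \<or> c = 0 \<or> c = 1" using \<mu> by auto
    then show ?thesis
      using gen_act_mix_0[OF Q, of "inverse Q" q] True c
      by (elim disjE) (simp_all add: gen_act_0_Cons gen_act_pre_0 lin_ext_add lin_ext_scale)
  next
    case False
    then show ?thesis using split_zeros_commute[OF q, of t \<mu>] \<mu> t by simp
  qed
qed

lemma merge_ones_hom:
  fixes q Q :: "'k::field"
  assumes q: "q \<noteq> 0" and Q: "Q \<noteq> 0"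
  shows "tensor_hom Q q n 3 d (lin_ext (merge_ones Q q 0))"
proof (rule tensor_hom_lin_ext)
  fix \<mu> t assume "\<mu> \<in> multi_indices n d"
  then have \<mu>: "length \<mu> = d" by (auto simp: multi_indices_def)
  show "merge_ones Q q 0 \<mu> \<in> tensor_space 3 d"
    using merge_ones_word_space[of Q q 0 \<mu>] \<mu> unfolding tensor_space_eq index_set_3 by simp
  assume t: "t < d"
  show "lin_ext (merge_ones Q q 0) (gen_act Q q (basis_vec \<mu>) t) = gen_act Q q (merge_ones Q q 0 \<mu>) t"
  proof (cases "t = 0")
    case True
    then obtain c \<nu> where c: "\<mu> = c # \<nu>" using \<mu> t by (cases \<mu>) auto
    have "c = 1 \<or> c = -1 \<or> c = 2 \<or> c = -2 \<or> c \<notin> {1, -1, 2, -2}" by auto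
    then show ?thesis
      using True c Q
      by (elim disjE; simp add: gen_act_0_Cons gen_act_pre_0 lin_ext_add lin_ext_scale gen_act_scale gen_act_zero;
          simp add: vec_eq_simps field_simps)
  next
    case False
    then show ?thesis using merge_ones_commute[OF q, of t \<mu>] \<mu> t by simp
  qed
qed

text \<open>
  The coefficient of the image at the word with \<open>1\<close> for every \<open>0\<close> and \<open>2 c\<close> for every other letter \<open>c\<close>
  recovers the coefficient of \<open>x\<close>.
\<close>

lemma split_zeros_inj:
  "lin_ext (\<lambda>\<mu>. split_zeros Q q k \<mu>) x = 0 \<Longrightarrow> x \<in> word_space {-1, 0, 1} m \<Longrightarrow> x = 0"
proof -
  let ?h = "map (\<lambda>c. if c = 0 then 1 else 2 * c) :: int list \<Rightarrow> int list"
  assume z: "lin_ext (\<lambda>\<mu>. split_zeros Q q k \<mu>) x = 0" and x: "x \<in> word_space {-1, 0, 1} m"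
  have look: "Poly_Mapping.lookup (split_zeros Q q k \<mu>) (?h \<nu>) = (if \<mu> = \<nu> then 1 else 0)"
    if "set \<mu> \<subseteq> {-1, 0, 1}" "set \<nu> \<subseteq> {-1, 0, 1}" "length \<mu> = length \<nu>" for \<mu> \<nu> k
    using that(3,1,2)
  proof (induction \<mu> \<nu> arbitrary: k rule: list_induct2)
    case Nil
    then show ?case by (simp add: lookup_basis_vec)
  next
    case (Cons a \<mu> b \<nu>)
    then have "a = -1 \<or> a = 0 \<or> a = 1" "b = -1 \<or> b = 0 \<or> b = 1" by auto
    then show ?case using Cons
      by (elim disjE) (simp_all add: mix_def lookup_add lookup_pre)
  qed
  have "Poly_Mapping.lookup x \<nu> = 0" if \<nu>: "\<nu> \<in> Poly_Mapping.keys x" for \<nu>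
  proof -
    have "0 = Poly_Mapping.lookup (lin_ext (\<lambda>\<mu>. split_zeros Q q k \<mu>) x) (?h \<nu>)" using z by simp
    also have "\<dots> = (\<Sum>\<mu>\<in>Poly_Mapping.keys x. if \<mu> = \<nu> then Poly_Mapping.lookup x \<mu> else 0)"
      unfolding lin_ext_def lookup_sum lookup_scale
      using x \<nu> by (intro sum.cong) (auto simp: look word_space_def)
    also have "\<dots> = Poly_Mapping.lookup x \<nu>" using \<nu> by (simp add: sum.delta')
    finally show ?thesis by simp
  qed
  then show "x = 0" by (intro poly_mapping_eqI) (metis in_keys_iff lookup_zero)
qed

lemma merge_split_test_vec:
  fixes q Q :: "'k::field"
  shows "lin_ext (merge_ones Q q 0) (lin_ext (split_zeros Q q 0) (test_vec Q q b l))
    = scale (\<Prod>i<l. 1 + (inverse Q / q ^ i)\<^sup>2) (test_vec Q q b l)"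
proof -
  define F where "F k x = lin_ext (merge_ones Q q k) (lin_ext (split_zeros Q q k) x)" for k x
  have F: "F k (pre 0 y) = scale (1 + (inverse Q / q ^ k)\<^sup>2) (pre 0 (F (Suc k) y))"
    "F k (pre 1 y) = pre 1 (F k y)" "F k (pre (-1) y) = pre (-1) (F k y)"
    "F k (x + y) = F k x + F k y" "F k (scale c x) = scale c (F k x)" for k x y c
    by (simp_all add: F_def split_zeros_pre merge_ones_pre mix_def lin_ext_add lin_ext_scale
        scale.scale_left_distrib power2_eq_square)
  have zeros: "F k (basis_vec (replicate l 0)) = scale (\<Prod>i<l. 1 + (inverse Q / q ^ (k + i))\<^sup>2) (basis_vec (replicate l 0))" for k
  proof (induction l arbitrary: k)
    case 0
    show ?case by (simp add: F_def)
  next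
    case (Suc l)
    have "F k (basis_vec (replicate (Suc l) 0)) = F k (pre 0 (basis_vec (replicate l 0)))" by simp
    also have "\<dots> = scale ((1 + (inverse Q / q ^ k)\<^sup>2) * (\<Prod>i<l. 1 + (inverse Q / q ^ (Suc k + i))\<^sup>2))
        (basis_vec (replicate (Suc l) 0))"
      unfolding F(1) Suc by (simp add: pre_simps)
    also have "(1 + (inverse Q / q ^ k)\<^sup>2) * (\<Prod>i<l. 1 + (inverse Q / q ^ (Suc k + i))\<^sup>2)
      = (\<Prod>i<Suc l. 1 + (inverse Q / q ^ (k + i))\<^sup>2)"
      unfolding prod.lessThan_Suc_shift by simp
    finally show ?case .
  qed
  have "F 0 (minus_vec Q q j b y) = minus_vec Q q j b (F 0 y)" for j y
    by (induction b arbitrary: j) (simp_all add: mix_def F flip: scale.scale_minus_left)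
  then show ?thesis
    using zeros[of 0] unfolding test_vec_def F_def[symmetric]
    by (simp add: module_hom.scale[OF lin_minus_vec])
qed

section \<open>The semisimplicity criterion\<close>

theorem theorem7p5p1:
  fixes q Q :: "'k::field" and n d :: nat
  assumes "q \<noteq> 0" and "Q \<noteq> 0" and "q\<^sup>2 \<noteq> 1"
    and "n \<ge> 1" and "d \<ge> 1"
    and "f_B d Q q \<noteq> 0"
  shows "semisimple_ring (schur_B Q q n d) \<longleftrightarrow>
           n = 1 \<or>
           \<not> root_of_unity q \<or>
           (\<exists>l. primitive_root_of_unity l (q\<^sup>2) \<and> d < l) \<or>
           n = 2"
proof -
  have sep: "Q powi (-2) + q powi (2 * i) \<noteq> 0" if "\<bar>i\<bar> < int d" for i
  proof -
    have "i \<in> {1 - int d..int d - 1}" using that by auto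
    then show ?thesis using assms(6) unfolding f_B_def by auto
  qed
  define R where "R \<longleftrightarrow> (\<forall>f. module_endo Q q n d f \<longrightarrow>
    (\<exists>g. module_endo Q q n d g \<and> (\<forall>x \<in> tensor_space n d. f (g (f x)) = f x)))"
  have generic: R if "\<And>j. 0 < j \<Longrightarrow> j \<le> d \<Longrightarrow> q ^ (2 * j) \<noteq> 1"
    unfolding R_def using regular_if_separated[OF assms(1,2) that sep] by blast
  have R if "n = 1" unfolding R_def using regular_one_letter that by blast
  moreover have R if "n = 2" unfolding R_def using regular_two_letters[OF assms(1,2) sep] that by blast
  moreover have R if no: "\<not> root_of_unity q"
  proof (rule generic)
    fix j :: nat assume "0 < j" "j \<le> d"
    then have "0 < 2 * j" by simp
    then show "q ^ (2 * j) \<noteq> 1" using no unfolding root_of_unity_def by blast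
  qed
  moreover have R if "primitive_root_of_unity l (q\<^sup>2)" "d < l" for l
  proof (rule generic)
    fix j :: nat assume "0 < j" "j \<le> d"
    then show "q ^ (2 * j) \<noteq> 1"
      using that by (auto simp: primitive_root_of_unity_def power_mult)
  qed
  moreover have "\<not> R"
    if n: "n \<noteq> 1" "n \<noteq> 2" and root: "root_of_unity q"
      and large: "\<nexists>l. primitive_root_of_unity l (q\<^sup>2) \<and> d < l"
  proof -
    obtain m where m: "m > 0" "q ^ m = 1" using root by (auto simp: root_of_unity_def)
    define l where "l = (LEAST l. l > 0 \<and> (q\<^sup>2) ^ l = 1)"
    have "(q\<^sup>2) ^ m = 1" using m(2) by (metis mult.commute power_mult power_one)
    then have l: "l > 0" "(q\<^sup>2) ^ l = 1" and least: "\<And>k. k > 0 \<Longrightarrow> (q\<^sup>2) ^ k = 1 \<Longrightarrow> l \<le> k"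
      using LeastI[of "\<lambda>l. l > 0 \<and> (q\<^sup>2) ^ l = 1" m] Least_le[of "\<lambda>l. l > 0 \<and> (q\<^sup>2) ^ l = 1"] m(1)
      unfolding l_def by auto
    then have "primitive_root_of_unity l (q\<^sup>2)"
      unfolding primitive_root_of_unity_def by (auto simp: not_le dest: least)
    then have ld: "l \<le> d" using large by (meson not_le)
    have ql: "q ^ (2 * l) = 1" using l(2) by (simp add: power_mult)
    have QQ: "inverse Q \<noteq> - Q"
    proof
      assume "inverse Q = - Q"
      then have "inverse Q * inverse Q = - 1" using assms(2) by (metis left_inverse mult_minus_left mult.commute minus_minus)
      then show False using sep[of 0] assms(5) by (simp add: power_int_minus power2_eq_square)
    qed
    have "n \<ge> 3" using n assms(4) by simp
    note transfer = not_regular_transfer[OF assms(1,3) ql assms(2) QQ _ ld, where n = n, folded R_def]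
    show ?thesis
    proof (cases "odd n")
      case True
      then have "{-1, 0, 1} \<subseteq> index_set n" using \<open>n \<ge> 3\<close> by (auto simp: index_set_def Let_def)
      note odd_transfer[OF this]
      note hom = this(1,2)[of Q q d] and id = this(3)
      have t: "test_vec Q q (d - l) l \<in> tensor_space 3 d"
      proof -
        have "basis_vec (replicate l 0) \<in> (word_space {-1, 0, 1} l :: (int list \<Rightarrow>\<^sub>0 'k) set)"
          by (intro word_space_basis_vec) (auto simp: set_replicate_conv_if)
        from word_space_minus_vec[OF this, of Q q 0 "d - l"] show ?thesis
          using ld unfolding tensor_space_eq index_set_3 test_vec_def by simp
      qed
      show ?thesis
        by (rule transfer[OF _ hom, where \<gamma> = 1]) (use l(1) id[OF t] in auto)
    next
      case False
      then have "n \<ge> 4" using \<open>n \<ge> 3\<close> by (cases "n = 3") auto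
      then have "2 \<le> n div 2" by simp
      then have "{1, -1, 2, -2} \<subseteq> index_set n" using False by (auto simp: index_set_def Let_def)
      note hom = split_zeros_hom[OF assms(1,2) this, of d] merge_ones_hom[OF assms(1,2), of n d]
      have "1 + (inverse Q / q ^ i)\<^sup>2 \<noteq> 0" if i: "i < l" for i
      proof
        assume "1 + (inverse Q / q ^ i)\<^sup>2 = 0"
        then have "(q ^ i)\<^sup>2 * (1 + (inverse Q / q ^ i)\<^sup>2) = 0" by simp
        then have "(q ^ i)\<^sup>2 + (inverse Q)\<^sup>2 = 0" using assms(1) by (simp add: distrib_left power_divide)
        moreover have "q powi (2 * int i) = (q ^ i)\<^sup>2"
          by (metis mult.commute of_nat_mult of_nat_numeral power_int_of_nat power_mult)
        moreover have "Q powi (-2) = (inverse Q)\<^sup>2" by (simp add: power_int_minus power_inverse)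
        ultimately show False using sep[of "int i"] i ld by (simp add: add.commute)
      qed
      then have "(\<Prod>i<l. 1 + (inverse Q / q ^ i)\<^sup>2) \<noteq> 0" by simp
      then show ?thesis
        by (intro transfer[OF _ hom _ _ merge_split_test_vec])
           (use l(1) split_zeros_inj[of Q q 0] in \<open>auto simp: tensor_space_eq index_set_3\<close>)
    qed
  qed
  ultimately show ?thesis
    unfolding semisimple_schur_B_iff[OF assms(1,2)] R_def[symmetric] by blast
qed

end
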